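(* Let $S$ be a compact connected oriented surface with $7$ boundary circles, and let $M_1=S\times T^2$, with boundary $3$-tori $T_{-3},T_{-2},\dots,T_3$, so that $\partial M_1=\bigcup_{i=-3}^{3}T_i$. Let $M$ be the $4$-dimensional generalized graph manifold with the single block $M_1$ and with boundary $\partial M=T_0$, obtained from $M_1$ by gluing $T_i$ to $T_{-i}$ by diffeomorphisms $\psi_i:T_i\to T_{-i}$, $i=1,2,3$, whose gluing matrices in some Waldhausen basis of $M_1$ are $$\Psi_i=\begin{pmatrix}1&1&i-1\\0&1&1\\0&3&2\end{pmatrix},\qquad i=1,2,3.$$ Then $M$ does not admit a geometrization.
   Context: Generalized graph manifolds (dimension $4$). A $4$-dimensional generalized graph manifold is a compact $4$-manifold glued from finitely many blocks $M_v\cong T^2\times S_v$ ($T^2$ the $2$-torus, $S_v$ a compact oriented surface with boundary and negative Euler characteristic) by diffeomorphisms between boundary $3$-tori of the blocks, which do not identify the homotopy classes of the fiber $2$-tori. Blocks may be glued to themselves and some boundary tori may remain unglued, forming $\partial M$. The decomposition into blocks is unique up to isotopy. Waldhausen basis of $M_1$ and gluing matrices. Let $L_i=H_1(T_i,\mathbb{Z})\simeq\mathbb{Z}^3$ for $-3\le i\le 3$, let $F=H_1(T^2,\mathbb{Z})\simeq\mathbb{Z}^2$ be the first homology of the fiber torus of $M_1$, and let $\iota^i:F\to L_i$ be the map induced by inclusion. A Waldhausen basis of $M_1$ is given by a basis $(f^1,f^2)$ of $F$ and classes $z_i\in L_i$, $-3\le i\le3$, such that the sum of the images of the $z_i$ in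 $H_1(M_1,\mathbb{Z})$ is $0$ and, for each $i$, $(z_i,f_i)=(z_i,\iota^if^1,\iota^if^2)$ is a basis of $L_i$. The gluing matrix $\Psi_i$ of $\psi_i$ is defined by $(z_{-i},f_{-i})=(z_i,f_i)\Psi_i$, where $L_i$ and $L_{-i}$ are identified by $(\psi_i)_*$. Geometrization. A geometrization of a block $M_v$ is a metric of nonpositive sectional curvature on $M_v$ such that all boundary $3$-tori of $M_v$ are flat and geodesic, and all fiber $2$-tori in $M_v$ are flat, geodesic and isometric. A geometrization of $M$ is a metric of nonpositive sectional curvature on $M$ which induces a geometrization on each of its blocks. *)

theory Defs
  imports "HOL-Analysis.Analysis" "HOL-Homology.Homology"
begin

section \<open>Smooth functions on subsets of Euclidean space\<close>

text \<open>\<open>Ck_on k W f\<close> is meant for open \<open>W\<close> only.\<close>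

primrec Ck_on ::
  "nat \<Rightarrow> 'e::euclidean_space set \<Rightarrow> ('e \<Rightarrow> 'f::real_normed_vector) \<Rightarrow> bool" where
  "Ck_on 0 W f \<longleftrightarrow> continuous_on W f"
| "Ck_on (Suc k) W f \<longleftrightarrow>
     f differentiable_on W \<and> (\<forall>v. Ck_on k W (\<lambda>x. frechet_derivative f (at x) v))"

text \<open>On an arbitrary set, smooth means: locally the restriction of a smooth function on an
  open set.\<close>

definition smooth_on ::
  "'e::euclidean_space set \<Rightarrow> ('e \<Rightarrow> 'f::real_normed_vector) \<Rightarrow> bool" where
  "smooth_on V f \<longleftrightarrow>
     (\<forall>x\<in>V. \<exists>W h. open W \<and> x \<in> W \<and> (\<forall>k. Ck_on k W h) \<and> (\<forall>y\<in>V \<inter> W. h y = f y))"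


section \<open>Smooth manifolds with boundary\<close>

text \<open>The chart maps its domain onto a relatively open subset of the closed half-space
  \<open>{x. 0 \<le> u \<bullet> x}\<close> with \<open>u = chalf c\<close>. For \<open>u = 0\<close> this is the whole model space,
  so interior charts need no separate treatment.\<close>

record ('a, 'e) chart =
  cdom :: "'a set"
  cmap :: "'a \<Rightarrow> 'e"
  chalf :: 'e

record ('a, 'e) mfd =
  mtop :: "'a topology"
  matlas :: "('a, 'e) chart set"

definition cimg :: "('a, 'e) chart \<Rightarrow> 'e set" where
  "cimg c = cmap c ` cdom c"

definition cinv :: "('a, 'e) chart \<Rightarrow> 'e \<Rightarrow> 'a" where
  "cinv c = the_inv_into (cdom c) (cmap c)"

definition is_chart :: "'a topology \<Rightarrow> ('a, 'e::euclidean_space) chart \<Rightarrow> bool" where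
  "is_chart X c \<longleftrightarrow>
     openin X (cdom c) \<and>
     openin (top_of_set {x. 0 \<le> chalf c \<bullet> x}) (cimg c) \<and>
     homeomorphic_map (subtopology X (cdom c)) (top_of_set (cimg c)) (cmap c)"

text \<open>The part of the image of \<open>c\<close> on which the coordinate expression of a map
  \<open>f\<close>, defined on the subset \<open>A\<close> of the source, makes sense.\<close>

definition loc_dom ::
  "('a, 'e) chart \<Rightarrow> ('b, 'f) chart \<Rightarrow> 'a set \<Rightarrow> ('a \<Rightarrow> 'b) \<Rightarrow> 'e set" where
  "loc_dom c d A f = cmap c ` (cdom c \<inter> A \<inter> f -` cdom d)"

definition loc_rep ::
  "('a, 'e) chart \<Rightarrow> ('b, 'f) chart \<Rightarrow> ('a \<Rightarrow> 'b) \<Rightarrow> 'e \<Rightarrow> 'f" where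
  "loc_rep c d f = cmap d \<circ> f \<circ> cinv c"

definition loc_deriv ::
  "('a, 'e::euclidean_space) chart \<Rightarrow> ('b, 'f::euclidean_space) chart \<Rightarrow> 'a set \<Rightarrow>
    ('a \<Rightarrow> 'b) \<Rightarrow> 'e \<Rightarrow> 'e \<Rightarrow> 'f" where
  "loc_deriv c d A f x = frechet_derivative (loc_rep c d f) (at x within loc_dom c d A f)"

definition smooth_manifold :: "('a, 'e::euclidean_space) mfd \<Rightarrow> bool" where
  "smooth_manifold M \<longleftrightarrow>
     Hausdorff_space (mtop M) \<and> second_countable (mtop M) \<and>
     (\<forall>c\<in>matlas M. is_chart (mtop M) c) \<and>
     (\<Union>c\<in>matlas M. cdom c) = topspace (mtop M) \<and>
     (\<forall>c\<in>matlas M. \<forall>d\<in>matlas M.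
        smooth_on (loc_dom c d (topspace (mtop M)) id) (loc_rep c d id))"

definition mboundary :: "('a, 'e::euclidean_space) mfd \<Rightarrow> 'a set" where
  "mboundary M =
     {p. \<exists>c\<in>matlas M. p \<in> cdom c \<and> chalf c \<noteq> 0 \<and> chalf c \<bullet> cmap c p = 0}"

text \<open>The manifold together with the orientation for which all charts of the given atlas are
  positive.\<close>

definition oriented_surface :: "('a, real^2) mfd \<Rightarrow> bool" where
  "oriented_surface S \<longleftrightarrow> smooth_manifold S \<and>
     (\<forall>c\<in>matlas S. \<forall>d\<in>matlas S. \<forall>p\<in>cdom c \<inter> cdom d.
        det (matrix (loc_deriv c d (topspace (mtop S)) id (cmap c p))) > 0)"

text \<open>Smoothness of a map defined on an arbitrary subset \<open>A\<close> of \<open>M\<close>: in charts it extends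
  locally to a smooth map. For submanifolds \<open>A\<close> and \<open>B\<close>, \<open>diffeo_betw\<close> therefore means
  diffeomorphic in the usual sense.\<close>

definition smooth_map_on ::
  "('a, 'e::euclidean_space) mfd \<Rightarrow> 'a set \<Rightarrow> ('b, 'f::euclidean_space) mfd \<Rightarrow> ('a \<Rightarrow> 'b) \<Rightarrow> bool"
  where
  "smooth_map_on M A N f \<longleftrightarrow>
     A \<subseteq> topspace (mtop M) \<and> continuous_map (subtopology (mtop M) A) (mtop N) f \<and>
     (\<forall>c\<in>matlas M. \<forall>d\<in>matlas N. smooth_on (loc_dom c d A f) (loc_rep c d f))"

definition diffeo_betw ::
  "('a, 'e::euclidean_space) mfd \<Rightarrow> 'a set \<Rightarrow> ('b, 'f::euclidean_space) mfd \<Rightarrow> 'b set \<Rightarrow>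
    ('a \<Rightarrow> 'b) \<Rightarrow> bool" where
  "diffeo_betw M A N B f \<longleftrightarrow>
     bij_betw f A B \<and> smooth_map_on M A N f \<and> smooth_map_on N B M (the_inv_into A f)"

definition immersion ::
  "('a, 'e::euclidean_space) mfd \<Rightarrow> ('b, 'f::euclidean_space) mfd \<Rightarrow> ('a \<Rightarrow> 'b) \<Rightarrow> bool" where
  "immersion M N f \<longleftrightarrow>
     smooth_map_on M (topspace (mtop M)) N f \<and>
     (\<forall>c\<in>matlas M. \<forall>d\<in>matlas N. \<forall>x\<in>loc_dom c d (topspace (mtop M)) f.
        inj (loc_deriv c d (topspace (mtop M)) f x))"

text \<open>Product manifold; the second factor is assumed to have empty boundary.\<close>

definition prod_chart ::
  "('a, 'e) chart \<Rightarrow> ('b, 'f::zero) chart \<Rightarrow> ('a \<times> 'b, 'e \<times> 'f) chart" where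
  "prod_chart c d =
     \<lparr>cdom = cdom c \<times> cdom d, cmap = map_prod (cmap c) (cmap d), chalf = (chalf c, 0)\<rparr>"

definition prod_mfd ::
  "('a, 'e) mfd \<Rightarrow> ('b, 'f::zero) mfd \<Rightarrow> ('a \<times> 'b, 'e \<times> 'f) mfd" where
  "prod_mfd M N =
     \<lparr>mtop = prod_topology (mtop M) (mtop N),
      matlas = {prod_chart c d | c d. c \<in> matlas M \<and> d \<in> matlas N}\<rparr>"

text \<open>The circle with its angular charts.\<close>

definition circle_chart :: "real \<Rightarrow> (complex, real) chart" where
  "circle_chart a =
     \<lparr>cdom = cis ` {a<..<a + 2 * pi}, cmap = the_inv_into {a<..<a + 2 * pi} cis, chalf = 0\<rparr>"

definition circle :: "(complex, real) mfd" where
  "circle = \<lparr>mtop = top_of_set (sphere 0 1), matlas = range circle_chart\<rparr>"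

definition torus2 :: "(complex \<times> complex, real \<times> real) mfd" where
  "torus2 = prod_mfd circle circle"

definition torus3 :: "(complex \<times> complex \<times> complex, real \<times> real \<times> real) mfd" where
  "torus3 = prod_mfd circle torus2"

definition euclid :: "('e, 'e::euclidean_space) mfd" where
  "euclid = \<lparr>mtop = euclidean, matlas = {\<lparr>cdom = UNIV, cmap = id, chalf = 0\<rparr>}\<rparr>"


section \<open>Riemannian metrics\<close>

text \<open>A metric is the family of its coordinate expressions: \<open>g c x v w\<close> is the scalar product,
  at the point with coordinates \<open>x\<close> in the chart \<open>c\<close>, of the tangent vectors with coordinates
  \<open>v\<close> and \<open>w\<close>.\<close>

type_synonym ('a, 'e) metric = "('a, 'e) chart \<Rightarrow> 'e \<Rightarrow> 'e \<Rightarrow> 'e \<Rightarrow> real"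

definition riemannian_metric ::
  "('a, 'e::euclidean_space) mfd \<Rightarrow> ('a, 'e) metric \<Rightarrow> bool" where
  "riemannian_metric M g \<longleftrightarrow>
     (\<forall>c\<in>matlas M.
        (\<forall>v w. smooth_on (cimg c) (\<lambda>x. g c x v w)) \<and>
        (\<forall>x\<in>cimg c. bilinear (g c x) \<and> (\<forall>v w. g c x v w = g c x w v) \<and>
                    (\<forall>v. v \<noteq> 0 \<longrightarrow> g c x v v > 0))) \<and>
     (\<forall>c\<in>matlas M. \<forall>d\<in>matlas M. \<forall>x\<in>loc_dom c d (topspace (mtop M)) id. \<forall>v w.
        g c x v w = g d (loc_rep c d id x)
                        (loc_deriv c d (topspace (mtop M)) id x v)
                        (loc_deriv c d (topspace (mtop M)) id x w))"

text \<open>Any chart around the image point gives the same value, so the choice does not matter.\<close>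

definition pullback ::
  "('a, 'e::euclidean_space) mfd \<Rightarrow> ('b, 'f::euclidean_space) mfd \<Rightarrow> ('a \<Rightarrow> 'b) \<Rightarrow>
    ('b, 'f) metric \<Rightarrow> ('a, 'e) metric" where
  "pullback N M j g = (\<lambda>c x v w.
     let d = (SOME d. d \<in> matlas M \<and> j (cinv c x) \<in> cdom d);
         D = loc_deriv c d (topspace (mtop N)) j x
     in g d (loc_rep c d j x) (D v) (D w))"

definition isometry_betw ::
  "('a, 'e::euclidean_space) mfd \<Rightarrow> ('a, 'e) metric \<Rightarrow> 'a set \<Rightarrow>
   ('b, 'f::euclidean_space) mfd \<Rightarrow> ('b, 'f) metric \<Rightarrow> 'b set \<Rightarrow> ('a \<Rightarrow> 'b) \<Rightarrow> bool" where
  "isometry_betw M g A N h B f \<longleftrightarrow>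
     openin (mtop M) A \<and> openin (mtop N) B \<and> diffeo_betw M A N B f \<and>
     (\<forall>c\<in>matlas M. \<forall>d\<in>matlas N. \<forall>x\<in>loc_dom c d A f. \<forall>v w.
        g c x v w = h d (loc_rep c d f x) (loc_deriv c d A f x v) (loc_deriv c d A f x w))"

text \<open>A metric (on a manifold without boundary) is flat if it is locally isometric to Euclidean
  space.\<close>

definition flat :: "('a, 'e::euclidean_space) mfd \<Rightarrow> ('a, 'e) metric \<Rightarrow> bool" where
  "flat M g \<longleftrightarrow>
     (\<forall>p\<in>topspace (mtop M). \<exists>U V f.
        p \<in> U \<and> isometry_betw M g U (euclid :: ('e, 'e) mfd) (\<lambda>c x v w. v \<bullet> w) V f)"

text \<open>The Levi-Civita connection in coordinates. Here \<open>V\<close> is the image of a chart and \<open>G\<close>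
  the metric in that chart. Derivatives are taken within \<open>V\<close>, which makes sense at boundary
  points also; \<open>christoffel V G x u v\<close> is the covariant derivative at \<open>x\<close> of the constant
  field \<open>v\<close> in direction \<open>u\<close> (Koszul formula).\<close>

definition dderiv ::
  "'e::euclidean_space set \<Rightarrow> ('e \<Rightarrow> 'f::real_normed_vector) \<Rightarrow> 'e \<Rightarrow> 'e \<Rightarrow> 'f" where
  "dderiv V f x v = frechet_derivative f (at x within V) v"

definition christoffel ::
  "'e::euclidean_space set \<Rightarrow> ('e \<Rightarrow> 'e \<Rightarrow> 'e \<Rightarrow> real) \<Rightarrow> 'e \<Rightarrow> 'e \<Rightarrow> 'e \<Rightarrow> 'e" where
  "christoffel V G x u v = (THE a. \<forall>w.
     2 * G x a w = dderiv V (\<lambda>y. G y v w) x u + dderiv V (\<lambda>y. G y u w) x v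
                   - dderiv V (\<lambda>y. G y u v) x w)"

text \<open>The curvature operator \<open>R(u,v)w = \<nabla>\<^sub>u\<nabla>\<^sub>vw - \<nabla>\<^sub>v\<nabla>\<^sub>uw\<close> for constant fields.\<close>

definition curvature_op ::
  "'e::euclidean_space set \<Rightarrow> ('e \<Rightarrow> 'e \<Rightarrow> 'e \<Rightarrow> real) \<Rightarrow> 'e \<Rightarrow> 'e \<Rightarrow> 'e \<Rightarrow> 'e \<Rightarrow> 'e" where
  "curvature_op V G x u v w =
     dderiv V (\<lambda>y. christoffel V G y v w) x u - dderiv V (\<lambda>y. christoffel V G y u w) x v
     + christoffel V G x u (christoffel V G x v w)
     - christoffel V G x v (christoffel V G x u w)"

definition sectional_curvature ::
  "'e::euclidean_space set \<Rightarrow> ('e \<Rightarrow> 'e \<Rightarrow> 'e \<Rightarrow> real) \<Rightarrow> 'e \<Rightarrow> 'e \<Rightarrow> 'e \<Rightarrow> real" where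
  "sectional_curvature V G x u v =
     G x (curvature_op V G x u v v) u / (G x u u * G x v v - (G x u v)\<^sup>2)"

definition nonpositively_curved ::
  "('a, 'e::euclidean_space) mfd \<Rightarrow> ('a, 'e) metric \<Rightarrow> bool" where
  "nonpositively_curved M g \<longleftrightarrow>
     (\<forall>c\<in>matlas M. \<forall>x\<in>cimg c. \<forall>u v. u \<noteq> v \<and> independent {u, v} \<longrightarrow>
        sectional_curvature (cimg c) (g c) x u v \<le> 0)"

definition geodesic ::
  "('a, 'e::euclidean_space) mfd \<Rightarrow> ('a, 'e) metric \<Rightarrow> real set \<Rightarrow> (real \<Rightarrow> 'a) \<Rightarrow> bool" where
  "geodesic M g I \<gamma> \<longleftrightarrow>
     continuous_map (top_of_set I) (mtop M) \<gamma> \<and>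
     (\<forall>c\<in>matlas M. \<exists>x'. \<forall>t\<in>I. \<gamma> t \<in> cdom c \<longrightarrow>
        ((cmap c \<circ> \<gamma>) has_vector_derivative x' t) (at t) \<and>
        (x' has_vector_derivative
           - christoffel (cimg c) (g c) (cmap c (\<gamma> t)) (x' t) (x' t)) (at t))"

text \<open>\<open>N\<close> immersed in \<open>M\<close> by \<open>j\<close> is totally geodesic: geodesics of the induced metric are
  geodesics of \<open>M\<close>.\<close>

definition totally_geodesic ::
  "('a, 'e::euclidean_space) mfd \<Rightarrow> ('b, 'f::euclidean_space) mfd \<Rightarrow> ('b, 'f) metric \<Rightarrow>
    ('a \<Rightarrow> 'b) \<Rightarrow> bool" where
  "totally_geodesic N M g j \<longleftrightarrow>
     (\<forall>I \<gamma>. open I \<and> is_interval I \<and> geodesic N (pullback N M j g) I \<gamma> \<longrightarrow>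
        geodesic M g I (j \<circ> \<gamma>))"


section \<open>A block and its self-gluings\<close>

text \<open>The boundary of \<open>S\<close> is the disjoint union of circles indexed by \<open>I\<close>, where \<open>\<kappa> i\<close>
  parametrizes the \<open>i\<close>-th one.\<close>

definition boundary_circles ::
  "('a, real^2) mfd \<Rightarrow> int set \<Rightarrow> (int \<Rightarrow> complex \<Rightarrow> 'a) \<Rightarrow> bool" where
  "boundary_circles S I \<kappa> \<longleftrightarrow>
     (\<forall>i\<in>I. diffeo_betw circle (sphere 0 1) S (\<kappa> i ` sphere 0 1) (\<kappa> i)) \<and>
     disjoint_family_on (\<lambda>i. \<kappa> i ` sphere 0 1) I \<and>
     (\<Union>i\<in>I. \<kappa> i ` sphere 0 1) = mboundary S"

definition block ::
  "('a, real^2) mfd \<Rightarrow> ('a \<times> complex \<times> complex, (real^2) \<times> real \<times> real) mfd" where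
  "block S = prod_mfd S torus2"

definition bd_param ::
  "(int \<Rightarrow> complex \<Rightarrow> 'a) \<Rightarrow> int \<Rightarrow> complex \<times> complex \<times> complex \<Rightarrow> 'a \<times> complex \<times> complex" where
  "bd_param \<kappa> i = map_prod (\<kappa> i) id"

definition bd_torus ::
  "(int \<Rightarrow> complex \<Rightarrow> 'a) \<Rightarrow> int \<Rightarrow> ('a \<times> complex \<times> complex) set" where
  "bd_torus \<kappa> i = bd_param \<kappa> i ` topspace (mtop torus3)"

definition bd_top ::
  "('a, real^2) mfd \<Rightarrow> (int \<Rightarrow> complex \<Rightarrow> 'a) \<Rightarrow> int \<Rightarrow> ('a \<times> complex \<times> complex) topology" where
  "bd_top S \<kappa> i = subtopology (mtop (block S)) (bd_torus \<kappa> i)"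

definition fiber :: "'a \<Rightarrow> complex \<times> complex \<Rightarrow> 'a \<times> complex \<times> complex" where
  "fiber s p = (s, p)"

text \<open>\<open>\<psi>\<close> glues \<open>T\<^sub>i\<close> to \<open>T\<^bsub>-i\<^esub>\<close> for \<open>i \<in> J\<close>, without identifying the homotopy classes of the
  fiber tori. A homotopy class of fibers is considered up to self-homeomorphisms of the
  2-torus, that is, unparametrized; the circle being connected, it does not depend on the point
  over which the fiber lies.\<close>

definition graph_gluing ::
  "('a, real^2) mfd \<Rightarrow> (int \<Rightarrow> complex \<Rightarrow> 'a) \<Rightarrow> int set \<Rightarrow>
    (int \<Rightarrow> 'a \<times> complex \<times> complex \<Rightarrow> 'a \<times> complex \<times> complex) \<Rightarrow> bool" where
  "graph_gluing S \<kappa> J \<psi> \<longleftrightarrow>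
     (\<forall>i\<in>J.
        diffeo_betw (block S) (bd_torus \<kappa> i) (block S) (bd_torus \<kappa> (- i)) (\<psi> i) \<and>
        \<not> (\<exists>h. homeomorphic_map (mtop torus2) (mtop torus2) h \<and>
               homotopic_with (\<lambda>_. True) (mtop torus2) (bd_top S \<kappa> (- i))
                 (\<psi> i \<circ> fiber (\<kappa> i 1)) (fiber (\<kappa> (- i) 1) \<circ> h)))"

text \<open>\<open>M\<close>, with the projection \<open>\<pi>\<close>, is the smooth manifold obtained from the block by the
  gluings \<open>\<psi>\<close>. The underlying space is the quotient; the smooth structure is any one for which
  the projection is a smooth immersion up to the boundary (it is unique up to diffeomorphism).\<close>

definition glued_manifold ::
  "('a, real^2) mfd \<Rightarrow> (int \<Rightarrow> complex \<Rightarrow> 'a) \<Rightarrow> int set \<Rightarrow>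
    (int \<Rightarrow> 'a \<times> complex \<times> complex \<Rightarrow> 'a \<times> complex \<times> complex) \<Rightarrow>
    ('b, real^4) mfd \<Rightarrow> ('a \<times> complex \<times> complex \<Rightarrow> 'b) \<Rightarrow> bool" where
  "glued_manifold S \<kappa> J \<psi> M \<pi> \<longleftrightarrow>
     smooth_manifold M \<and>
     quotient_map (mtop (block S)) (mtop M) \<pi> \<and>
     immersion (block S) M \<pi> \<and>
     (\<forall>x\<in>topspace (mtop (block S)). \<forall>y\<in>topspace (mtop (block S)).
        \<pi> x = \<pi> y \<longleftrightarrow>
          x = y \<or> (\<exists>i\<in>J. x \<in> bd_torus \<kappa> i \<and> y = \<psi> i x \<or> y \<in> bd_torus \<kappa> i \<and> x = \<psi> i y))"


section \<open>Waldhausen bases and gluing matrices\<close>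

definition zcomb :: "('g, 'x) monoid_scheme \<Rightarrow> ('i::finite \<Rightarrow> 'g) \<Rightarrow> ('i \<Rightarrow> int) \<Rightarrow> 'g" where
  "zcomb G b n = finprod G (\<lambda>k. b k [^]\<^bsub>G\<^esub> n k) UNIV"

definition zbasis :: "('g, 'x) monoid_scheme \<Rightarrow> ('i::finite \<Rightarrow> 'g) \<Rightarrow> bool" where
  "zbasis G b \<longleftrightarrow> range b \<subseteq> carrier G \<and> bij_betw (zcomb G b) UNIV (carrier G)"

definition fiber_hom ::
  "('a, real^2) mfd \<Rightarrow> (int \<Rightarrow> complex \<Rightarrow> 'a) \<Rightarrow> int \<Rightarrow>
    (complex \<times> complex) chain set \<Rightarrow> ('a \<times> complex \<times> complex) chain set" where
  "fiber_hom S \<kappa> i =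
     hom_induced 1 (mtop torus2) {} (bd_top S \<kappa> i) {} (fiber (\<kappa> i 1))"

text \<open>The triple \<open>(z\<^sub>i, \<iota>\<^sup>i f\<^sup>1, \<iota>\<^sup>i f\<^sup>2)\<close>.\<close>

definition bd_frame ::
  "('a, real^2) mfd \<Rightarrow> (int \<Rightarrow> complex \<Rightarrow> 'a) \<Rightarrow> (2 \<Rightarrow> (complex \<times> complex) chain set) \<Rightarrow>
    (int \<Rightarrow> ('a \<times> complex \<times> complex) chain set) \<Rightarrow> int \<Rightarrow> 3 \<Rightarrow> ('a \<times> complex \<times> complex) chain set"
  where
  "bd_frame S \<kappa> f z i k =
     (if k = 1 then z i else if k = 2 then fiber_hom S \<kappa> i (f 1) else fiber_hom S \<kappa> i (f 2))"

definition waldhausen_basis ::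
  "('a, real^2) mfd \<Rightarrow> int set \<Rightarrow> (int \<Rightarrow> complex \<Rightarrow> 'a) \<Rightarrow>
    (2 \<Rightarrow> (complex \<times> complex) chain set) \<Rightarrow> (int \<Rightarrow> ('a \<times> complex \<times> complex) chain set) \<Rightarrow> bool"
  where
  "waldhausen_basis S I \<kappa> f z \<longleftrightarrow>
     zbasis (homology_group 1 (mtop torus2)) f \<and>
     (\<forall>i\<in>I. zbasis (homology_group 1 (bd_top S \<kappa> i)) (bd_frame S \<kappa> f z i)) \<and>
     finprod (homology_group 1 (mtop (block S)))
       (\<lambda>i. hom_induced 1 (bd_top S \<kappa> i) {} (mtop (block S)) {} id (z i)) I
       = one (homology_group 1 (mtop (block S)))"

text \<open>\<open>(z\<^bsub>-i\<^esub>, f\<^bsub>-i\<^esub>) = (z\<^sub>i, f\<^sub>i) A\<close>, where the right-hand side is transported to \<open>T\<^bsub>-i\<^esub>\<close> by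
  the map induced by \<open>\<psi>\<^sub>i\<close>.\<close>

definition gluing_matrix ::
  "('a, real^2) mfd \<Rightarrow> (int \<Rightarrow> complex \<Rightarrow> 'a) \<Rightarrow>
    (int \<Rightarrow> 'a \<times> complex \<times> complex \<Rightarrow> 'a \<times> complex \<times> complex) \<Rightarrow>
    (2 \<Rightarrow> (complex \<times> complex) chain set) \<Rightarrow> (int \<Rightarrow> ('a \<times> complex \<times> complex) chain set) \<Rightarrow>
    int \<Rightarrow> int^3^3 \<Rightarrow> bool" where
  "gluing_matrix S \<kappa> \<psi> f z i A \<longleftrightarrow>
     (\<forall>k. bd_frame S \<kappa> f z (- i) k =
        hom_induced 1 (bd_top S \<kappa> i) {} (bd_top S \<kappa> (- i)) {} (\<psi> i)
          (zcomb (homology_group 1 (bd_top S \<kappa> i)) (bd_frame S \<kappa> f z i) (\<lambda>l. A $ l $ k)))"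


section \<open>Geometrizations\<close>

definition block_geometrization ::
  "('a, real^2) mfd \<Rightarrow> int set \<Rightarrow> (int \<Rightarrow> complex \<Rightarrow> 'a) \<Rightarrow>
    ('a \<times> complex \<times> complex, (real^2) \<times> real \<times> real) metric \<Rightarrow> bool" where
  "block_geometrization S I \<kappa> g \<longleftrightarrow>
     riemannian_metric (block S) g \<and> nonpositively_curved (block S) g \<and>
     (\<forall>i\<in>I. flat torus3 (pullback torus3 (block S) (bd_param \<kappa> i) g) \<and>
             totally_geodesic torus3 (block S) g (bd_param \<kappa> i)) \<and>
     (\<forall>s\<in>topspace (mtop S).
        flat torus2 (pullback torus2 (block S) (fiber s) g) \<and>
        totally_geodesic torus2 (block S) g (fiber s)) \<and>
     (\<forall>s\<in>topspace (mtop S). \<forall>t\<in>topspace (mtop S). \<exists>h.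
        isometry_betw
          torus2 (pullback torus2 (block S) (fiber s) g) (topspace (mtop torus2))
          torus2 (pullback torus2 (block S) (fiber t) g) (topspace (mtop torus2)) h)"

definition geometrization ::
  "('a, real^2) mfd \<Rightarrow> int set \<Rightarrow> (int \<Rightarrow> complex \<Rightarrow> 'a) \<Rightarrow>
    ('b, real^4) mfd \<Rightarrow> ('a \<times> complex \<times> complex \<Rightarrow> 'b) \<Rightarrow> ('b, real^4) metric \<Rightarrow> bool" where
  "geometrization S I \<kappa> M \<pi> g \<longleftrightarrow>
     riemannian_metric M g \<and> nonpositively_curved M g \<and>
     block_geometrization S I \<kappa> (pullback (block S) M \<pi> g)"

end

theory Submission
  imports Defs
begin

text \<open>A flat metric on a torus, seen on the universal cover, has a developing map, which is affine up
  to a bounded error; its linear part \<open>P\<close> gives the length \<open>|P v|\<close> of a closed geodesic with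
  homology class \<open>v\<close>. All fiber tori of a geometrized block have the same length form: the lengths of
  a fixed class vary continuously with the fiber, but since the fibers are isometric they lie in a
  countable set. Fibers being totally geodesic in the boundary tori, the length form of
  each boundary torus restricts to this common form \<open>q\<close> on the fiber classes, and the
  gluings, being isometries of boundary tori, preserve length. The third column of \<open>\<Psi>\<^sub>1\<close> gives
  \<open>q(f\<^sup>2) = q(f\<^sup>1 + 2 f\<^sup>2)\<close>, and the difference of the last two columns of \<open>\<Psi>\<^sub>2\<close> gives
  \<open>q(f\<^sup>1 - f\<^sup>2) = q(f\<^sup>2)\<close>. Hence \<open>q(f\<^sup>1) = 2\<langle>f\<^sup>1, f\<^sup>2\<rangle>\<close> and \<open>q(f\<^sup>1) + q(f\<^sup>2) = 0\<close>, which is impossible for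
  a positive definite form.\<close>

section \<open>Developing maps\<close>

text \<open>Completeness of the torus enters as surjectivity of \<open>D\<close>. This forces the
  holonomy to consist of translations, because an orthogonal map that moves all points by a bounded
  distance is the identity. That fibers are totally geodesic is exploited through the Koszul
  formula: the part of an acceleration tangent to a boundary torus depends on the induced metric
  alone, so fiber geodesics develop to straight lines there. The columns are chosen so that the
  class z cancels, since the common form says nothing about its length: the entry i - 1 vanishes for
  i = 1, and for i = 2 the last two columns both contain z exactly once.\<close>

text \<open>Local injectivity is demanded outright: \<open>D\<close> is merely differentiable, so
  the inverse function theorem is not at hand, while invariance of domain is. Positivity of
  \<open>G\<close> makes the differential injective.\<close>

definition developing ::
  "('e::euclidean_space \<Rightarrow> 'e \<Rightarrow> 'e \<Rightarrow> real) \<Rightarrow> 'e set \<Rightarrow> ('e \<Rightarrow> 'e) \<Rightarrow> bool" where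
  "developing G W D \<longleftrightarrow> open W \<and>
     (\<forall>x\<in>W. (\<exists>D'. (D has_derivative D') (at x) \<and> (\<forall>u v. D' u \<bullet> D' v = G x u v)) \<and>
            (\<exists>U. open U \<and> x \<in> U \<and> inj_on D U) \<and> (\<forall>v. v \<noteq> 0 \<longrightarrow> G x v v > 0))"

lemma developing_open: "developing G W D \<Longrightarrow> open W"
  by (simp add: developing_def)

lemma developing_derivative:
  assumes "developing G W D" "x \<in> W"
  obtains D' where "(D has_derivative D') (at x)" "\<And>u v. D' u \<bullet> D' v = G x u v"
  using assms unfolding developing_def by blast

lemma developing_continuous_on: "developing G W D \<Longrightarrow> continuous_on W D"
  unfolding developing_def
  by (meson continuous_at_imp_continuous_on has_derivative_continuous)

lemma developing_subset: "developing G W D \<Longrightarrow> open V \<Longrightarrow> V \<subseteq> W \<Longrightarrow> developing G V D"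
  unfolding developing_def by blast

lemma developing_congruent:
  assumes "developing G W D" "\<And>x. x \<in> W \<Longrightarrow> D2 x = D x"
  shows "developing G W D2"
  unfolding developing_def
proof (intro conjI ballI)
  show W: "open W" using assms(1) by (rule developing_open)
  fix x assume x: "x \<in> W"
  show "\<exists>D'. (D2 has_derivative D') (at x) \<and> (\<forall>u v. D' u \<bullet> D' v = G x u v)"
    using developing_derivative[OF assms(1) x] assms(2) W x
    by (metis has_derivative_transform_within_open)
  obtain U where U: "open U" "x \<in> U" "inj_on D U"
    using assms(1) x unfolding developing_def by blast
  then show "\<exists>U. open U \<and> x \<in> U \<and> inj_on D2 U"
    using W x assms(2) by (intro exI[of _ "U \<inter> W"]) (auto simp: inj_on_def)
  show "\<forall>v. v \<noteq> 0 \<longrightarrow> G x v v > 0" using assms(1) x unfolding developing_def by blast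
qed

lemma developing_Un:
  assumes "developing G V D" "developing G W D"
  shows "developing G (V \<union> W) D"
  using assms unfolding developing_def by blast

lemma developing_Union:
  assumes "\<And>i. i \<in> I \<Longrightarrow> developing G (V i) D"
  shows "developing G (\<Union>i\<in>I. V i) D"
  using assms unfolding developing_def by blast

text \<open>Invariance of domain makes the locally injective \<open>D\<close> open, and its local
  inverse is differentiable because the differential of \<open>D\<close> is invertible. The image is
  cut down to a ball since the mean value inequality needs a convex domain.\<close>

lemma developing_section:
  fixes D :: "'e::euclidean_space \<Rightarrow> 'e"
  assumes D: "developing G W D" and x: "x \<in> W" and N: "open N" "x \<in> N"
  obtains U r \<sigma> where "open U" "x \<in> U" "U \<subseteq> W \<inter> N" "r > 0"
    "homeomorphism U (ball (D x) r) D \<sigma>"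
    "\<And>y. y \<in> ball (D x) r \<Longrightarrow> \<exists>s'. (\<sigma> has_derivative s') (at y) \<and> (\<forall>u v. G (\<sigma> y) (s' u) (s' v) = u \<bullet> v)"
proof -
  obtain U0 where U0: "open U0" "x \<in> U0" "inj_on D U0"
    using D x unfolding developing_def by blast
  define U1 where "U1 = U0 \<inter> W \<inter> N"
  have U1: "open U1" "x \<in> U1" "inj_on D U1" "U1 \<subseteq> W" "U1 \<subseteq> N"
    using U0 x N developing_open[OF D] by (auto simp: U1_def inj_on_def)
  have c1: "continuous_on U1 D"
    using developing_continuous_on[OF D] U1(4) continuous_on_subset by blast
  have o1: "open (D ` U1)" by (rule invariance_of_domain[OF c1 U1(1) U1(3)])
  obtain \<sigma> where h1: "homeomorphism U1 (D ` U1) D \<sigma>"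
    using invariance_of_domain_homeomorphism[OF U1(1) c1 _ U1(3)] by auto
  obtain r where r: "r > 0" "ball (D x) r \<subseteq> D ` U1"
    using o1 U1(2) open_contains_ball by (metis imageI)
  define U where "U = U1 \<inter> D -` ball (D x) r"
  have oU: "open U" unfolding U_def
    using continuous_open_preimage[OF c1 U1(1)] open_ball by blast
  have U_eq: "U = \<sigma> ` ball (D x) r"
    using h1 r(2) unfolding U_def homeomorphism_def by (force simp: image_iff)
  have hU: "homeomorphism U (ball (D x) r) D \<sigma>"
  proof (rule homeomorphism_of_subsets[OF h1])
    show "U \<subseteq> U1" by (auto simp: U_def)
    show "ball (D x) r \<subseteq> D ` U1" by fact
    show "D ` U = ball (D x) r" unfolding U_def using r(2) by auto
  qed
  have deriv: "\<exists>s'. (\<sigma> has_derivative s') (at y) \<and> (\<forall>u v. G (\<sigma> y) (s' u) (s' v) = u \<bullet> v)"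
    if y: "y \<in> ball (D x) r" for y
  proof -
    have sU: "\<sigma> y \<in> U" using hU y unfolding homeomorphism_def by blast
    then have sW: "\<sigma> y \<in> W" using U1(4) by (auto simp: U_def)
    obtain D' where D': "(D has_derivative D') (at (\<sigma> y))" "\<And>u v. D' u \<bullet> D' v = G (\<sigma> y) u v"
      using developing_derivative[OF D sW] by blast
    have lin: "linear D'" using D'(1) has_derivative_linear by blast
    have "inj D'"
    proof (subst linear_injective_0[OF lin], intro allI impI)
      fix v assume "D' v = 0"
      then have "G (\<sigma> y) v v = 0" using D'(2)[of v v] by simp
      then show "v = 0" using D sW unfolding developing_def by (metis less_irrefl)
    qed
    then obtain s' where s': "linear s'" "s' \<circ> D' = id" "D' \<circ> s' = id"
      using linear_injective_isomorphism[OF lin] by (metis linear_injective_left_inverse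
          left_right_inverse_eq linear_injective_imp_surjective lin linear_surjective_right_inverse)
    have bs: "bounded_linear s'" using s'(1) linear_conv_bounded_linear by blast
    have cs: "continuous (at y) \<sigma>"
      using hU y open_ball unfolding homeomorphism_def
      by (metis continuous_on_eq_continuous_at)
    have "(\<sigma> has_derivative s') (at y)"
      by (rule has_derivative_inverse_basic[OF D'(1) bs s'(2) cs open_ball[of "D x" r] y])
         (use hU in \<open>auto simp: homeomorphism_def\<close>)
    moreover have "G (\<sigma> y) (s' u) (s' v) = u \<bullet> v" for u v
      using D'(2)[of "s' u" "s' v"] s'(3) by (metis comp_apply id_apply)
    ultimately show ?thesis by blast
  qed
  show ?thesis
  proof (rule that[of U r \<sigma>])
    show "x \<in> U" using U1(2) r(1) by (auto simp: U_def)
    show "U \<subseteq> W \<inter> N" using U1 by (auto simp: U_def)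
  qed (use oU r hU deriv in auto)
qed

text \<open>In the coordinates given by \<open>D\<close> the metric is Euclidean, so the bound on
  \<open>f'\<close> says that \<open>f \<circ> \<sigma>\<close> has a differential of norm at most
  \<open>C\<close> on a convex ball.\<close>

lemma lipschitz_along_section:
  fixes D :: "'e::euclidean_space \<Rightarrow> 'e" and f :: "'e \<Rightarrow> 'f::real_inner"
  assumes h: "homeomorphism U (ball c r) D \<sigma>"
    and s: "\<And>y. y \<in> ball c r \<Longrightarrow> \<exists>s'. (\<sigma> has_derivative s') (at y) \<and> (\<forall>u v. G (\<sigma> y) (s' u) (s' v) = u \<bullet> v)"
    and f: "\<And>z. z \<in> U \<Longrightarrow> \<exists>f'. (f has_derivative f') (at z) \<and> (\<forall>v. f' v \<bullet> f' v \<le> C\<^sup>2 * G z v v)"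
    and C: "C \<ge> 0" and ab: "a \<in> U" "b \<in> U"
  shows "norm (f a - f b) \<le> C * norm (D a - D b)"
proof -
  have "\<exists>g'. ((f \<circ> \<sigma>) has_derivative g') (at y within ball c r) \<and> onorm g' \<le> C" if y: "y \<in> ball c r" for y
  proof -
    have yU: "\<sigma> y \<in> U" using h y unfolding homeomorphism_def by blast
    obtain s' where s': "(\<sigma> has_derivative s') (at y)" "\<And>u v. G (\<sigma> y) (s' u) (s' v) = u \<bullet> v"
      using s[OF y] by blast
    obtain f' where f': "(f has_derivative f') (at (\<sigma> y))" "\<And>v. f' v \<bullet> f' v \<le> C\<^sup>2 * G (\<sigma> y) v v"
      using f[OF yU] by blast
    have "((f \<circ> \<sigma>) has_derivative (f' \<circ> s')) (at y)"
      by (rule diff_chain_at[OF s'(1) f'(1)])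
    moreover have "onorm (f' \<circ> s') \<le> C"
    proof (rule onorm_bound[OF C])
      fix v
      have "(norm (f' (s' v)))\<^sup>2 \<le> (C * norm v)\<^sup>2"
        using f'(2)[of "s' v"] s'(2)[of v v] by (simp add: power2_norm_eq_inner power_mult_distrib)
      then show "norm ((f' \<circ> s') v) \<le> C * norm v"
        using power2_le_imp_le[of "norm (f' (s' v))" "C * norm v"] C by simp
    qed
    ultimately show ?thesis using has_derivative_at_withinI by blast
  qed
  then obtain g' where g': "\<And>y. y \<in> ball c r \<Longrightarrow> ((f \<circ> \<sigma>) has_derivative g' y) (at y within ball c r)"
      "\<And>y. y \<in> ball c r \<Longrightarrow> onorm (g' y) \<le> C" by metis
  have "D a \<in> ball c r" "D b \<in> ball c r" using h ab unfolding homeomorphism_def by blast+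
  then have "norm ((f \<circ> \<sigma>) (D a) - (f \<circ> \<sigma>) (D b)) \<le> C * norm (D a - D b)"
    using differentiable_bound[of "ball c r" "f \<circ> \<sigma>" g' C "D a" "D b"] g' by (simp add: convex_ball)
  moreover have "\<sigma> (D a) = a" "\<sigma> (D b) = b" using h ab unfolding homeomorphism_def by blast+
  ultimately show ?thesis by simp
qed

section \<open>Uniqueness of developing maps up to rigid motions\<close>

text \<open>Polarization turns preserved distances into preserved inner products of vectors from the
  centre. The images of a small multiple of the standard basis, rescaled, are then orthonormal and
  define \<open>L\<close>.\<close>

lemma isometry_on_ball_affine:
  fixes f :: "'e::euclidean_space \<Rightarrow> 'e"
  assumes r: "r > 0"
    and iso: "\<And>a b. a \<in> ball c r \<Longrightarrow> b \<in> ball c r \<Longrightarrow> norm (f a - f b) = norm (a - b)"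
  obtains L where "orthogonal_transformation L" "\<And>y. y \<in> ball c r \<Longrightarrow> f y = f c + L (y - c)"
proof -
  define g where "g w = f (c + w) - f c" for w
  have nd: "norm (g u - g v) = norm (u - v)" if "norm u < r" "norm v < r" for u v
    using iso[of "c + u" "c + v"] that by (simp add: g_def dist_norm)
  have g0: "g 0 = 0" by (simp add: g_def)
  have ng: "norm (g u) = norm u" if "norm u < r" for u
    using nd[OF that, of 0] r by (simp add: g0)
  have gi: "g u \<bullet> g v = u \<bullet> v" if "norm u < r" "norm v < r" for u v
  proof -
    have "(norm (g u - g v))\<^sup>2 = (norm (u - v))\<^sup>2" using nd that by simp
    moreover have "g u \<bullet> g u = u \<bullet> u" "g v \<bullet> g v = v \<bullet> v"
      using ng[OF that(1)] ng[OF that(2)] by (simp_all flip: power2_norm_eq_inner)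
    ultimately show ?thesis
      by (simp add: power2_norm_eq_inner inner_diff_left inner_diff_right inner_commute)
  qed
  \<comment> \<open>The factor brings the basis vectors into the ball; dividing by it in
    \<open>e\<close> restores unit length.\<close>
  define t where "t = r / 2"
  have t: "t > 0" "t < r" using r by (auto simp: t_def)
  define e where "e b = g (t *\<^sub>R b) /\<^sub>R t" for b
  define L where "L w = (\<Sum>b\<in>Basis. (w \<bullet> b) *\<^sub>R e b)" for w
  have linL: "linear L" unfolding L_def
    by (intro linearI) (simp_all add: inner_add_left scaleR_add_left sum.distrib scaleR_sum_right)
  have nb: "norm (t *\<^sub>R b) < r" if "b \<in> Basis" for b using that t by simp
  have ee: "e b \<bullet> e b' = (if b = b' then 1 else 0)" if "b \<in> Basis" "b' \<in> Basis" for b b'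
    using gi[OF nb[OF that(1)] nb[OF that(2)]] t that by (simp add: e_def inner_Basis field_simps)
  have eu: "g u \<bullet> e b = u \<bullet> b" if "norm u < r" "b \<in> Basis" for u b
    using gi[OF that(1) nb[OF that(2)]] t by (simp add: e_def field_simps)
  have Lu: "g u \<bullet> L w = u \<bullet> w" if "norm u < r" for u w
  proof -
    have "g u \<bullet> L w = (\<Sum>b\<in>Basis. (w \<bullet> b) * (u \<bullet> b))"
      unfolding L_def inner_sum_right by (intro sum.cong) (auto simp: eu that)
    also have "\<dots> = u \<bullet> w" by (metis (mono_tags, lifting) euclidean_inner inner_commute sum.cong)
    finally show ?thesis .
  qed
  have LL: "L u \<bullet> L w = u \<bullet> w" for u w
  proof -
    have "e b \<bullet> L w = w \<bullet> b" if "b \<in> Basis" for b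
      using Lu[OF nb[OF that], of w] t by (simp add: e_def inner_commute field_simps)
    then have "L u \<bullet> L w = (\<Sum>b\<in>Basis. (u \<bullet> b) * (w \<bullet> b))"
      unfolding L_def[of u] inner_sum_left by (intro sum.cong) auto
    then show ?thesis by (metis (mono_tags, lifting) euclidean_inner sum.cong)
  qed
  have orth: "orthogonal_transformation L" using linL LL by (simp add: orthogonal_transformation_def)
  have "g u = L u" if "norm u < r" for u
  proof -
    have "(g u - L u) \<bullet> (g u - L u) = 0"
      using gi[OF that that] Lu[OF that, of u] LL[of u u]
      by (simp add: inner_diff_left inner_diff_right inner_commute)
    then show ?thesis by simp
  qed
  then have "f y = f c + L (y - c)" if "y \<in> ball c r" for y
    using that g_def[of "y - c"] by (auto simp: dist_norm norm_minus_commute algebra_simps)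
  then show ?thesis using that orth by blast
qed

text \<open>Each of the two maps is 1-Lipschitz with respect to the other, so
  \<open>D1 \<circ> \<sigma>2\<close> preserves distances on a ball.\<close>

lemma developing_unique_local:
  fixes D1 D2 :: "'e::euclidean_space \<Rightarrow> 'e"
  assumes D1: "developing G W1 D1" and D2: "developing G W2 D2" and x: "x \<in> W1" "x \<in> W2"
  obtains U L b where "open U" "x \<in> U" "U \<subseteq> W1 \<inter> W2" "orthogonal_transformation L"
    "\<And>y. y \<in> U \<Longrightarrow> D1 y = L (D2 y) + b"
proof -
  obtain U1 r1 \<sigma>1 where s1: "open U1" "x \<in> U1" "U1 \<subseteq> W1 \<inter> W2" "r1 > 0"
    "homeomorphism U1 (ball (D1 x) r1) D1 \<sigma>1"
    "\<And>y. y \<in> ball (D1 x) r1 \<Longrightarrow> \<exists>s'. (\<sigma>1 has_derivative s') (at y) \<and> (\<forall>u v. G (\<sigma>1 y) (s' u) (s' v) = u \<bullet> v)"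
    using developing_section[OF D1 x(1) developing_open[OF D2] x(2)] by metis
  \<comment> \<open>This neighbourhood is chosen inside \<open>U1\<close>, so that both Lipschitz
    estimates hold on it.\<close>
  obtain U2 r2 \<sigma>2 where s2: "open U2" "x \<in> U2" "U2 \<subseteq> W2 \<inter> U1" "r2 > 0"
    "homeomorphism U2 (ball (D2 x) r2) D2 \<sigma>2"
    "\<And>y. y \<in> ball (D2 x) r2 \<Longrightarrow> \<exists>s'. (\<sigma>2 has_derivative s') (at y) \<and> (\<forall>u v. G (\<sigma>2 y) (s' u) (s' v) = u \<bullet> v)"
    using developing_section[OF D2 x(2) s1(1) s1(2)] by metis
  have f1: "\<exists>f'. (D1 has_derivative f') (at z) \<and> (\<forall>v. f' v \<bullet> f' v \<le> 1\<^sup>2 * G z v v)" if "z \<in> U2" for z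
    using developing_derivative[OF D1, of z] that s1(3) s2(3) by (metis IntD1 mult_1 order_refl power_one subsetD IntD2)
  have f2: "\<exists>f'. (D2 has_derivative f') (at z) \<and> (\<forall>v. f' v \<bullet> f' v \<le> 1\<^sup>2 * G z v v)" if "z \<in> U1" for z
    using developing_derivative[OF D2, of z] that s1(3) by (metis IntD2 mult_1 order_refl power_one subsetD)
  have eq: "norm (D1 a - D1 b) = norm (D2 a - D2 b)" if "a \<in> U2" "b \<in> U2" for a b
    using lipschitz_along_section[where G = G and C = 1, OF s2(5,6) f1 _ that]
      lipschitz_along_section[where G = G and C = 1, OF s1(5,6) f2 _ , of a b] that s2(3) by fastforce
  have inU: "\<sigma>2 y \<in> U2" "D2 (\<sigma>2 y) = y" if "y \<in> ball (D2 x) r2" for y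
    using s2(5) that unfolding homeomorphism_def by blast+
  obtain L where L: "orthogonal_transformation L"
     "\<And>y. y \<in> ball (D2 x) r2 \<Longrightarrow> (D1 \<circ> \<sigma>2) y = (D1 \<circ> \<sigma>2) (D2 x) + L (y - D2 x)"
    using isometry_on_ball_affine[OF s2(4), of "D2 x" "D1 \<circ> \<sigma>2"] eq inU by (metis comp_apply)
  have "D1 y = L (D2 y) + (D1 x - L (D2 x))" if "y \<in> U2" for y
  proof -
    have 1: "\<sigma>2 (D2 y) = y" "\<sigma>2 (D2 x) = x" "D2 y \<in> ball (D2 x) r2"
      using s2(5) that s2(2) unfolding homeomorphism_def by blast+
    show ?thesis using L(2)[OF 1(3)] 1(1,2) linear_diff[OF orthogonal_transformation_linear[OF L(1)]] by simp
  qed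
  then show ?thesis using that[of U2 L] s1(3) s2(1-3) L(1) by blast
qed

lemma developing_affine:
  assumes D: "developing G W D" and L: "orthogonal_transformation L"
  shows "developing G W (\<lambda>x. L (D x) + b)"
  unfolding developing_def
proof (intro conjI ballI)
  show "open W" using D by (rule developing_open)
  fix x assume x: "x \<in> W"
  obtain D' where D': "(D has_derivative D') (at x)" "\<And>u v. D' u \<bullet> D' v = G x u v"
    using developing_derivative[OF D x] by blast
  have bl: "bounded_linear L" using orthogonal_transformation_linear[OF L] linear_conv_bounded_linear by blast
  have "((\<lambda>x. L (D x) + b) has_derivative (\<lambda>v. L (D' v))) (at x)"
    using has_derivative_add[OF bounded_linear.has_derivative[OF bl D'(1)] has_derivative_const, of b] by simp
  moreover have "L (D' u) \<bullet> L (D' v) = G x u v" for u v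
    using L D'(2) by (simp add: orthogonal_transformation_def)
  ultimately show "\<exists>D''. ((\<lambda>x. L (D x) + b) has_derivative D'') (at x) \<and> (\<forall>u v. D'' u \<bullet> D'' v = G x u v)"
    by blast
  obtain U where U: "open U" "x \<in> U" "inj_on D U"
    using D x unfolding developing_def by blast
  have "inj L" using orthogonal_transformation_inj[OF L] .
  then have "inj_on (\<lambda>x. L (D x) + b) U" using U(3) by (auto simp: inj_on_def)
  then show "\<exists>U. open U \<and> x \<in> U \<and> inj_on (\<lambda>x. L (D x) + b) U" using U by blast
  show "\<forall>v. v \<noteq> 0 \<longrightarrow> G x v v > 0" using D x unfolding developing_def by blast
qed

text \<open>The image of \<open>V\<close> under \<open>D\<close> contains a ball, and an affine map
  is determined by its values on a ball.\<close>

lemma developing_affine_agree: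
  fixes D :: "'e::euclidean_space \<Rightarrow> 'e"
  assumes D: "developing G W D" and V: "open V" "V \<noteq> {}" "V \<subseteq> W"
    and L: "linear L" "linear L'"
    and eq: "\<And>x. x \<in> V \<Longrightarrow> L (D x) + b = L' (D x) + b'"
  shows "L = L'" "b = b'"
proof -
  obtain x where x: "x \<in> V" using V by blast
  obtain U r \<sigma> where U: "open U" "x \<in> U" "U \<subseteq> W \<inter> V" "r > 0" "homeomorphism U (ball (D x) r) D \<sigma>"
    using developing_section[OF D subsetD[OF V(3) x] V(1) x] by metis
  have eqb: "L y + b = L' y + b'" if y: "y \<in> ball (D x) r" for y
  proof -
    have "\<sigma> y \<in> U" "D (\<sigma> y) = y" using U(5) y unfolding homeomorphism_def by blast+
    then show ?thesis using eq[of "\<sigma> y"] U(3) by auto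
  qed
  have c: "L (D x) + b = L' (D x) + b'" using eqb U(4) by simp
  show LL: "L = L'"
  proof
    fix v
    show "L v = L' v"
    proof (cases "v = 0")
      case True then show ?thesis using L by (simp add: linear_0)
    next
      case False
      define t where "t = r / (2 * norm v)"
      have t: "t > 0" using False U(4) by (simp add: t_def)
      have "D x + t *\<^sub>R v \<in> ball (D x) r" using False U(4) t by (simp add: dist_norm t_def)
      from eqb[OF this] have e: "L (D x) + t *\<^sub>R L v + b = L' (D x) + t *\<^sub>R L' v + b'"
        by (simp only: linear_add[OF L(1)] linear_add[OF L(2)] linear_scale[OF L(1)] linear_scale[OF L(2)])
      have "t *\<^sub>R L v = (L (D x) + t *\<^sub>R L v + b) - (L (D x) + b)" by simp
      also have "\<dots> = t *\<^sub>R L' v" unfolding e c by simp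
      finally have "t *\<^sub>R L v = t *\<^sub>R L' v" .
      then show ?thesis using t by simp
    qed
  qed
  show "b = b'" using c LL by simp
qed

lemma developing_unique:
  fixes D1 D2 :: "'e::euclidean_space \<Rightarrow> 'e"
  assumes D1: "developing G W D1" and D2: "developing G W D2" and W: "connected W"
  obtains L b where "orthogonal_transformation L" "\<And>x. x \<in> W \<Longrightarrow> D1 x = L (D2 x) + b"
proof (cases "W = {}")
  case True
  then show ?thesis using that[of "\<lambda>x. x"] orthogonal_transformation_id by blast
next
  case False
  then obtain x0 where x0: "x0 \<in> W" by blast
  obtain U0 L b where U0: "open U0" "x0 \<in> U0" "U0 \<subseteq> W" "orthogonal_transformation L"
    "\<And>y. y \<in> U0 \<Longrightarrow> D1 y = L (D2 y) + b"
    using developing_unique_local[OF D1 D2 x0 x0] by (metis inf.idem)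
  have lL: "linear L" by (rule orthogonal_transformation_linear[OF U0(4)])
  \<comment> \<open>\<open>S\<close> is where the affine relation found near \<open>x0\<close>
    persists. A neighbourhood with a local relation either meets \<open>S\<close>, and then has the
    same relation, or is disjoint from \<open>S\<close>; hence \<open>S\<close> and \<open>T\<close>
    cover the connected \<open>W\<close>.\<close>
  define S where "S = \<Union>{U. open U \<and> U \<subseteq> W \<and> (\<forall>y\<in>U. D1 y = L (D2 y) + b)}"
  define T where "T = \<Union>{U. open U \<and> U \<subseteq> W \<and> U \<inter> S = {}}"
  have oS: "open S" and oT: "open T" unfolding S_def T_def by (auto intro: open_Union)
  have "W \<subseteq> S \<union> T"
  proof
    fix x assume x: "x \<in> W"
    obtain U L' b' where U: "open U" "x \<in> U" "U \<subseteq> W" "orthogonal_transformation L'"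
      "\<And>y. y \<in> U \<Longrightarrow> D1 y = L' (D2 y) + b'"
      using developing_unique_local[OF D1 D2 x x] by (metis inf.idem)
    have lL': "linear L'" by (rule orthogonal_transformation_linear[OF U(4)])
    show "x \<in> S \<union> T"
    proof (cases "U \<inter> S = {}")
      case True then show ?thesis using U by (auto simp: T_def)
    next
      case False
      have eqS: "D1 y = L (D2 y) + b" if "y \<in> S" for y using that by (auto simp: S_def)
      have "L = L'" "b = b'"
        using developing_affine_agree[OF D2 _ False _ lL lL', of b b'] U(3,5) eqS oS U(1)
        by (metis IntD1 IntD2 inf.coboundedI1 open_Int)+
      then have "x \<in> S" using U by (auto simp: S_def)
      then show ?thesis by simp
    qed
  qed
  moreover have "S \<inter> T = {}" by (auto simp: T_def)
  moreover have "x0 \<in> S" using U0 by (auto simp: S_def)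
  ultimately have "W \<inter> T = {}"
    using connectedD[OF W oS oT] x0 by blast
  then have "W \<subseteq> S" using \<open>W \<subseteq> S \<union> T\<close> by blast
  then show ?thesis using that[OF U0(4), of b] by (auto simp: S_def)
qed

section \<open>Existence of a global developing map\<close>

text \<open>Boxes of a division meet only in faces, on which two developing maps could not be
  compared; open neighbourhoods give them an overlap with interior.\<close>

definition developable :: "('e::euclidean_space \<Rightarrow> 'e \<Rightarrow> 'e \<Rightarrow> real) \<Rightarrow> 'e set \<Rightarrow> bool" where
  "developable G K \<longleftrightarrow> (\<exists>W D. K \<subseteq> W \<and> developing G W D)"

lemma developable_subset: "developable G K \<Longrightarrow> K' \<subseteq> K \<Longrightarrow> developable G K'"
  unfolding developable_def by blast

text \<open>Convex neighbourhoods meet in a convex, hence connected, set. There the two developing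
  maps differ by one rigid motion, which is used to correct the second map.\<close>

lemma developable_Un:
  fixes K1 K2 :: "'e::euclidean_space set"
  assumes K: "compact K1" "convex K1" "compact K2" "convex K2" "K1 \<inter> K2 \<noteq> {}"
    and "developable G K1" "developable G K2"
  shows "developable G (K1 \<union> K2)"
proof -
  obtain W1 D1 where 1: "K1 \<subseteq> W1" "developing G W1 D1" using assms by (auto simp: developable_def)
  obtain W2 D2 where 2: "K2 \<subseteq> W2" "developing G W2 D2" using assms by (auto simp: developable_def)
  obtain e1 where e1: "e1 > 0" "(\<Union>x\<in>K1. ball x e1) \<subseteq> W1"
    using compact_subset_open_imp_ball_epsilon_subset[OF K(1) developing_open[OF 1(2)] 1(1)] by blast
  obtain e2 where e2: "e2 > 0" "(\<Union>x\<in>K2. ball x e2) \<subseteq> W2"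
    using compact_subset_open_imp_ball_epsilon_subset[OF K(3) developing_open[OF 2(2)] 2(1)] by blast
  \<comment> \<open>A union of balls of fixed radius is a Minkowski sum with a ball, hence convex
    whenever \<open>K\<close> is.\<close>
  have thick: "(\<Union>x\<in>K. ball x e) = (\<Union>x\<in>K. \<Union>y\<in>ball 0 e. {x + y})" for K :: "'e set" and e
  proof (rule subset_antisym; rule subsetI)
    fix y assume "y \<in> (\<Union>x\<in>K. ball x e)"
    then obtain x where "x \<in> K" "y \<in> ball x e" by blast
    then show "y \<in> (\<Union>x\<in>K. \<Union>y\<in>ball 0 e. {x + y})"
      by (intro UN_I[of x] UN_I[of "y - x"]) (auto simp: dist_norm norm_minus_commute)
  next
    fix y assume "y \<in> (\<Union>x\<in>K. \<Union>y\<in>ball 0 e. {x + y})"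
    then obtain x w where "x \<in> K" "w \<in> ball 0 e" "y = x + w" by blast
    then show "y \<in> (\<Union>x\<in>K. ball x e)" by (intro UN_I[of x]) (auto simp: dist_norm)
  qed
  define V1 where "V1 = (\<Union>x\<in>K1. ball x e1)"
  define V2 where "V2 = (\<Union>x\<in>K2. ball x e2)"
  have V: "open V1" "open V2" "convex V1" "convex V2" "K1 \<subseteq> V1" "K2 \<subseteq> V2" "V1 \<subseteq> W1" "V2 \<subseteq> W2"
  proof -
    show "convex V1" unfolding V1_def thick by (rule convex_sums[OF K(2) convex_ball])
    show "convex V2" unfolding V2_def thick by (rule convex_sums[OF K(4) convex_ball])
    show "open V1" "open V2" unfolding V1_def V2_def by (intro open_UN ballI open_ball)+
    show "K1 \<subseteq> V1" "K2 \<subseteq> V2" "V1 \<subseteq> W1" "V2 \<subseteq> W2"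
      using e1 e2 unfolding V1_def V2_def by (auto intro: centre_in_ball[THEN iffD2])
  qed
  have d1: "developing G V1 D1" and d2: "developing G V2 D2"
    using developing_subset 1(2) 2(2) V by blast+
  have con: "connected (V1 \<inter> V2)" using V by (simp add: convex_Int convex_connected)
  obtain L b where L: "orthogonal_transformation L" "\<And>x. x \<in> V1 \<inter> V2 \<Longrightarrow> D1 x = L (D2 x) + b"
    using developing_unique[OF developing_subset[OF d1] developing_subset[OF d2] con] V(1,2)
    by (metis inf_le1 inf_le2 open_Int)
  define D where "D x = (if x \<in> V1 then D1 x else L (D2 x) + b)" for x
  have "developing G V1 D"
    by (rule developing_congruent[OF d1]) (simp add: D_def)
  moreover have "developing G V2 D"
    by (rule developing_congruent[OF developing_affine[OF d2 L(1), of b]]) (use L(2) in \<open>auto simp: D_def\<close>)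
  ultimately have "developing G (V1 \<union> V2) D" by (rule developing_Un)
  then show ?thesis using V unfolding developable_def by (meson Un_mono)
qed

text \<open>This is induction over divisions of a box, phrased with conjunction as the operation.
  Boxes without interior have to satisfy the predicate for free, hence the first disjunct; the work
  is in a cut both of whose halves have interior.\<close>

lemma operative_developable:
  fixes G :: "'e::euclidean_space \<Rightarrow> 'e \<Rightarrow> 'e \<Rightarrow> real"
  shows "operative (\<and>) True (\<lambda>K. interior K = {} \<or> developable G K)"
proof -
  interpret comm_monoid_set "(\<and>)" True ..
  show ?thesis
  proof
    fix a b :: 'e
    show "(interior (cbox a b) = {} \<or> developable G (cbox a b)) = True" if "box a b = {}"
      using that by (simp add: interior_cbox)
  next
    fix a b k :: 'e and c :: real
    assume k: "k \<in> Basis"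
    define K K1 K2 where "K = cbox a b" and "K1 = cbox a b \<inter> {x. x \<bullet> k \<le> c}" and "K2 = cbox a b \<inter> {x. x \<bullet> k \<ge> c}"
    have sub: "K1 \<subseteq> K" "K2 \<subseteq> K" "K = K1 \<union> K2" by (auto simp: K_def K1_def K2_def)
    have bx: "compact K1" "convex K1" "compact K2" "convex K2"
      unfolding K1_def K2_def interval_split[OF k] by (simp_all add: convex_box)
    have whole: "interior K = {} \<or> developable G K" if Q: "interior K1 = {} \<or> developable G K1" "interior K2 = {} \<or> developable G K2"
    proof (cases "interior K = {}")
      case False
      then have ne: "box a b \<noteq> {}" by (simp add: K_def interior_cbox)
      then obtain y where y: "y \<in> box a b" by blast
      consider "c \<le> a \<bullet> k" | "c \<ge> b \<bullet> k" | "a \<bullet> k < c" "c < b \<bullet> k" by linarith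
      then show ?thesis
      proof cases
        case 1
        then have "K2 = K" using k unfolding K_def K2_def by (force simp: mem_box)
        then show ?thesis using Q(2) by simp
      next
        case 2
        then have "K1 = K" using k unfolding K_def K1_def by (force simp: mem_box)
        then show ?thesis using Q(1) by simp
      next
        case 3
        \<comment> \<open>Sliding an interior point in direction \<open>k\<close> produces interior
          points on either side of the cut and on the cut itself.\<close>
        have mv: "y + (t - y \<bullet> k) *\<^sub>R k \<in> box a b" "(y + (t - y \<bullet> k) *\<^sub>R k) \<bullet> k = t"
          if "a \<bullet> k < t" "t < b \<bullet> k" for t
        proof -
          have "(y + (t - y \<bullet> k) *\<^sub>R k) \<bullet> i = (if i = k then t else y \<bullet> i)" if "i \<in> Basis" for i
            using k that by (simp add: inner_add_left inner_Basis)
          then show "y + (t - y \<bullet> k) *\<^sub>R k \<in> box a b" "(y + (t - y \<bullet> k) *\<^sub>R k) \<bullet> k = t"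
            using y that k by (auto simp: mem_box)
        qed
        have o1: "open {x::'e. x \<bullet> k < c}" "open {x::'e. x \<bullet> k > c}"
          using open_halfspace_component_lt[of k c] open_halfspace_component_gt[of c k] by simp_all
        have "box a b \<inter> {x. x \<bullet> k < c} \<subseteq> interior K1" "box a b \<inter> {x. x \<bullet> k > c} \<subseteq> interior K2"
          by (rule interior_maximal; use box_subset_cbox[of a b] o1 in \<open>auto simp: K1_def K2_def\<close>)+
        moreover have "box a b \<inter> {x. x \<bullet> k < c} \<noteq> {}" "box a b \<inter> {x. x \<bullet> k > c} \<noteq> {}"
          using mv[of "(a \<bullet> k + c) / 2"] mv[of "(b \<bullet> k + c) / 2"] 3 by (force simp: field_simps)+
        ultimately have "developable G K1" "developable G K2" using Q by blast+
        moreover have "K1 \<inter> K2 \<noteq> {}"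
          using mv[of c] 3 box_subset_cbox unfolding K1_def K2_def by fastforce
        ultimately have "developable G (K1 \<union> K2)" by (intro developable_Un bx)
        then show ?thesis using sub by simp
      qed
    qed simp
    have part: "interior K' = {} \<or> developable G K'" if "interior K = {} \<or> developable G K" "K' \<subseteq> K" for K'
      using that developable_subset interior_mono by blast
    show "(interior (cbox a b) = {} \<or> developable G (cbox a b)) =
       ((interior (cbox a b \<inter> {x. x \<bullet> k \<le> c}) = {} \<or> developable G (cbox a b \<inter> {x. x \<bullet> k \<le> c})) \<and>
        (interior (cbox a b \<inter> {x. c \<le> x \<bullet> k}) = {} \<or> developable G (cbox a b \<inter> {x. c \<le> x \<bullet> k})))"
      using whole part[OF _ sub(1)] part[OF _ sub(2)]
      unfolding K1_def[symmetric] K2_def[symmetric] unfolding K_def[symmetric] by argo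
  qed
qed

text \<open>The local neighbourhoods form a gauge, and each piece of a division fine for it lies in
  one of them.\<close>

lemma developable_cbox:
  assumes loc: "\<And>x. \<exists>W D. x \<in> W \<and> developing G W D"
  shows "box a b = {} \<or> developable G (cbox a b)"
proof -
  obtain W where W: "\<And>x. x \<in> W x" "\<And>x. \<exists>D. developing G (W x) D" using loc by metis
  have "gauge W" using W developing_open unfolding gauge_def by blast
  then obtain p where p: "p tagged_division_of cbox a b" "W fine p"
    using fine_division_exists by blast
  interpret operative "(\<and>)" True "\<lambda>K. interior K = {} \<or> developable G K"
    by (rule operative_developable)
  have "snd ` p division_of cbox a b" using p(1) by (rule division_of_tagged_division)
  from division[OF this] have "(\<forall>K\<in>snd ` p. interior K = {} \<or> developable G K) \<Longrightarrow> interior (cbox a b) = {} \<or> developable G (cbox a b)"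
    by (simp add: comm_monoid_set_F_and)
  moreover have "\<forall>K\<in>snd ` p. interior K = {} \<or> developable G K"
  proof
    fix K assume "K \<in> snd ` p"
    then obtain x where "(x, K) \<in> p" by auto
    then have "K \<subseteq> W x" using p(2) unfolding fine_def by blast
    then show "interior K = {} \<or> developable G K" using W(2)[of x] unfolding developable_def by blast
  qed
  ultimately show ?thesis by (simp add: interior_cbox)
qed

text \<open>Space is exhausted by cubes. The maps on the cubes are normalized to agree on the
  smallest one, after which uniqueness makes them extend each other.\<close>

theorem developing_UNIV:
  fixes G :: "'e::euclidean_space \<Rightarrow> 'e \<Rightarrow> 'e \<Rightarrow> real"
  assumes loc: "\<And>x. \<exists>W D. x \<in> W \<and> developing G W D"
  obtains D where "developing G UNIV D"
proof -
  define B :: "nat \<Rightarrow> 'e set" where "B n = box (- real (Suc n) *\<^sub>R One) (real (Suc n) *\<^sub>R One)" for n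
  have memB: "x \<in> B n \<longleftrightarrow> (\<forall>i\<in>Basis. \<bar>x \<bullet> i\<bar> < real (Suc n))" for x n
    by (auto simp: B_def mem_box abs_less_iff)
  have oB: "open (B n)" "connected (B n)" for n by (auto simp: B_def convex_box convex_connected)
  have mono: "B m \<subseteq> B n" if "m \<le> n" for m n using that by (force simp: memB)
  have ne: "B n \<noteq> {}" for n using memB[of 0 n] by auto
  have cov: "\<exists>n. x \<in> B n" for x
  proof -
    obtain n where "norm x < real n" using reals_Archimedean2 by blast
    then have "x \<in> B n" using Basis_le_norm[of _ x] by (force simp: memB)
    then show ?thesis ..
  qed
  have "\<exists>D. developing G (B n) D" for n
  proof -
    have "developable G (B n)"
      using developable_cbox[OF loc, of "- real (Suc n) *\<^sub>R One" "real (Suc n) *\<^sub>R One"] ne[of n]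
        developable_subset[OF _ box_subset_cbox] by (auto simp: B_def)
    then show ?thesis using developing_subset oB unfolding developable_def by blast
  qed
  then obtain E0 where E0: "\<And>n. developing G (B n) (E0 n)" by metis
  have "\<exists>E. developing G (B n) E \<and> (\<forall>x\<in>B 0. E x = E0 0 x)" for n
  proof -
    obtain L b where L: "orthogonal_transformation L" "\<And>x. x \<in> B 0 \<Longrightarrow> E0 0 x = L (E0 n x) + b"
      using developing_unique[OF E0[of 0] developing_subset[OF E0[of n] oB(1)[of 0] mono] oB(2)] by blast
    then show ?thesis using developing_affine[OF E0[of n] L(1), of b] by auto
  qed
  then obtain E where E: "\<And>n. developing G (B n) (E n)" "\<And>n x. x \<in> B 0 \<Longrightarrow> E n x = E0 0 x" by metis
  have agree: "E n x = E m x" if mn: "m \<le> n" "x \<in> B m" for m n x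
  proof -
    obtain L b where L: "orthogonal_transformation L" "\<And>x. x \<in> B m \<Longrightarrow> E n x = L (E m x) + b"
      using developing_unique[OF developing_subset[OF E(1)[of n] oB(1)[of m] mono[OF mn(1)]] E(1)[of m] oB(2)] by blast
    have eq: "L (E m x) + b = id (E m x) + 0" if x: "x \<in> B 0" for x
      using L(2)[of x] E(2)[OF x] mono[of 0 m] x by auto
    \<comment> \<open>Both maps equal \<open>E0 0\<close> on the smallest cube, which pins the rigid
      motion down to the identity.\<close>
    have "L = id" "b = 0"
      using developing_affine_agree[OF E(1)[of m] oB(1)[of 0] ne[of 0] mono[of 0 m]
        orthogonal_transformation_linear[OF L(1)] linear_id eq] by auto
    then show ?thesis using L(2)[OF mn(2)] by simp
  qed
  define D where "D x = E (LEAST n. x \<in> B n) x" for x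
  have DE: "D x = E n x" if "x \<in> B n" for x n
    unfolding D_def using agree[of "LEAST n. x \<in> B n" n x] that LeastI[of "\<lambda>n. x \<in> B n" n] Least_le[of "\<lambda>n. x \<in> B n" n] by simp
  have "developing G (B n) D" for n by (rule developing_congruent[OF E(1)]) (rule DE)
  then have "developing G (\<Union>n\<in>UNIV. B n) D" by (rule developing_Union)
  moreover have "(\<Union>n\<in>UNIV. B n) = UNIV" using cov by auto
  ultimately show ?thesis using that by simp
qed

section \<open>Flat metrics on tori\<close>

text \<open>The factor 2 pi fits the parametrization of circles by \<open>cis\<close>, whose
  products will be the universal covers.\<close>

definition period_lattice :: "'e::euclidean_space set" where
  "period_lattice = {x. \<forall>b\<in>Basis. \<exists>k::int. x \<bullet> b = 2 * pi * of_int k}"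

lemma lattice_add: "x \<in> period_lattice \<Longrightarrow> y \<in> period_lattice \<Longrightarrow> x + y \<in> period_lattice"
  unfolding period_lattice_def by (clarsimp simp: inner_add_left) (metis distrib_left of_int_add)

lemma lattice_minus: "x \<in> period_lattice \<Longrightarrow> - x \<in> period_lattice"
  unfolding period_lattice_def by clarsimp (metis mult_minus_right of_int_minus)

lemma lattice_Basis: "b \<in> Basis \<Longrightarrow> (2 * pi) *\<^sub>R b \<in> period_lattice"
  by (auto simp: period_lattice_def inner_Basis intro!: exI[of _ "if b = _ then 1 else 0"])

lemma lattice_fundamental:
  fixes x :: "'e::euclidean_space"
  obtains z l where "l \<in> period_lattice" "z \<in> cbox 0 ((2 * pi) *\<^sub>R One)" "x = z + l"
proof -
  define l :: 'e where "l = (\<Sum>b\<in>Basis. (2 * pi * of_int \<lfloor>(x \<bullet> b) / (2 * pi)\<rfloor>) *\<^sub>R b)"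
  have two_pi_pos: "0 < 2 * pi" by simp
  have lb: "l \<bullet> b = 2 * pi * of_int \<lfloor>(x \<bullet> b) / (2 * pi)\<rfloor>" if "b \<in> Basis" for b
    using that by (simp add: l_def inner_sum_left inner_Basis if_distrib cong: if_cong)
  have "l \<in> period_lattice" using lb by (auto simp: period_lattice_def)
  moreover have "x - l \<in> cbox 0 ((2 * pi) *\<^sub>R One)"
  proof -
    have "0 \<le> (x - l) \<bullet> b \<and> (x - l) \<bullet> b \<le> 2 * pi" if "b \<in> Basis" for b
    proof -
      have "of_int \<lfloor>(x \<bullet> b) / (2 * pi)\<rfloor> \<le> (x \<bullet> b) / (2 * pi)" "(x \<bullet> b) / (2 * pi) \<le> of_int \<lfloor>(x \<bullet> b) / (2 * pi)\<rfloor> + 1"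
        by linarith+
      then have "2 * pi * of_int \<lfloor>(x \<bullet> b) / (2 * pi)\<rfloor> \<le> x \<bullet> b" "x \<bullet> b \<le> 2 * pi * (of_int \<lfloor>(x \<bullet> b) / (2 * pi)\<rfloor> + 1)"
        by (simp_all only: pos_le_divide_eq[of "2 * pi"] pos_divide_le_eq[of "2 * pi"] two_pi_pos mult.commute[of _ "2 * pi"])
      then show ?thesis using lb[OF that] by (simp add: inner_diff_left distrib_left)
    qed
    then show ?thesis by (simp add: mem_box)
  qed
  ultimately show ?thesis using that[of l "x - l"] by simp
qed

text \<open>Only the norm is assumed periodic, because the displacement of a developing map under a
  lattice translation is at first periodic only up to rotation.\<close>

lemma periodic_bounded:
  fixes u :: "'e::euclidean_space \<Rightarrow> 'f::real_normed_vector"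
  assumes "continuous_on UNIV u" "\<And>x l. l \<in> period_lattice \<Longrightarrow> norm (u (x + l)) = norm (u x)"
  obtains M where "M \<ge> 0" "\<And>x. norm (u x) \<le> M"
proof -
  have "compact (u ` cbox 0 ((2 * pi) *\<^sub>R One))"
    by (intro compact_continuous_image compact_cbox continuous_on_subset[OF assms(1)]) auto
  then obtain M where M: "\<And>x. x \<in> cbox 0 ((2 * pi) *\<^sub>R One) \<Longrightarrow> norm (u x) \<le> M"
    using compact_imp_bounded bounded_iff by (metis imageI)
  have "norm (u x) \<le> max M 0" for x
    using lattice_fundamental[of x] assms(2) M by (metis max.coboundedI1)
  then show ?thesis using that[of "max M 0"] by auto
qed

lemma has_derivative_translate:
  assumes "(f has_derivative f') (at (x + l))"
  shows "((\<lambda>x. f (x + l)) has_derivative f') (at x)"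
proof -
  have "((\<lambda>x. x + l) has_derivative (\<lambda>h. h)) (at x)"
    by (auto intro!: derivative_eq_intros)
  from has_derivative_compose[OF this assms] show ?thesis .
qed

section \<open>Linear parts of maps that are equivariant under the lattice\<close>

text \<open>The additive constant is negligible against large multiples of \<open>v\<close>.\<close>

lemma asymptotic_norm_le:
  assumes P: "linear P" and Q: "linear Q" and le: "\<And>k::nat. norm (P (real k *\<^sub>R v)) \<le> C * norm (Q (real k *\<^sub>R v)) + K"
  shows "norm (P v) \<le> C * norm (Q v)"
proof (rule ccontr)
  assume "\<not> ?thesis"
  then have pos: "norm (P v) - C * norm (Q v) > 0" by simp
  obtain k :: nat where k: "real k * (norm (P v) - C * norm (Q v)) > K"
    using reals_Archimedean3[OF pos] by blast
  have "real k * norm (P v) \<le> C * (real k * norm (Q v)) + K"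
    using le[of k] by (simp add: linear_scale[OF P] linear_scale[OF Q])
  then show False using k by (simp add: algebra_simps)
qed

text \<open>The linear extension to the whole space of the homomorphism that sends a lattice vector
  l to the displacement F l - F 0; for a developing map it is the linear part \<open>P\<close> of
  the overview.\<close>

definition period_map :: "('e::euclidean_space \<Rightarrow> 'f::real_normed_vector) \<Rightarrow> 'e \<Rightarrow> 'f" where
  "period_map F v = (\<Sum>b\<in>Basis. ((v \<bullet> b) / (2 * pi)) *\<^sub>R (F ((2 * pi) *\<^sub>R b) - F 0))"

lemma linear_period_map: "linear (period_map F)"
  unfolding period_map_def
  by (intro linearI)
    (simp_all add: inner_add_left add_divide_distrib scaleR_add_left sum.distrib scaleR_sum_right)

text \<open>The lattice vectors for which the equation holds at every \<open>x\<close> form a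
  subgroup containing the generators.\<close>

lemma period_map_lattice:
  fixes F :: "'e::euclidean_space \<Rightarrow> 'f::real_normed_vector"
  assumes translation: "\<And>x l. l \<in> period_lattice \<Longrightarrow> F (x + l) = F x + (F l - F 0)"
    and l: "l \<in> period_lattice"
  shows "F (x + l) = F x + period_map F l"
proof -
  define P where "P = {l. \<forall>x. F (x + l) = F x + period_map F l}"
  have P0: "0 \<in> P" by (simp add: P_def linear_0[OF linear_period_map])
  have Padd: "m + n \<in> P" if "m \<in> P" "n \<in> P" for m n
    using that by (simp add: P_def linear_add[OF linear_period_map] add.assoc[symmetric])
  have Pneg: "- m \<in> P" if "m \<in> P" for m
  proof -
    have "F (x + - m) = F x + period_map F (- m)" for x
    proof -
      have "F (x - m + m) = F (x - m) + period_map F m" using that unfolding P_def by blast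
      then show ?thesis by (simp add: linear_neg[OF linear_period_map])
    qed
    then show ?thesis by (simp add: P_def)
  qed
  have PB: "(2 * pi) *\<^sub>R b \<in> P" if b: "b \<in> Basis" for b
  proof -
    have "period_map F ((2 * pi) *\<^sub>R b) = F ((2 * pi) *\<^sub>R b) - F 0"
      unfolding period_map_def using b
      by (subst sum.remove[OF finite_Basis b]) (auto simp: inner_Basis intro!: sum.neutral split: if_splits)
    then show ?thesis using translation[OF lattice_Basis[OF b]] by (simp add: P_def)
  qed
  have PZ: "(2 * pi * of_int k) *\<^sub>R b \<in> P" if b: "b \<in> Basis" for b and k :: int
  proof (induction k rule: int_induct[where k = 0])
    case (step1 i)
    then show ?case using Padd[OF step1(2) PB[OF b]] by (simp add: algebra_simps)
  next
    case (step2 i)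
    then show ?case using Padd[OF step2(2) Pneg[OF PB[OF b]]] by (simp add: algebra_simps)
  qed (simp add: P0)
  have "(\<Sum>b\<in>S. (l \<bullet> b) *\<^sub>R b) \<in> P" if "finite S" "S \<subseteq> Basis" for S
    using that
  proof (induction S rule: finite_induct)
    case (insert b S)
    obtain k :: int where "l \<bullet> b = 2 * pi * of_int k" using l insert by (auto simp: period_lattice_def)
    then show ?case using insert Padd[OF PZ[of b k]] by auto
  qed (simp add: P0)
  then have "l \<in> P" using euclidean_representation[of l] by (metis finite_Basis order_refl)
  then show ?thesis by (simp add: P_def)
qed

text \<open>After subtraction of the linear part a periodic function remains, and a fundamental
  domain is compact.\<close>

lemma period_map_bounded:
  fixes F :: "'e::euclidean_space \<Rightarrow> 'f::real_normed_vector"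
  assumes translation: "\<And>x l. l \<in> period_lattice \<Longrightarrow> F (x + l) = F x + (F l - F 0)"
    and cont: "continuous_on UNIV F"
  obtains M where "M \<ge> 0" "\<And>x. norm (F x - period_map F x) \<le> M"
proof (rule periodic_bounded[of "\<lambda>x. F x - period_map F x"])
  show "continuous_on UNIV (\<lambda>x. F x - period_map F x)"
    by (intro continuous_intros cont linear_continuous_on linear_conv_bounded_linear[THEN iffD1] linear_period_map)
  show "norm (F (x + l) - period_map F (x + l)) = norm (F x - period_map F x)" if "l \<in> period_lattice" for x l
    using period_map_lattice[OF translation that] by (simp add: linear_add[OF linear_period_map])
qed (use that in blast)

section \<open>Completeness and holonomy of a flat torus\<close>

locale flat_torus =
  fixes G :: "'e::euclidean_space \<Rightarrow> 'e \<Rightarrow> 'e \<Rightarrow> real" and D :: "'e \<Rightarrow> 'e"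
  assumes dev: "developing G UNIV D"
    and periodic: "l \<in> period_lattice \<Longrightarrow> G (x + l) = G x"
begin

lemma continuous: "continuous_on UNIV D" using developing_continuous_on[OF dev] .

text \<open>Lattice translations preserve the periodic metric, so \<open>D\<close> composed with one
  is again a developing map, and uniqueness applies.\<close>

lemma holonomy_affine:
  assumes l: "l \<in> period_lattice"
  obtains A b where "orthogonal_transformation A" "\<And>x. D (x + l) = A (D x) + b"
proof -
  have "developing G UNIV (\<lambda>x. D (x + l))"
    unfolding developing_def
  proof (intro conjI ballI)
    fix x
    obtain D' where D': "(D has_derivative D') (at (x + l))" "\<And>u v. D' u \<bullet> D' v = G (x + l) u v"
      using developing_derivative[OF dev] by blast
    have "((\<lambda>x. D (x + l)) has_derivative D') (at x)"
      using D'(1) by (rule has_derivative_translate)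
    then show "\<exists>D'. ((\<lambda>x. D (x + l)) has_derivative D') (at x) \<and> (\<forall>u v. D' u \<bullet> D' v = G x u v)"
      using D'(2) periodic[OF l] by auto
    obtain U where U: "open U" "x + l \<in> U" "inj_on D U" using dev unfolding developing_def by blast
    then show "\<exists>U. open U \<and> x \<in> U \<and> inj_on (\<lambda>x. D (x + l)) U"
      by (intro exI[of _ "(\<lambda>y. y - l) ` U"])
        (auto simp: open_translation_subtract inj_on_def image_iff intro!: bexI[of _ "x + l"])
    show "\<forall>v. v \<noteq> 0 \<longrightarrow> 0 < G x v v" using dev unfolding developing_def by blast
  qed simp
  from developing_unique[OF this dev] that show ?thesis by auto
qed

text \<open>\<open>x'\<close> is the end of the lift, starting at \<open>x\<close>, of the straight segment from \<open>D x\<close> to \<open>y\<close>. Of the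
  lift only its effect is recorded: a map whose differential is bounded by \<open>C\<close> moves its ends apart
  by at most \<open>C\<close> times the length of the segment.\<close>

definition reaches :: "'e \<Rightarrow> 'e \<Rightarrow> 'e \<Rightarrow> bool" where
  "reaches x y x' \<longleftrightarrow> D x' = y \<and>
     (\<forall>(f::'e \<Rightarrow> 'e) C. C \<ge> 0 \<and> (\<forall>z. \<exists>f'. (f has_derivative f') (at z) \<and> (\<forall>v. f' v \<bullet> f' v \<le> C\<^sup>2 * G z v v)) \<longrightarrow>
        norm (f x' - f x) \<le> C * norm (y - D x))"

text \<open>A lattice translation acts on the developed picture by the rigid motion of its holonomy,
  and composing a test map \<open>f\<close> with the translation keeps its bound because
  \<open>G\<close> is periodic.\<close>

lemma reaches_shift:
  assumes l: "l \<in> period_lattice" and z: "\<forall>y\<in>ball (D z) r. \<exists>x'. reaches z y x'"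
    and y: "y \<in> ball (D (z + l)) r"
  shows "\<exists>x'. reaches (z + l) y x'"
proof -
  obtain A b where A: "orthogonal_transformation A" "\<And>x. D (x + l) = A (D x) + b"
    using holonomy_affine[OF l] by blast
  obtain w where w: "A w = y - b" using orthogonal_transformation_surj[OF A(1)] by (metis surjD)
  have lA: "linear A" using A(1) by (rule orthogonal_transformation_linear)
  have nw: "norm (w - D z) = norm (y - D (z + l))"
  proof -
    have "norm (w - D z) = norm (A (w - D z))" using A(1) by (simp add: orthogonal_transformation_norm)
    also have "A (w - D z) = y - D (z + l)" by (simp add: w A(2)[of z] linear_diff[OF lA])
    finally show ?thesis .
  qed
  then have "w \<in> ball (D z) r" using y by (simp add: dist_norm norm_minus_commute)
  then obtain x' where x': "reaches z w x'" using z by blast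
  have "reaches (z + l) y (x' + l)"
    unfolding reaches_def
  proof (intro conjI allI impI; (elim conjE)?)
    show "D (x' + l) = y" using A(2) x' w by (simp add: reaches_def)
    fix f :: "'e \<Rightarrow> 'e" and C :: real
    assume C: "C \<ge> 0" and f: "\<forall>z. \<exists>f'. (f has_derivative f') (at z) \<and> (\<forall>v. f' v \<bullet> f' v \<le> C\<^sup>2 * G z v v)"
    have "\<exists>f'. ((\<lambda>x. f (x + l)) has_derivative f') (at z) \<and> (\<forall>v. f' v \<bullet> f' v \<le> C\<^sup>2 * G z v v)" for z
    proof -
      obtain f' where f': "(f has_derivative f') (at (z + l))" "\<forall>v. f' v \<bullet> f' v \<le> C\<^sup>2 * G (z + l) v v"
        using f by blast
      then have "((\<lambda>x. f (x + l)) has_derivative f') (at z)"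
        by (blast intro: has_derivative_translate)
      then show ?thesis using f'(2) periodic[OF l] by auto
    qed
    then have "norm (f (x' + l) - f (z + l)) \<le> C * norm (w - D z)"
      using x' C unfolding reaches_def by blast
    then show "norm (f (x' + l) - f (z + l)) \<le> C * norm (y - D (z + l))" using nw by simp
  qed
  then show ?thesis by blast
qed

text \<open>Compactness of a fundamental domain gives one radius for its points, and lattice
  translations carry it to all others.\<close>

lemma reaches_uniform: obtains r where "r > 0" "\<And>x y. y \<in> ball (D x) r \<Longrightarrow> \<exists>x'. reaches x y x'"
proof -
  have "\<exists>N r. open N \<and> x \<in> N \<and> r > 0 \<and> (\<forall>z\<in>N. \<forall>y\<in>ball (D z) r. \<exists>x'. reaches z y x')" for x
  proof -
    obtain U r \<sigma> where U: "open U" "x \<in> U" "r > 0" "homeomorphism U (ball (D x) r) D \<sigma>"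
       "\<And>y. y \<in> ball (D x) r \<Longrightarrow> \<exists>s'. (\<sigma> has_derivative s') (at y) \<and> (\<forall>u v. G (\<sigma> y) (s' u) (s' v) = u \<bullet> v)"
      using developing_section[OF dev UNIV_I[of x] open_UNIV UNIV_I] by metis
    \<comment> \<open>With half the radius, the ball of radius \<open>r / 2\<close> about
      \<open>D z\<close> stays in the ball about \<open>D x\<close> on which the local inverse is
      defined.\<close>
    define N where "N = D -` ball (D x) (r / 2) \<inter> U"
    have "open N" unfolding N_def
      by (intro open_Int U(1) open_vimage open_ball) (rule continuous)
    moreover have "x \<in> N" using U by (simp add: N_def)
    moreover have "\<exists>x'. reaches z y x'" if z: "z \<in> N" and y: "y \<in> ball (D z) (r / 2)" for z y
    proof -
      have "dist (D x) y \<le> dist (D x) (D z) + dist (D z) y" by (rule dist_triangle)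
      also have "\<dots> < r" using z y by (simp add: N_def)
      finally have yb: "y \<in> ball (D x) r" by simp
      have s: "\<sigma> y \<in> U" "D (\<sigma> y) = y" using U(4) yb unfolding homeomorphism_def by blast+
      have "reaches z y (\<sigma> y)"
        unfolding reaches_def
      proof (intro conjI allI impI; (elim conjE)?)
        fix f :: "'e \<Rightarrow> 'e" and C :: real
        assume C: "C \<ge> 0" and f: "\<forall>z. \<exists>f'. (f has_derivative f') (at z) \<and> (\<forall>v. f' v \<bullet> f' v \<le> C\<^sup>2 * G z v v)"
        have "norm (f (\<sigma> y) - f z) \<le> C * norm (D (\<sigma> y) - D z)"
          by (rule lipschitz_along_section[where G = G, OF U(4,5)]) (use f C s z in \<open>auto simp: N_def\<close>)
        then show "norm (f (\<sigma> y) - f z) \<le> C * norm (y - D z)" using s by simp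
      qed (use s in simp)
      then show ?thesis by blast
    qed
    ultimately show ?thesis using U(3) by (intro exI[of _ N] exI[of _ "r / 2"]) auto
  qed
  then obtain N r where N: "\<And>x. open (N x)" "\<And>x. x \<in> N x" "\<And>x. r x > (0::real)"
    "\<And>x z y. z \<in> N x \<Longrightarrow> y \<in> ball (D z) (r x) \<Longrightarrow> \<exists>x'. reaches z y x'"
    by metis
  define K :: "'e set" where "K = cbox 0 ((2 * pi) *\<^sub>R One)"
  have "compact K" by (simp add: K_def)
  moreover have "K \<subseteq> \<Union>(N ` K)" using N(2) by blast
  ultimately obtain F where F: "F \<subseteq> K" "finite F" "K \<subseteq> \<Union>(N ` F)"
    using N(1) by (metis compactE_image)
  define r0 where "r0 = Min (insert 1 (r ` F))"
  have r0: "r0 > 0" "\<And>x. x \<in> F \<Longrightarrow> r0 \<le> r x"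
    unfolding r0_def using F(2) N(3) by auto
  have "\<exists>x'. reaches x y x'" if y: "y \<in> ball (D x) r0" for x y
  proof -
    obtain z l where zl: "l \<in> period_lattice" "z \<in> K" "x = z + l"
      unfolding K_def by (rule lattice_fundamental)
    obtain w where w: "w \<in> F" "z \<in> N w" using F(3) zl(2) by blast
    have "\<forall>y\<in>ball (D z) r0. \<exists>x'. reaches z y x'"
      using N(4)[OF w(2)] r0(2)[OF w(1)] by auto
    from reaches_shift[OF zl(1) this] y show ?thesis unfolding zl(3) by blast
  qed
  then show ?thesis using that r0(1) by blast
qed

text \<open>The segment is cut into steps shorter than the uniform radius, each of which can be
  lifted. This takes the place of completeness and the lifting of long segments.\<close>

lemma reaches_everywhere: "\<exists>x'. reaches x y x'"
proof -
  obtain r where r: "r > 0" "\<And>x y. y \<in> ball (D x) r \<Longrightarrow> \<exists>x'. reaches x y x'"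
    using reaches_uniform by blast
  obtain n :: nat where n: "real n * r > norm (y - D x)"
    using reals_Archimedean3[OF r(1)] by blast
  have n0: "n > 0" using n r(1) by (cases n) auto
  have small: "norm (y - D x) / real n < r" using n n0 by (simp add: field_simps)
  have "\<exists>x'. reaches x (D x + (real k / real n) *\<^sub>R (y - D x)) x'" for k
  proof (induction k)
    case 0
    have "reaches x (D x) x" by (auto simp: reaches_def)
    then show ?case by auto
  next
    case (Suc k)
    then obtain z where z: "reaches x (D x + (real k / real n) *\<^sub>R (y - D x)) z" by blast
    define w where "w = D x + (real (Suc k) / real n) *\<^sub>R (y - D x)"
    have Dz: "D z = D x + (real k / real n) *\<^sub>R (y - D x)" using z by (simp add: reaches_def)
    have wz: "w - D z = (1 / real n) *\<^sub>R (y - D x)"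
      unfolding w_def Dz by (simp add: add_divide_distrib scaleR_add_left)
    then have nwz: "norm (w - D z) = norm (y - D x) / real n" by simp
    then have "w \<in> ball (D z) r" using small by (simp add: dist_norm norm_minus_commute)
    then obtain z' where z': "reaches z w z'" using r(2) by blast
    have "reaches x w z'"
      unfolding reaches_def
    proof (intro conjI allI impI; (elim conjE)?)
      show "D z' = w" using z' by (simp add: reaches_def)
      fix f :: "'e \<Rightarrow> 'e" and C :: real
      assume C: "C \<ge> 0" and f: "\<forall>z. \<exists>f'. (f has_derivative f') (at z) \<and> (\<forall>v. f' v \<bullet> f' v \<le> C\<^sup>2 * G z v v)"
      have 1: "norm (f z - f x) \<le> C * norm (D z - D x)" using z C f unfolding reaches_def by auto
      have 2: "norm (f z' - f z) \<le> C * norm (w - D z)" using z' C f unfolding reaches_def by blast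
      have "norm (f z' - f x) \<le> norm (f z' - f z) + norm (f z - f x)"
        by (metis norm_triangle_ineq diff_add_cancel add_diff_eq)
      also have "\<dots> \<le> C * (norm (w - D z) + norm (D z - D x))" using 1 2 by (simp add: algebra_simps)
      \<comment> \<open>The intermediate points lie in order on one segment, so the lengths add up
        exactly and the constant \<open>C\<close> does not deteriorate.\<close>
      also have "norm (w - D z) + norm (D z - D x) = norm (w - D x)"
      proof -
        have "norm (D z - D x) = (real k / real n) * norm (y - D x)" unfolding Dz by simp
        moreover have "norm (w - D x) = (real (Suc k) / real n) * norm (y - D x)" unfolding w_def by simp
        ultimately show ?thesis unfolding nwz using n0 by (simp add: field_simps)
      qed
      finally show "norm (f z' - f x) \<le> C * norm (w - D x)" .
    qed
    then show ?case unfolding w_def by blast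
  qed
  from this[of n] show ?thesis using n0 by simp
qed

lemma surj: "surj D"
  unfolding surj_def using reaches_everywhere unfolding reaches_def by metis

text \<open>Since lattice translations commute, the displacement by \<open>l\<close> has a norm that
  is periodic, hence bounded. By surjectivity of \<open>D\<close> the rotational part
  \<open>A\<close> then moves every point of space by a bounded distance, which only the identity
  does.\<close>

lemma translation:
  assumes l: "l \<in> period_lattice"
  shows "D (x + l) = D x + (D l - D 0)"
proof -
  obtain A b where A: "orthogonal_transformation A" "\<And>x. D (x + l) = A (D x) + b"
    using holonomy_affine[OF l] by blast
  have lA: "linear A" using A(1) by (rule orthogonal_transformation_linear)
  have "norm (D (x + m + l) - D (x + m)) = norm (D (x + l) - D x)" if m: "m \<in> period_lattice" for x m
  proof -
    obtain A' b' where A': "orthogonal_transformation A'" "\<And>x. D (x + m) = A' (D x) + b'"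
      using holonomy_affine[OF m] by blast
    have "D (x + m + l) - D (x + m) = A' (D (x + l) - D x)"
      using A'(2)[of "x + l"] A'(2)[of x]
      by (simp add: linear_diff[OF orthogonal_transformation_linear[OF A'(1)]] ac_simps)
    then show ?thesis using A'(1) by (simp add: orthogonal_transformation_norm)
  qed
  moreover have "continuous_on UNIV (\<lambda>x. D (x + l) - D x)"
    by (intro continuous_intros continuous_on_compose2[OF continuous]) auto
  ultimately obtain M where M: "\<And>x. norm (D (x + l) - D x) \<le> M"
    using periodic_bounded[of "\<lambda>x. D (x + l) - D x"] by metis
  have bnd: "norm (A y - y) \<le> M + norm b" for y
  proof -
    obtain x where x: "y = D x" using surj by blast
    have "A y - y = (D (x + l) - D x) - b" using A(2)[of x] x by simp
    then show ?thesis using M[of x] norm_triangle_ineq4[of "D (x + l) - D x" b] by simp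
  qed
  \<comment> \<open>A linear map with bounded values vanishes: this is the growth estimate with
    constant 0.\<close>
  have "norm (A y - y) \<le> 0 * norm (id y)" for y
  proof (rule asymptotic_norm_le[where Q = id and P = "\<lambda>y. A y - y" and K = "M + norm b"])
    show "linear (\<lambda>y. A y - y)" using lA by (intro linear_compose_sub linear_id[unfolded id_def])
    show "linear (id :: 'e \<Rightarrow> 'e)" by (rule linear_id)
    show "norm (A (real k *\<^sub>R y) - real k *\<^sub>R y) \<le> 0 * norm (id (real k *\<^sub>R y)) + (M + norm b)" for k
      using bnd by simp
  qed
  then have "A y = y" for y by (metis mult_zero_left norm_le_zero_iff right_minus_eq)
  then show ?thesis using A(2)[of x] A(2)[of 0] by simp
qed

lemma period_map_asymptotic: obtains M where "M \<ge> 0" "\<And>x y. norm (D x - D y - period_map D (x - y)) \<le> M"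
proof -
  obtain M where M: "M \<ge> 0" "\<And>x. norm (D x - period_map D x) \<le> M" using period_map_bounded[OF translation continuous] by blast
  have "norm (D x - D y - period_map D (x - y)) \<le> 2 * M" for x y
    using M(2)[of x] M(2)[of y] norm_triangle_ineq4[of "D x - period_map D x" "D y - period_map D y"]
    by (simp add: linear_diff[OF linear_period_map] algebra_simps)
  then show ?thesis using that[of "2 * M"] M(1) by simp
qed

text \<open>\<open>D\<close> is surjective and stays within bounded distance of its linear part, so
  the range of the linear part cannot lie in a hyperplane; in equal dimensions surjectivity gives
  injectivity.\<close>

lemma inj_period_map: "inj (period_map D)"
proof -
  obtain M where M: "M \<ge> 0" "\<And>x. norm (D x - period_map D x) \<le> M" using period_map_bounded[OF translation continuous] by blast
  have "range (period_map D) = UNIV"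
  proof (rule ccontr)
    assume ne: "range (period_map D) \<noteq> UNIV"
    have "subspace (range (period_map D))" using linear_subspace_image[OF linear_period_map subspace_UNIV] .
    then have "span (range (period_map D)) \<noteq> UNIV" using ne by (simp add: span_eq_iff[THEN iffD2])
    then obtain a where a: "a \<noteq> 0" "\<forall>x\<in>span (range (period_map D)). a \<bullet> x = 0"
      using span_not_univ_subset_hyperplane span_not_UNIV_orthogonal by blast
    then have a2: "a \<bullet> period_map D x = 0" for x by (simp add: span_base)
    \<comment> \<open>Chosen so that the point \<open>t *\<^sub>R a\<close> has distance M + 1 from
      the hyperplane orthogonal to \<open>a\<close>, just more than the error allows.\<close>
    define t where "t = (M + 1) / norm a"
    obtain x where x: "D x = t *\<^sub>R a" using surj by (metis surjD)
    have "a \<bullet> (D x - period_map D x) = (M + 1) * norm a"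
      using a(1) a2 x by (simp add: inner_diff_right t_def dot_square_norm power2_eq_square)
    then have "(M + 1) * norm a \<le> norm a * norm (D x - period_map D x)"
      using norm_cauchy_schwarz[of a "D x - period_map D x"] by simp
    also have "\<dots> \<le> norm a * M" using M(2) by (simp add: mult_left_mono)
    finally show False using a(1) by (simp add: algebra_simps)
  qed
  then show ?thesis using linear_surjective_imp_injective[OF linear_period_map[of D]] by simp
qed

lemma period_map_eq_0: "period_map D v = 0 \<longleftrightarrow> v = 0"
  using injD[OF inj_period_map, of v 0] linear_0[OF linear_period_map[of D]] by auto

end

section \<open>Comparing the linear parts of two flat tori\<close>

text \<open>Lifting the segment from \<open>D x\<close> to \<open>D y\<close> and measuring it with
  the second metric bounds the displacement of \<open>D'\<close> by \<open>C\<close> times that of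
  \<open>D\<close>, up to a constant that disappears in the growth rate.\<close>

lemma period_map_compare:
  assumes "flat_torus G D" and "flat_torus G' D'" and C: "C \<ge> 0"
    and le: "\<And>x v. G' x v v \<le> C\<^sup>2 * G x v v"
  shows "norm (period_map D' v) \<le> C * norm (period_map D v)"
proof -
  interpret T: flat_torus G D by fact
  interpret T': flat_torus G' D' by fact
  obtain M where M: "M \<ge> 0" "\<And>x y. norm (D x - D y - period_map D (x - y)) \<le> M"
    using T.period_map_asymptotic by blast
  obtain M' where M': "M' \<ge> 0" "\<And>x y. norm (D' x - D' y - period_map D' (x - y)) \<le> M'"
    using T'.period_map_asymptotic by blast
  obtain c where c: "c > 0" "\<And>x. c * norm x \<le> norm (period_map D x)"
    using linear_inj_bounded_below_pos[OF linear_period_map T.inj_period_map] by (metis mult.commute)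
  obtain B where B: "B > 0" "\<And>x. norm (period_map D' x) \<le> B * norm x"
    using linear_bounded_pos[OF linear_period_map] by blast
  have f: "\<forall>z. \<exists>f'. (D' has_derivative f') (at z) \<and> (\<forall>v. f' v \<bullet> f' v \<le> C\<^sup>2 * G z v v)"
    using developing_derivative[OF T'.dev UNIV_I] le by metis
  have bd: "norm (D' y - D' x) \<le> C * norm (D y - D x) + (B * (M / c) + M')" for x y
  proof -
    obtain x' where x': "T.reaches x (D y) x'" using T.reaches_everywhere by blast
    have 1: "norm (D' x' - D' x) \<le> C * norm (D y - D x)"
      using x' f C unfolding T.reaches_def by blast
    \<comment> \<open>\<open>D\<close> has not been shown to be injective, so the lift may end at a
      point other than \<open>y\<close>. Both points have the same image, hence differ by a bounded
      amount, which costs only a constant.\<close>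
    have "norm (period_map D (x' - y)) \<le> M" using M(2)[of x' y] x' by (simp add: T.reaches_def)
    then have "norm (x' - y) \<le> M / c" using c(2)[of "x' - y"] c(1) by (simp add: field_simps)
    then have "norm (period_map D' (x' - y)) \<le> B * (M / c)"
      using B(2)[of "x' - y"] B(1) by (meson mult_left_mono less_imp_le order_trans)
    then have 2: "norm (D' x' - D' y) \<le> B * (M / c) + M'"
      using M'(2)[of x' y] norm_triangle_ineq[of "D' x' - D' y - period_map D' (x' - y)" "period_map D' (x' - y)"] by simp
    have "norm (D' y - D' x) \<le> norm (D' x' - D' x) + norm (D' x' - D' y)"
      using norm_triangle_ineq4[of "D' x' - D' x" "D' x' - D' y"] by simp
    then show ?thesis using 1 2 by simp
  qed
  show ?thesis
  proof (rule asymptotic_norm_le[OF linear_period_map linear_period_map])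
    fix k :: nat
    let ?x = "real k *\<^sub>R v"
    have "norm (period_map D' ?x) \<le> norm (D' ?x - D' 0) + M'"
      using M'(2)[of ?x 0] norm_triangle_ineq4[of "D' ?x - D' 0" "D' ?x - D' 0 - period_map D' ?x"] by simp
    also have "norm (D' ?x - D' 0) \<le> C * norm (D ?x - D 0) + (B * (M / c) + M')" by (rule bd)
    also have "C * norm (D ?x - D 0) \<le> C * (norm (period_map D ?x) + M)"
      using M(2)[of ?x 0] norm_triangle_ineq[of "D ?x - D 0 - period_map D ?x" "period_map D ?x"]
      by (intro mult_left_mono C) simp
    finally show "norm (period_map D' ?x) \<le> C * norm (period_map D ?x) + (C * M + (B * (M / c) + M') + M')"
      by (simp add: algebra_simps)
  qed
qed

text \<open>Growth rates see \<open>f\<close> only through the linear map \<open>B\<close> that it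
  follows at bounded distance. The dimensions may differ: this serves the inclusion of a fiber in a
  boundary torus as well as lifts of isometries.\<close>

lemma period_map_isometric:
  fixes f :: "'e::euclidean_space \<Rightarrow> 'f::euclidean_space"
  assumes "flat_torus G D" and "flat_torus G' D'" and B: "linear B" "\<And>x. norm (f x - B x) \<le> K"
    and iso: "\<And>x. norm (D' (f x) - D' (f 0)) = norm (D x - D 0)"
  shows "norm (period_map D' (B v)) = norm (period_map D v)"
proof -
  interpret T: flat_torus G D by fact
  interpret T': flat_torus G' D' by fact
  obtain M where M: "M \<ge> 0" "\<And>x y. norm (D x - D y - period_map D (x - y)) \<le> M"
    using T.period_map_asymptotic by blast
  obtain M' where M': "M' \<ge> 0" "\<And>x y. norm (D' x - D' y - period_map D' (x - y)) \<le> M'"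
    using T'.period_map_asymptotic by blast
  obtain C where C: "C > 0" "\<And>x. norm (period_map D' x) \<le> C * norm x"
    using linear_bounded_pos[OF linear_period_map] by blast
  have lin: "linear (\<lambda>v. period_map D' (B v))"
    using linear_compose[OF B(1) linear_period_map] by (simp add: o_def)
  have diff: "\<bar>norm (period_map D' (B x)) - norm (period_map D x)\<bar> \<le> C * (K + K) + M' + M" for x
  proof -
    have B0: "norm (f 0) \<le> K" using B(2)[of 0] by (simp add: linear_0[OF B(1)])
    have "norm (f x - f 0 - B x) \<le> K + K"
      using norm_triangle_ineq4[of "f x - B x" "f 0"] B(2)[of x] B0 by (simp add: algebra_simps)
    then have "norm (period_map D' (f x - f 0 - B x)) \<le> C * (K + K)"
      using C by (meson mult_left_mono less_imp_le order_trans)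
    then have 1: "norm (period_map D' (f x - f 0) - period_map D' (B x)) \<le> C * (K + K)"
      by (simp add: linear_diff[OF linear_period_map])
    have 2: "norm (D' (f x) - D' (f 0) - period_map D' (f x - f 0)) \<le> M'" by (rule M'(2))
    have 3: "norm (D x - D 0 - period_map D x) \<le> M" using M(2)[of x 0] by simp
    have "\<bar>norm (period_map D' (f x - f 0)) - norm (period_map D' (B x))\<bar> \<le> C * (K + K)"
      using 1 norm_triangle_ineq3 order_trans by blast
    moreover have "\<bar>norm (D' (f x) - D' (f 0)) - norm (period_map D' (f x - f 0))\<bar> \<le> M'"
      using 2 norm_triangle_ineq3 order_trans by blast
    moreover have "\<bar>norm (D x - D 0) - norm (period_map D x)\<bar> \<le> M"
      using 3 norm_triangle_ineq3 order_trans by blast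
    ultimately show ?thesis using iso[of x] by linarith
  qed
  show ?thesis
  proof (rule antisym)
    have "norm (period_map D' (B v)) \<le> 1 * norm (period_map D v)"
      by (rule asymptotic_norm_le[OF lin linear_period_map, where K = "C * (K + K) + M' + M"])
        (use diff in \<open>smt (verit)\<close>)
    then show "norm (period_map D' (B v)) \<le> norm (period_map D v)" by simp
    have "norm (period_map D v) \<le> 1 * norm (period_map D' (B v))"
      by (rule asymptotic_norm_le[OF linear_period_map lin, where K = "C * (K + K) + M' + M"])
        (use diff in \<open>smt (verit)\<close>)
    then show "norm (period_map D v) \<le> norm (period_map D' (B v))" by simp
  qed
qed

section \<open>Periods of one-dimensional homology classes\<close>

definition frag_sum :: "('s \<Rightarrow> 'v::real_vector) \<Rightarrow> ('s \<Rightarrow>\<^sub>0 int) \<Rightarrow> 'v" where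
  "frag_sum h c = (\<Sum>s\<in>Poly_Mapping.keys c. of_int (Poly_Mapping.lookup c s) *\<^sub>R h s)"

lemma frag_sum_superset:
  assumes "finite S" "Poly_Mapping.keys c \<subseteq> S"
  shows "frag_sum h c = (\<Sum>s\<in>S. of_int (Poly_Mapping.lookup c s) *\<^sub>R h s)"
  unfolding frag_sum_def using assms
  by (intro sum.mono_neutral_left) (auto simp: in_keys_iff)

lemma frag_sum_0 [simp]: "frag_sum h 0 = 0"
  by (simp add: frag_sum_def)

lemma frag_sum_of [simp]: "frag_sum h (frag_of s) = h s"
  by (simp add: frag_sum_def)

lemma frag_sum_add: "frag_sum h (a + b) = frag_sum h a + frag_sum h b"
proof -
  let ?S = "Poly_Mapping.keys a \<union> Poly_Mapping.keys b"
  have "frag_sum h (a + b) = (\<Sum>s\<in>?S. of_int (Poly_Mapping.lookup (a + b) s) *\<^sub>R h s)"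
    using Poly_Mapping.keys_add[of a b] by (intro frag_sum_superset) auto
  also have "\<dots> = (\<Sum>s\<in>?S. of_int (Poly_Mapping.lookup a s) *\<^sub>R h s) + (\<Sum>s\<in>?S. of_int (Poly_Mapping.lookup b s) *\<^sub>R h s)"
    by (simp add: lookup_add scaleR_add_left sum.distrib)
  also have "\<dots> = frag_sum h a + frag_sum h b"
    by (simp add: frag_sum_superset[of ?S])
  finally show ?thesis .
qed

lemma frag_sum_cmul: "frag_sum h (frag_cmul k c) = of_int k *\<^sub>R frag_sum h c"
proof -
  have "frag_sum h (frag_cmul k c) = (\<Sum>s\<in>Poly_Mapping.keys c. of_int (Poly_Mapping.lookup (frag_cmul k c) s) *\<^sub>R h s)"
    by (rule frag_sum_superset) (auto simp: keys_cmul[THEN subsetD] intro: keys_cmul[THEN subsetD])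
  then show ?thesis by (simp add: frag_sum_def scaleR_sum_right)
qed

lemma frag_sum_minus: "frag_sum h (- c) = - frag_sum h c"
  using frag_sum_cmul[of h "-1" c] by simp

lemma frag_sum_diff: "frag_sum h (a - b) = frag_sum h a - frag_sum h b"
  using frag_sum_add[of h a "- b"] by (simp add: frag_sum_minus)

lemma frag_sum_sum: "frag_sum h (\<Sum>i\<in>I. c i) = (\<Sum>i\<in>I. frag_sum h (c i))"
  by (induction I rule: infinite_finite_induct) (simp_all add: frag_sum_add)

lemma frag_sum_extend: "frag_sum h (frag_extend \<phi> c) = frag_sum (\<lambda>s. frag_sum h (\<phi> s)) c"
  by (simp add: frag_extend_def frag_sum_sum frag_sum_cmul) (simp add: frag_sum_def)

lemma frag_sum_cong: "(\<And>s. s \<in> Poly_Mapping.keys c \<Longrightarrow> h s = h' s) \<Longrightarrow> frag_sum h c = frag_sum h' c"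
  by (simp add: frag_sum_def)

lemma frag_sum_linear:
  assumes "linear B" shows "frag_sum (\<lambda>s. B (h s)) c = B (frag_sum h c)"
  by (simp add: frag_sum_def linear_sum[OF assms] linear_scale[OF assms])

lemma frag_sum_plus: "frag_sum (\<lambda>s. h s + h' s) c = frag_sum h c + frag_sum h' c"
  by (simp add: frag_sum_def scaleR_add_right sum.distrib)

section \<open>Lifts to the universal cover and the increment cocycle\<close>

text \<open>The type of the parameter space is an explicit argument because a predicate cannot
  quantify over types. The instances wanted are intervals, triangles in the plane and the cover
  itself.\<close>

definition lifting :: "'z::real_normed_vector itself \<Rightarrow> 'x topology \<Rightarrow> ('e::euclidean_space \<Rightarrow> 'x) \<Rightarrow> bool" where
  "lifting _ X p \<longleftrightarrow> (\<forall>(S::'z set) f. convex S \<and> continuous_map (top_of_set S) X f \<longrightarrow>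
      (\<exists>g. continuous_on S g \<and> (\<forall>t\<in>S. p (g t) = f t)))"

text \<open>Different values of a coordinate are at least 2 pi apart, so each coordinate is constant
  on a connected set.\<close>

lemma period_lattice_discrete:
  fixes g :: "'z::topological_space \<Rightarrow> 'e::euclidean_space"
  assumes S: "connected S" and g: "continuous_on S g" "\<And>t. t \<in> S \<Longrightarrow> g t \<in> period_lattice"
    and st: "s \<in> S" "t \<in> S"
  shows "g s = g t"
proof (rule euclidean_eqI)
  fix b :: 'e assume b: "b \<in> Basis"
  have "(\<lambda>t. g t \<bullet> b) constant_on S"
  proof (rule continuous_discrete_range_constant[OF S])
    show "continuous_on S (\<lambda>t. g t \<bullet> b)" by (intro continuous_intros g)
    fix x assume x: "x \<in> S"
    have "2 * pi \<le> norm (g y \<bullet> b - g x \<bullet> b)" if y: "y \<in> S" "g y \<bullet> b \<noteq> g x \<bullet> b" for y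
    proof -
      obtain k m :: int where k: "g y \<bullet> b = 2 * pi * of_int k" "g x \<bullet> b = 2 * pi * of_int m"
        using g(2)[OF y(1)] g(2)[OF x] b unfolding period_lattice_def by blast
      have "k \<noteq> m" using k y(2) by auto
      then have "1 \<le> \<bar>real_of_int (k - m)\<bar>" by linarith
      then have "2 * pi * 1 \<le> 2 * pi * \<bar>real_of_int (k - m)\<bar>" by (intro mult_left_mono) auto
      also have "\<dots> = \<bar>2 * pi * real_of_int (k - m)\<bar>" by (simp add: abs_mult)
      also have "2 * pi * real_of_int (k - m) = g y \<bullet> b - g x \<bullet> b" unfolding k by (simp add: algebra_simps)
      finally show ?thesis by simp
    qed
    then show "\<exists>e>0. \<forall>y. y \<in> S \<and> g y \<bullet> b \<noteq> g x \<bullet> b \<longrightarrow> e \<le> norm (g y \<bullet> b - g x \<bullet> b)"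
      by (intro exI[of _ "2 * pi"]) auto
  qed
  then show "g s \<bullet> b = g t \<bullet> b" using st unfolding constant_on_def by metis
qed

text \<open>Affine parametrization of the standard 1-simplex, whose points are functions giving
  barycentric coordinates; \<open>triangle\<close> does the same for the 2-simplex.\<close>

definition edge :: "real \<Rightarrow> nat \<Rightarrow> real" where
  "edge t = (\<lambda>i. if i = 0 then 1 - t else if i = 1 then t else 0)"

definition triangle :: "real \<times> real \<Rightarrow> nat \<Rightarrow> real" where
  "triangle q = (\<lambda>i. if i = 0 then 1 - fst q - snd q else if i = 1 then fst q else if i = 2 then snd q else 0)"

lemma edge_in_simplex: "t \<in> {0..1} \<Longrightarrow> edge t \<in> standard_simplex (Suc 0)"
  by (auto simp: standard_simplex_def edge_def)

lemma triangle_in_simplex: "0 \<le> fst q \<Longrightarrow> 0 \<le> snd q \<Longrightarrow> fst q + snd q \<le> 1 \<Longrightarrow> triangle q \<in> standard_simplex (Suc (Suc 0))"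
  by (auto simp: standard_simplex_def triangle_def)

lemma edge_endpoints: "edge 0 = (\<lambda>j. if j = 0 then 1 else 0)" "edge 1 = (\<lambda>j. if j = 1 then 1 else 0)"
  by (auto simp: edge_def)

lemma continuous_edge: "continuous_map (top_of_set {0..1}) (subtopology (powertop_real UNIV) (standard_simplex (Suc 0))) edge"
  unfolding continuous_map_in_subtopology
proof
  show "continuous_map (top_of_set {0..1}) (powertop_real UNIV) edge"
    unfolding continuous_map_componentwise_UNIV
  proof
    show "continuous_map (top_of_set {0..1}) euclideanreal (\<lambda>t. edge t k)" for k
      by (cases "k = 0"; cases "k = 1")
        (auto simp: edge_def continuous_map_iff_continuous intro!: continuous_intros)
  qed
  show "edge \<in> topspace (top_of_set {0..1}) \<rightarrow> standard_simplex (Suc 0)"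
    using edge_in_simplex by auto
qed

lemma continuous_triangle:
  "continuous_map (top_of_set {q. 0 \<le> fst q \<and> 0 \<le> snd q \<and> fst q + snd q \<le> 1})
     (subtopology (powertop_real UNIV) (standard_simplex (Suc (Suc 0)))) triangle"
  unfolding continuous_map_in_subtopology
proof
  show "continuous_map (top_of_set {q. 0 \<le> fst q \<and> 0 \<le> snd q \<and> fst q + snd q \<le> 1}) (powertop_real UNIV) triangle"
    unfolding continuous_map_componentwise_UNIV
  proof
    show "continuous_map (top_of_set {q. 0 \<le> fst q \<and> 0 \<le> snd q \<and> fst q + snd q \<le> 1}) euclideanreal (\<lambda>q. triangle q k)" for k
      by (cases "k = 0"; cases "k = 1"; cases "k = 2")
        (auto simp: triangle_def continuous_map_iff_continuous intro!: continuous_intros)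
  qed
  show "triangle \<in> topspace (top_of_set {q. 0 \<le> fst q \<and> 0 \<le> snd q \<and> fst q + snd q \<le> 1}) \<rightarrow> standard_simplex (Suc (Suc 0))"
    using triangle_in_simplex by auto
qed

text \<open>A universal cover with the lattice as deck group. Existence of lifts is assumed in place
  of evenly covered neighbourhoods; their uniqueness up to lattice vectors follows from
  discreteness.\<close>

locale lattice_cover =
  fixes X :: "'x topology" and p :: "'e::euclidean_space \<Rightarrow> 'x"
  assumes continuous_cover: "continuous_map euclidean X p"
    and cover_eq_iff: "p x = p y \<longleftrightarrow> x - y \<in> period_lattice"
    and range_cover: "range p = topspace X"
    and lift_path: "lifting TYPE(real) X p"
    and lift_square: "lifting TYPE(real \<times> real) X p"
    and lift_self: "lifting TYPE('e) X p"
begin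

definition lift_of :: "((nat \<Rightarrow> real) \<Rightarrow> 'x) \<Rightarrow> (real \<Rightarrow> 'e) \<Rightarrow> bool" where
  "lift_of \<sigma> g \<longleftrightarrow> continuous_on {0..1} g \<and> (\<forall>t\<in>{0..1}. p (g t) = \<sigma> (edge t))"

definition increment :: "((nat \<Rightarrow> real) \<Rightarrow> 'x) \<Rightarrow> 'e" where
  "increment \<sigma> = (THE d. \<exists>g. lift_of \<sigma> g \<and> d = g 1 - g 0)"

text \<open>Two lifts of the same edge differ by a continuous function with lattice values, hence by
  a constant, so the definite description in \<open>increment\<close> is justified.\<close>

lemma increment_eq:
  assumes "lift_of \<sigma> g" shows "increment \<sigma> = g 1 - g 0"
  unfolding increment_def
proof (rule the_equality)
  show "\<exists>g'. lift_of \<sigma> g' \<and> g 1 - g 0 = g' 1 - g' 0" using assms by blast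
  fix d assume "\<exists>g. lift_of \<sigma> g \<and> d = g 1 - g 0"
  then obtain h where h: "lift_of \<sigma> h" "d = h 1 - h 0" by blast
  have "h 1 - g 1 = h 0 - g 0"
  proof (rule period_lattice_discrete[where S = "{0..1}" and g = "\<lambda>t. h t - g t"])
    show "continuous_on {0..1} (\<lambda>t. h t - g t)"
      using h assms unfolding lift_of_def by (intro continuous_intros) auto
    show "h t - g t \<in> period_lattice" if "t \<in> {0..1}" for t
      using h assms that cover_eq_iff unfolding lift_of_def by metis
  qed auto
  then have "h 1 - h 0 = g 1 - g 0" by (metis add_diff_cancel_left diff_add_cancel diff_diff_eq2)
  then show "d = g 1 - g 0" using h(2) by simp
qed

lemma lift_exists:
  assumes "singular_simplex (Suc 0) X \<sigma>" obtains g where "lift_of \<sigma> g"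
proof -
  have "continuous_map (top_of_set {0..1}) X (\<sigma> \<circ> edge)"
    using assms continuous_map_compose[OF continuous_edge] unfolding singular_simplex_def by blast
  moreover have "convex {0..1::real}" by simp
  ultimately show ?thesis
    using lift_path that unfolding lifting_def lift_of_def by (metis comp_apply)
qed

text \<open>The whole triangle lifts at once, and the increments of its sides are differences of the
  lift at the three vertices, which telescope. Thus \<open>increment\<close> is a cocycle.\<close>

lemma increment_triangle:
  assumes \<tau>: "singular_simplex (Suc (Suc 0)) X \<tau>"
  shows "increment (singular_face 2 0 \<tau>) - increment (singular_face 2 1 \<tau>) + increment (singular_face 2 2 \<tau>) = 0"
proof -
  define S :: "(real \<times> real) set" where "S = {q. 0 \<le> fst q \<and> 0 \<le> snd q \<and> fst q + snd q \<le> 1}"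
  have "S = {q. (-1, 0) \<bullet> q \<le> 0} \<inter> {q. (0, -1) \<bullet> q \<le> 0} \<inter> {q. (1, 1) \<bullet> q \<le> 1}"
    by (auto simp: S_def inner_prod_def)
  then have "convex S" by (simp add: convex_Int convex_halfspace_le)
  moreover have "continuous_map (top_of_set S) X (\<tau> \<circ> triangle)"
    using \<tau> continuous_map_compose[OF continuous_triangle] unfolding singular_simplex_def S_def by blast
  ultimately obtain g where g: "continuous_on S g" "\<And>q. q \<in> S \<Longrightarrow> p (g q) = \<tau> (triangle q)"
    using lift_square unfolding lifting_def by (metis comp_apply)
  have face: "singular_face 2 k \<tau> (edge t) = \<tau> (simplical_face k (edge t))" if "t \<in> {0..1}" for k t
    using edge_in_simplex[OF that] by (simp add: singular_face_def)
  \<comment> \<open>Face 0 is opposite to vertex 0 and runs from (1, 0) to (0, 1), which explains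
    the reversed first coordinate.\<close>
  have sf: "simplical_face 0 (edge t) = triangle (1 - t, t)" "simplical_face (Suc 0) (edge t) = triangle (0, t)"
    "simplical_face 2 (edge t) = triangle (t, 0)" for t
    by (auto simp: simplical_face_def edge_def triangle_def fun_eq_iff numeral_2_eq_2)
  have comp: "continuous_on {0..1} (\<lambda>t. g (q t))"
    if "continuous_on {0..1} q" "\<And>t. t \<in> {0..1} \<Longrightarrow> q t \<in> S" for q
    using continuous_on_compose2[OF g(1) that(1)] that(2) by blast
  have "increment (singular_face 2 0 \<tau>) = g (1 - 1, 1) - g (1 - 0, 0)"
    by (rule increment_eq[where g = "\<lambda>t. g (1 - t, t)"])
      (auto simp: lift_of_def face sf S_def intro!: g(2) comp continuous_intros)
  moreover have "increment (singular_face 2 1 \<tau>) = g (0, 1) - g (0, 0)"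
    by (rule increment_eq[where g = "\<lambda>t. g (0, t)"])
      (auto simp: lift_of_def face sf S_def intro!: g(2) comp continuous_intros)
  moreover have "increment (singular_face 2 2 \<tau>) = g (1, 0) - g (0, 0)"
    by (rule increment_eq[where g = "\<lambda>t. g (t, 0)"])
      (auto simp: lift_of_def face sf S_def intro!: g(2) comp continuous_intros)
  ultimately show ?thesis by simp
qed

lemma increment_boundary:
  assumes "singular_chain (Suc (Suc 0)) X d"
  shows "frag_sum increment (chain_boundary (Suc (Suc 0)) d) = 0"
proof -
  have "frag_sum increment (chain_boundary (Suc (Suc 0)) d) =
    frag_sum (\<lambda>\<tau>. increment (singular_face 2 0 \<tau>) - increment (singular_face 2 1 \<tau>) + increment (singular_face 2 2 \<tau>)) d"
    unfolding chain_boundary_def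
    by (simp add: frag_sum_extend frag_sum_add frag_sum_diff frag_sum_minus numeral_2_eq_2)
  also have "\<dots> = frag_sum (\<lambda>_. 0) d"
    using assms by (intro frag_sum_cong increment_triangle) (auto simp: singular_chain_def)
  finally show ?thesis by (simp add: frag_sum_def)
qed

text \<open>The pairing of a homology class with the cocycle \<open>increment\<close>. The chosen
  representative does not matter, since the cocycle vanishes on boundaries.\<close>

definition period :: "'x chain set \<Rightarrow> 'e" where
  "period \<alpha> = frag_sum increment (SOME c. c \<in> \<alpha>)"

lemma period_eq:
  assumes \<alpha>: "\<alpha> \<in> carrier (homology_group 1 X)" and c: "c \<in> \<alpha>"
  shows "period \<alpha> = frag_sum increment c"
proof -
  obtain a where a: "\<alpha> = homologous_rel_set (Suc 0) X {} a"
    using \<alpha> carrier_relative_homology_group[of "Suc 0" X "{}"] by auto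
  define c' where "c' = (SOME c. c \<in> \<alpha>)"
  have c': "c' \<in> \<alpha>" unfolding c'_def using c by (rule someI)
  have "homologous_rel (Suc 0) X {} c c'"
    using c c' homologous_rel_sym homologous_rel_trans unfolding a by blast
  then obtain d where "singular_chain (Suc (Suc 0)) X d" "chain_boundary (Suc (Suc 0)) d = c - c'"
    unfolding homologous_rel_def singular_boundary by blast
  then have "frag_sum increment (c - c') = 0" using increment_boundary by metis
  then show ?thesis by (simp add: period_def c'_def[symmetric] frag_sum_diff)
qed

lemma period_class:
  assumes "singular_relcycle (Suc 0) X {} c"
  shows "homologous_rel_set (Suc 0) X {} c \<in> carrier (homology_group 1 X)"
    "period (homologous_rel_set (Suc 0) X {} c) = frag_sum increment c"
proof -
  show *: "homologous_rel_set (Suc 0) X {} c \<in> carrier (homology_group 1 X)"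
    using carrier_relative_homology_group[of "Suc 0" X "{}"] assms by auto
  show "period (homologous_rel_set (Suc 0) X {} c) = frag_sum increment c"
    by (rule period_eq[OF *]) simp
qed

lemma period_mult:
  assumes "\<alpha> \<in> carrier (homology_group 1 X)" "\<beta> \<in> carrier (homology_group 1 X)"
  shows "period (\<alpha> \<otimes>\<^bsub>homology_group 1 X\<^esub> \<beta>) = period \<alpha> + period \<beta>"
proof -
  interpret comm_group "homology_group 1 X" by simp
  obtain a b where ab: "a \<in> \<alpha>" "b \<in> \<beta>"
    using assms carrier_relative_homology_group[of "Suc 0" X "{}"] by auto (metis homologous_rel_refl mem_Collect_eq)
  have "a + b \<in> \<alpha> \<otimes>\<^bsub>homology_group 1 X\<^esub> \<beta>"
    using ab mult_relative_homology_group[of "Suc 0" X "{}"] by auto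
  then have "period (\<alpha> \<otimes>\<^bsub>homology_group 1 X\<^esub> \<beta>) = frag_sum increment (a + b)"
    by (rule period_eq[OF m_closed[OF assms]])
  then show ?thesis using period_eq[OF assms(1) ab(1)] period_eq[OF assms(2) ab(2)] by (simp add: frag_sum_add)
qed

lemma period_one: "period \<one>\<^bsub>homology_group 1 X\<^esub> = 0"
proof -
  interpret comm_group "homology_group 1 X" by simp
  have "period (\<one>\<^bsub>homology_group 1 X\<^esub> \<otimes>\<^bsub>homology_group 1 X\<^esub> \<one>\<^bsub>homology_group 1 X\<^esub>) = period \<one>\<^bsub>homology_group 1 X\<^esub> + period \<one>\<^bsub>homology_group 1 X\<^esub>"
    by (rule period_mult) auto
  then show ?thesis by simp
qed

lemma period_pow:
  assumes \<alpha>: "\<alpha> \<in> carrier (homology_group 1 X)"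
  shows "period (\<alpha> [^]\<^bsub>homology_group 1 X\<^esub> (n::int)) = of_int n *\<^sub>R period \<alpha>"
proof -
  interpret comm_group "homology_group 1 X" by simp
  show ?thesis
  proof (induction n rule: int_induct[where k = 0])
    case base
    then show ?case by (simp add: period_one)
  next
    case (step1 i)
    have "\<alpha> [^]\<^bsub>homology_group 1 X\<^esub> (i + 1) = \<alpha> [^]\<^bsub>homology_group 1 X\<^esub> i \<otimes>\<^bsub>homology_group 1 X\<^esub> \<alpha>"
      using \<alpha> by (simp add: int_pow_mult)
    then show ?case using step1 period_mult[OF int_pow_closed[OF \<alpha>] \<alpha>] by (simp add: scaleR_add_left)
  next
    case (step2 i)
    have "\<alpha> [^]\<^bsub>homology_group 1 X\<^esub> i = \<alpha> [^]\<^bsub>homology_group 1 X\<^esub> (i - 1) \<otimes>\<^bsub>homology_group 1 X\<^esub> \<alpha>"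
      using \<alpha> int_pow_mult[OF \<alpha>, of "i - 1" 1] by simp
    then show ?case using step2 period_mult[OF int_pow_closed[OF \<alpha>] \<alpha>, of "i - 1"] by (simp add: scaleR_diff_left eq_diff_eq)
  qed
qed

lemma period_zcomb:
  assumes "range b \<subseteq> carrier (homology_group 1 X)"
  shows "period (zcomb (homology_group 1 X) b n) = (\<Sum>k\<in>UNIV. of_int (n k) *\<^sub>R period (b k))"
proof -
  interpret comm_group "homology_group 1 X" by simp
  have "period (finprod (homology_group 1 X) (\<lambda>k. b k [^]\<^bsub>homology_group 1 X\<^esub> n k) A)
      = (\<Sum>k\<in>A. of_int (n k) *\<^sub>R period (b k))" for A
  proof (induction A rule: infinite_finite_induct)
    case (infinite A) then show ?case by simp
  next
    case empty then show ?case by (simp add: period_one)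
  next
    case (insert k A)
    have "b k [^]\<^bsub>homology_group 1 X\<^esub> n k \<in> carrier (homology_group 1 X)" for k
      using assms by (auto intro!: int_pow_closed)
    then show ?case using insert assms
      by (simp add: Pi_def finprod_insert period_mult finprod_closed period_pow image_subset_iff)
  qed
  then show ?thesis by (simp add: zcomb_def)
qed

text \<open>The straight path along \<open>b\<close> closes up to a loop in \<open>X\<close>. This
  shows that periods of a basis of the homology cannot all vanish, which ends the main
  proof.\<close>

lemma exists_period:
  assumes b: "b \<in> Basis"
  obtains \<alpha> where "\<alpha> \<in> carrier (homology_group 1 X)" "period \<alpha> = (2 * pi) *\<^sub>R b"
proof -
  define \<sigma> where "\<sigma> = restrict (\<lambda>x. p ((2 * pi * x 1) *\<^sub>R b)) (standard_simplex (Suc 0))"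
  have cont: "continuous_map (powertop_real UNIV) X (\<lambda>x::nat \<Rightarrow> real. p ((2 * pi * x 1) *\<^sub>R b))"
  proof -
    have 1: "continuous_map (powertop_real UNIV) euclideanreal (\<lambda>x. x (1::nat))"
      by (rule continuous_map_product_projection) simp
    have 2: "continuous_map euclideanreal euclidean (\<lambda>t. (2 * pi * t) *\<^sub>R b)"
      by (auto simp: continuous_map_iff_continuous intro!: continuous_intros)
    show ?thesis
      using continuous_map_compose[OF continuous_map_compose[OF 1 2] continuous_cover] by (simp only: o_def)
  qed
  have \<sigma>: "singular_simplex (Suc 0) X \<sigma>"
    unfolding singular_simplex_def \<sigma>_def
    using continuous_map_from_subtopology[OF cont] by (auto intro: continuous_map_eq)
  have ends: "p ((2 * pi) *\<^sub>R b) = p 0"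
    using cover_eq_iff[of "(2 * pi) *\<^sub>R b" 0] lattice_Basis[OF b] by simp
  \<comment> \<open>The two ends of the path project to the same point, so the faces coincide and
    the single simplex is a cycle.\<close>
  have f: "singular_face (Suc 0) 0 \<sigma> = singular_face (Suc 0) (Suc 0) \<sigma>"
  proof
    fix x
    show "singular_face (Suc 0) 0 \<sigma> x = singular_face (Suc 0) (Suc 0) \<sigma> x"
    proof (cases "x \<in> standard_simplex 0")
      case True
      then have x: "x = (\<lambda>j. if j = 0 then 1 else 0)" by (simp add: standard_simplex_0)
      have "simplical_face 0 x = edge 1" "simplical_face (Suc 0) x = edge 0"
        by (auto simp: simplical_face_def x edge_def fun_eq_iff)
      then show ?thesis using True edge_in_simplex[of 0] edge_in_simplex[of 1] ends
        by (simp add: singular_face_def \<sigma>_def edge_def)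
    qed (simp add: singular_face_def)
  qed
  have "chain_boundary (Suc 0) (frag_of \<sigma>) = 0" by (simp add: chain_boundary_of f)
  then have cyc: "singular_relcycle (Suc 0) X {} (frag_of \<sigma>)"
    by (simp add: singular_cycle singular_chain_of \<sigma>)
  have e1: "edge t (Suc 0) = t" for t by (simp add: edge_def)
  have "increment \<sigma> = (2 * pi * 1) *\<^sub>R b - (2 * pi * 0) *\<^sub>R b"
    by (rule increment_eq[where g = "\<lambda>t. (2 * pi * t) *\<^sub>R b"])
      (use edge_in_simplex in \<open>auto simp: lift_of_def \<sigma>_def e1 intro!: continuous_intros\<close>)
  then show ?thesis using that[of "homologous_rel_set (Suc 0) X {} (frag_of \<sigma>)"] period_class[OF cyc] by simp
qed

end

text \<open>The \<open>u\<close>-terms cancel over a cycle since they are the values of a function of the endpoints.\<close>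

lemma period_natural:
  fixes p :: "'e::euclidean_space \<Rightarrow> 'x" and q :: "'f::euclidean_space \<Rightarrow> 'y"
  assumes "lattice_cover X p" "lattice_cover Y q"
    and f: "continuous_map X Y f" and F: "continuous_on UNIV F" "\<And>x. q (F x) = f (p x)"
    and B: "linear B" "\<And>x l. l \<in> period_lattice \<Longrightarrow> F (x + l) = F x + B l"
    and \<alpha>: "\<alpha> \<in> carrier (homology_group 1 X)"
  shows "lattice_cover.period q (hom_induced 1 X {} Y {} f \<alpha>) = B (lattice_cover.period p \<alpha>)"
proof -
  interpret X: lattice_cover X p by fact
  interpret Y: lattice_cover Y q by fact
  obtain c where c: "singular_relcycle (Suc 0) X {} c" "\<alpha> = homologous_rel_set (Suc 0) X {} c"
    using \<alpha> carrier_relative_homology_group[of "Suc 0" X "{}"] by auto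
  have cyc': "singular_relcycle (Suc 0) Y {} (chain_map (Suc 0) f c)"
    by (rule singular_relcycle_chain_map[OF c(1) f]) simp
  have "hom_induced 1 X {} Y {} f \<alpha> = homologous_rel_set (Suc 0) Y {} (chain_map (Suc 0) f c)"
    using hom_induced_chain_map[OF f _ c(1), of "{}"] c(2) by simp
  then have "Y.period (hom_induced 1 X {} Y {} f \<alpha>) = frag_sum Y.increment (chain_map (Suc 0) f c)"
    using Y.period_class(2)[OF cyc'] by simp
  also have "\<dots> = frag_sum (\<lambda>\<sigma>. Y.increment (simplex_map (Suc 0) f \<sigma>)) c"
    by (simp add: chain_map_def frag_sum_extend)
  also have "\<dots> = B (frag_sum X.increment c)"
  proof -
    define u where "u x = F x - B x" for x
    have u: "u (x + l) = u x" if "l \<in> period_lattice" for x l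
      using B that by (simp add: u_def linear_add[OF B(1)])
    \<comment> \<open>By its periodicity \<open>u\<close> descends to \<open>X\<close>; any preimage
      of \<open>y\<close> may be used.\<close>
    define v where "v y = u (SOME x. p x = y)" for y
    have v: "v (p x) = u x" for x
    proof -
      have "p (SOME x'. p x' = p x) = p x" by (rule someI[where P = "\<lambda>x'. p x' = p x"]) simp
      then have "(SOME x'. p x' = p x) - x \<in> period_lattice" by (simp add: X.cover_eq_iff)
      from u[OF this, of x] show ?thesis by (simp add: v_def)
    qed
    have inc: "Y.increment (simplex_map (Suc 0) f \<sigma>) = B (X.increment \<sigma>) + (v (\<sigma> (edge 1)) - v (\<sigma> (edge 0)))"
      if \<sigma>: "singular_simplex (Suc 0) X \<sigma>" for \<sigma>
    proof -
      obtain g where g: "X.lift_of \<sigma> g" using X.lift_exists[OF \<sigma>] by blast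
      have "Y.lift_of (simplex_map (Suc 0) f \<sigma>) (\<lambda>t. F (g t))"
        using g continuous_on_compose2[OF F(1), of "{0..1}" g] edge_in_simplex F(2)
        by (auto simp: Y.lift_of_def X.lift_of_def simplex_map_def)
      then have "Y.increment (simplex_map (Suc 0) f \<sigma>) = F (g 1) - F (g 0)" by (rule Y.increment_eq)
      moreover have "\<sigma> (edge 1) = p (g 1)" "\<sigma> (edge 0) = p (g 0)"
        using g unfolding X.lift_of_def by auto
      ultimately show ?thesis using X.increment_eq[OF g] v
        by (simp add: u_def linear_diff[OF B(1)])
    qed
    have "frag_sum (\<lambda>\<sigma>. Y.increment (simplex_map (Suc 0) f \<sigma>)) c
        = frag_sum (\<lambda>\<sigma>. B (X.increment \<sigma>) + (v (\<sigma> (edge 1)) - v (\<sigma> (edge 0)))) c"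
      using c(1) by (intro frag_sum_cong inc) (auto simp: singular_relcycle_def singular_chain_def)
    also have "\<dots> = B (frag_sum X.increment c) + frag_sum (\<lambda>\<sigma>. v (\<sigma> (edge 1)) - v (\<sigma> (edge 0))) c"
      by (simp add: frag_sum_plus frag_sum_linear[OF B(1)])
    also have "frag_sum (\<lambda>\<sigma>. v (\<sigma> (edge 1)) - v (\<sigma> (edge 0))) c
      = frag_sum (\<lambda>s. v (s (edge 0))) (chain_boundary (Suc 0) c)"
    proof -
      \<comment> \<open>\<open>edge 0\<close> doubles as the only point of the standard 0-simplex,
        at which the faces of a 1-simplex are evaluated. The differences of end values thus become a
        0-cochain applied to the boundary of \<open>c\<close>.\<close>
      have "simplical_face 0 (edge 0) = edge 1" "simplical_face (Suc 0) (edge 0) = edge 0"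
        by (auto simp: simplical_face_def edge_def fun_eq_iff)
      moreover have "edge 0 \<in> standard_simplex 0" by (simp add: standard_simplex_0 edge_endpoints)
      ultimately have "singular_face (Suc 0) 0 \<sigma> (edge 0) = \<sigma> (edge 1)" "singular_face (Suc 0) (Suc 0) \<sigma> (edge 0) = \<sigma> (edge 0)" for \<sigma> :: "(nat \<Rightarrow> real) \<Rightarrow> 'x"
        by (simp_all add: singular_face_def)
      then show ?thesis unfolding chain_boundary_def by (simp add: frag_sum_extend frag_sum_add frag_sum_diff frag_sum_minus)
    qed
    also have "chain_boundary (Suc 0) c = 0" using c(1) by (simp add: singular_cycle)
    finally show ?thesis by simp
  qed
  finally show ?thesis using X.period_class(2)[OF c(1)] c(2) by simp
qed

section \<open>Second derivatives and the Koszul formula\<close>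

text \<open>The mean value theorem in direction \<open>u\<close>, applied to the difference of
  \<open>f\<close> along two parallel segments, leaves a difference of first derivatives, which
  \<open>L\<close> approximates. The derivative in direction \<open>u\<close> need only be
  differentiable at \<open>x\<close>, not continuously so.\<close>

lemma second_difference:
  fixes f :: "'e::real_normed_vector \<Rightarrow> real"
  assumes W: "open W" "x \<in> W" and f: "\<And>z. z \<in> W \<Longrightarrow> (f has_derivative f' z) (at z)"
    and f2: "((\<lambda>z. f' z u) has_derivative L) (at x)" and e: "e > 0"
  shows "\<exists>\<delta>>0. \<forall>t. 0 < t \<and> t < \<delta> \<longrightarrow>
    \<bar>f (x + t *\<^sub>R u + t *\<^sub>R v) - f (x + t *\<^sub>R u) - f (x + t *\<^sub>R v) + f x - t\<^sup>2 * L v\<bar> \<le> e * t\<^sup>2"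
proof -
  \<comment> \<open>A bound for combinations of \<open>u\<close> and \<open>v\<close> with
    coefficients at most t is t * C; the summand 1 keeps \<open>C\<close> positive. Dividing
    \<open>e\<close> by 2 * C below leaves e / 2 for each of the two approximations.\<close>
  define C where "C = norm u + norm v + 1"
  have C: "C > 0" by (simp add: C_def add_nonneg_pos)
  have linL: "linear L" using f2 has_derivative_linear by blast
  obtain d where d: "d > 0" "\<And>h. norm h < d \<Longrightarrow> \<bar>f' (x + h) u - f' x u - L h\<bar> \<le> e / (2 * C) * norm h"
  proof -
    have "e / (2 * C) > 0" using e C by simp
    then obtain d where "d > 0" "\<forall>y. norm (y - x) < d \<longrightarrow> norm (f' y u - f' x u - L (y - x)) \<le> e / (2 * C) * norm (y - x)"
      using f2 unfolding has_derivative_at_alt by blast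
    then show ?thesis using that[of d] by (metis add_diff_cancel_left' real_norm_def)
  qed
  obtain r where r: "r > 0" "ball x r \<subseteq> W" using W open_contains_ball by blast
  define \<delta> where "\<delta> = min d r / C"
  have "\<delta> > 0" using d r C by (simp add: \<delta>_def)
  moreover have "\<bar>f (x + t *\<^sub>R u + t *\<^sub>R v) - f (x + t *\<^sub>R u) - f (x + t *\<^sub>R v) + f x - t\<^sup>2 * L v\<bar> \<le> e * t\<^sup>2"
    if t: "0 < t" "t < \<delta>" for t
  proof -
    have tC: "t * C < min d r" using t C by (simp add: \<delta>_def pos_less_divide_eq)
    have small: "norm (s *\<^sub>R u + q *\<^sub>R v) \<le> t * C" if "0 \<le> s" "s \<le> t" "0 \<le> q" "q \<le> t" for s q
    proof -
      have "norm (s *\<^sub>R u + q *\<^sub>R v) \<le> s * norm u + q * norm v"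
        using norm_triangle_ineq[of "s *\<^sub>R u" "q *\<^sub>R v"] that by simp
      also have "\<dots> \<le> t * norm u + t * norm v" using that by (intro add_mono mult_right_mono) auto
      also have "\<dots> \<le> t * C" using t by (simp add: C_def algebra_simps)
      finally show ?thesis .
    qed
    have inW: "x + (s *\<^sub>R u + q *\<^sub>R v) \<in> W" if "0 \<le> s" "s \<le> t" "0 \<le> q" "q \<le> t" for s q
    proof -
      have "dist x (x + (s *\<^sub>R u + q *\<^sub>R v)) = norm (s *\<^sub>R u + q *\<^sub>R v)"
        by (metis add_diff_cancel_left' dist_commute dist_norm)
      then have "x + (s *\<^sub>R u + q *\<^sub>R v) \<in> ball x r" using small[OF that] tC by simp
      then show ?thesis using r(2) by blast
    qed
    define k where "k s = f (x + (s *\<^sub>R u + t *\<^sub>R v)) - f (x + (s *\<^sub>R u + 0 *\<^sub>R v))" for s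
    define k' where "k' s = f' (x + (s *\<^sub>R u + t *\<^sub>R v)) u - f' (x + (s *\<^sub>R u + 0 *\<^sub>R v)) u" for s
    have lin: "((\<lambda>s. f (x + (s *\<^sub>R u + q *\<^sub>R v))) has_derivative (\<lambda>h. f' (x + (s *\<^sub>R u + q *\<^sub>R v)) (h *\<^sub>R u))) (at s)"
      if "0 \<le> s" "s \<le> t" "0 \<le> q" "q \<le> t" for s q
    proof -
      have 1: "((\<lambda>s. x + (s *\<^sub>R u + q *\<^sub>R v)) has_derivative (\<lambda>h. h *\<^sub>R u)) (at s)"
        by (auto intro!: derivative_eq_intros)
      show ?thesis using has_derivative_compose[OF 1 f[OF inW[OF that]]] .
    qed
    have k: "(k has_real_derivative k' s) (at s)" if "0 \<le> s" "s \<le> t" for s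
    proof -
      have s1: "f' (x + (s *\<^sub>R u + q *\<^sub>R v)) (h *\<^sub>R u) = h * f' (x + (s *\<^sub>R u + q *\<^sub>R v)) u" if "q \<in> {0, t}" for h q
        using linear_scale[OF has_derivative_linear[OF f[OF inW]], of s q h u] \<open>0 \<le> s\<close> \<open>s \<le> t\<close> t that by auto
      have "(k has_derivative (\<lambda>h. f' (x + (s *\<^sub>R u + t *\<^sub>R v)) (h *\<^sub>R u) - f' (x + (s *\<^sub>R u + 0 *\<^sub>R v)) (h *\<^sub>R u))) (at s)"
        unfolding k_def by (rule has_derivative_diff[OF lin lin]) (use that t in auto)
      moreover have "f' (x + (s *\<^sub>R u + t *\<^sub>R v)) (h *\<^sub>R u) - f' (x + (s *\<^sub>R u + 0 *\<^sub>R v)) (h *\<^sub>R u) = k' s * h" for h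
        unfolding s1[OF insertI1] s1[OF insertI2[OF singletonI]] k'_def by (simp only: left_diff_distrib right_diff_distrib mult.commute)
      ultimately show ?thesis by (simp add: has_field_derivative_def)
    qed
    obtain \<xi> where \<xi>: "0 < \<xi>" "\<xi> < t" "k t - k 0 = (t - 0) * k' \<xi>"
      using MVT2[of 0 t k k'] k t by auto
    have 1: "\<bar>f' (x + (\<xi> *\<^sub>R u + q *\<^sub>R v)) u - f' x u - L (\<xi> *\<^sub>R u + q *\<^sub>R v)\<bar> \<le> e / 2 * t" if "q \<in> {0, t}" for q
    proof -
      have n: "norm (\<xi> *\<^sub>R u + q *\<^sub>R v) \<le> t * C" using small[of \<xi> q] \<xi> that by auto
      then have "\<bar>f' (x + (\<xi> *\<^sub>R u + q *\<^sub>R v)) u - f' x u - L (\<xi> *\<^sub>R u + q *\<^sub>R v)\<bar> \<le> e / (2 * C) * norm (\<xi> *\<^sub>R u + q *\<^sub>R v)"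
        using tC by (intro d(2)) auto
      also have "\<dots> \<le> e / (2 * C) * (t * C)" using n e C by (intro mult_left_mono) auto
      also have "\<dots> = e / 2 * t" using C by simp
      finally show ?thesis .
    qed
    have "L (\<xi> *\<^sub>R u + t *\<^sub>R v) - L (\<xi> *\<^sub>R u + 0 *\<^sub>R v) = t * L v"
      by (simp add: linear_add[OF linL] linear_scale[OF linL])
    then have "\<bar>k' \<xi> - t * L v\<bar> \<le> e * t" using 1[OF insertI2[OF singletonI]] 1[OF insertI1] unfolding k'_def by linarith
    then have "t * \<bar>k' \<xi> - t * L v\<bar> \<le> t * (e * t)" using t by (intro mult_left_mono) auto
    moreover have "\<bar>t * k' \<xi> - t * (t * L v)\<bar> = t * \<bar>k' \<xi> - t * L v\<bar>"
      using t by (simp add: abs_mult flip: right_diff_distrib)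
    ultimately have "\<bar>t * k' \<xi> - t * (t * L v)\<bar> \<le> e * t\<^sup>2"
      by (simp add: power2_eq_square ac_simps)
    moreover have "k t - k 0 = f (x + t *\<^sub>R u + t *\<^sub>R v) - f (x + t *\<^sub>R u) - f (x + t *\<^sub>R v) + f x"
      by (simp add: k_def add.assoc)
    ultimately show ?thesis using \<xi>(3) by (simp add: power2_eq_square)
  qed
  ultimately show ?thesis by blast
qed

text \<open>The second difference is symmetric in the two directions and approximates both mixed
  derivatives.\<close>

lemma second_derivative_symmetric_real:
  fixes f :: "'e::real_normed_vector \<Rightarrow> real"
  assumes W: "open W" "x \<in> W" and f: "\<And>z. z \<in> W \<Longrightarrow> (f has_derivative f' z) (at z)"
    and f2: "\<And>v. ((\<lambda>z. f' z v) has_derivative (\<lambda>u. f'' u v)) (at x)"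
  shows "f'' u v = f'' v u"
proof (rule ccontr)
  assume ne: "f'' u v \<noteq> f'' v u"
  \<comment> \<open>The two approximations together cost twice \<open>e\<close>, so a third of the
    gap leads to a contradiction.\<close>
  define e where "e = \<bar>f'' u v - f'' v u\<bar> / 3"
  have e: "e > 0" using ne by (simp add: e_def)
  obtain d1 where d1: "d1 > 0" "\<And>t. 0 < t \<Longrightarrow> t < d1 \<Longrightarrow>
    \<bar>f (x + t *\<^sub>R u + t *\<^sub>R v) - f (x + t *\<^sub>R u) - f (x + t *\<^sub>R v) + f x - t\<^sup>2 * f'' v u\<bar> \<le> e * t\<^sup>2"
    using second_difference[OF W f f2 e, of u v] by blast
  obtain d2 where d2: "d2 > 0" "\<And>t. 0 < t \<Longrightarrow> t < d2 \<Longrightarrow>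
    \<bar>f (x + t *\<^sub>R v + t *\<^sub>R u) - f (x + t *\<^sub>R v) - f (x + t *\<^sub>R u) + f x - t\<^sup>2 * f'' u v\<bar> \<le> e * t\<^sup>2"
    using second_difference[OF W f f2 e, of v u] by blast
  define t where "t = min d1 d2 / 2"
  have t: "0 < t" "t < d1" "t < d2" using d1 d2 by (auto simp: t_def)
  have "f (x + t *\<^sub>R v + t *\<^sub>R u) = f (x + t *\<^sub>R u + t *\<^sub>R v)" by (simp add: ac_simps)
  then have "\<bar>t\<^sup>2 * f'' u v - t\<^sup>2 * f'' v u\<bar> \<le> 2 * (e * t\<^sup>2)"
    using d1(2)[OF t(1,2)] d2(2)[OF t(1,3)] by linarith
  moreover have "\<bar>t\<^sup>2 * f'' u v - t\<^sup>2 * f'' v u\<bar> = t\<^sup>2 * \<bar>f'' u v - f'' v u\<bar>"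
    by (simp add: abs_mult flip: right_diff_distrib)
  ultimately have "t\<^sup>2 * \<bar>f'' u v - f'' v u\<bar> \<le> t\<^sup>2 * (2 * e)" by (simp add: ac_simps)
  then have "\<bar>f'' u v - f'' v u\<bar> \<le> 2 * e" using t(1) by simp
  then show False using e by (simp add: e_def)
qed

section \<open>Twice differentiable maps and smooth functions\<close>

text \<open>The derivatives are carried along as explicit functions. Continuity of the second
  derivative is not part of the notion: symmetry holds without it.\<close>

definition C2_map :: "'e::euclidean_space set \<Rightarrow> ('e \<Rightarrow> 'f::euclidean_space) \<Rightarrow> ('e \<Rightarrow> 'e \<Rightarrow> 'f) \<Rightarrow> ('e \<Rightarrow> 'e \<Rightarrow> 'e \<Rightarrow> 'f) \<Rightarrow> bool"
  where "C2_map W H H' H'' \<longleftrightarrow> open W \<and>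
    (\<forall>y\<in>W. (H has_derivative H' y) (at y) \<and> (\<forall>v. ((\<lambda>z. H' z v) has_derivative (\<lambda>u. H'' y u v)) (at y)))"

lemma C2_map_symmetric:
  assumes "C2_map W H H' H''" "y \<in> W"
  shows "H'' y u v = H'' y v u"
proof (rule euclidean_eqI)
  fix b :: 'b
  show "H'' y u v \<bullet> b = H'' y v u \<bullet> b"
    using assms unfolding C2_map_def
    by (intro second_derivative_symmetric_real[where W = W and x = y and f = "\<lambda>z. H z \<bullet> b" and f' = "\<lambda>z v. H' z v \<bullet> b"
        and f'' = "\<lambda>u v. H'' y u v \<bullet> b"]) (auto intro!: derivative_eq_intros)
qed

lemma C2_map_subset: "C2_map W H H' H'' \<Longrightarrow> open V \<Longrightarrow> V \<subseteq> W \<Longrightarrow> C2_map V H H' H''"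
  unfolding C2_map_def by blast

lemma Ck_on_C2_map:
  assumes "open W" "Ck_on 2 W H"
  shows "C2_map W H (\<lambda>y. frechet_derivative H (at y))
     (\<lambda>y u v. frechet_derivative (\<lambda>z. frechet_derivative H (at z) v) (at y) u)"
  using assms unfolding C2_map_def numeral_2_eq_2
  by (auto simp: differentiable_on_eq_differentiable_at frechet_derivative_works[symmetric])

lemma Ck_on_subset: "Ck_on k W f \<Longrightarrow> V \<subseteq> W \<Longrightarrow> Ck_on k V f"
proof (induction k arbitrary: f)
  case 0 then show ?case using continuous_on_subset by auto
next
  case (Suc k) then show ?case using differentiable_on_subset by fastforce
qed

lemma Ck_on_cong:
  assumes "open W" "\<And>x. x \<in> W \<Longrightarrow> f x = g x" "Ck_on k W f"
  shows "Ck_on k W g"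
  using assms(2,3)
proof (induction k arbitrary: f g)
  case 0 then show ?case by (simp cong: continuous_on_cong)
next
  case (Suc k)
  have d: "(f has_derivative frechet_derivative f (at x)) (at x)" if "x \<in> W" for x
    using Suc.prems(2) that assms(1) by (auto simp: differentiable_on_eq_differentiable_at frechet_derivative_works)
  then have g: "(g has_derivative frechet_derivative f (at x)) (at x)" if "x \<in> W" for x
    using has_derivative_transform_within_open[OF d[OF that] assms(1) that] Suc.prems(1) by blast
  then have eq: "frechet_derivative f (at x) = frechet_derivative g (at x)" if "x \<in> W" for x
    using that frechet_derivative_at by blast
  have "Ck_on k W (\<lambda>x. frechet_derivative g (at x) v)" for v
    using Suc.IH[of "\<lambda>x. frechet_derivative f (at x) v" "\<lambda>x. frechet_derivative g (at x) v"] eq Suc.prems(2) by simp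
  moreover have "g differentiable_on W"
    using g assms(1) by (auto simp: differentiable_on_eq_differentiable_at differentiable_def)
  ultimately show ?case by simp
qed

lemma smooth_on_open:
  assumes "smooth_on V f" "open V" "x \<in> V"
  obtains W where "open W" "x \<in> W" "W \<subseteq> V" "\<And>k. Ck_on k W f"
proof -
  obtain W h where W: "open W" "x \<in> W" "\<And>k. Ck_on k W h" "\<And>y. y \<in> V \<inter> W \<Longrightarrow> h y = f y"
    using assms unfolding smooth_on_def by meson
  have "Ck_on k (V \<inter> W) f" for k
    by (rule Ck_on_cong[where f = h]) (use W assms in \<open>auto intro: Ck_on_subset\<close>)
  then show ?thesis using that[of "V \<inter> W"] W assms by auto
qed

lemma smooth_on_differentiable:
  assumes "smooth_on V f" "x \<in> V"
  shows "f differentiable (at x within V)"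
proof -
  obtain W h where W: "open W" "x \<in> W" "\<And>k. Ck_on k W h" "\<And>y. y \<in> V \<inter> W \<Longrightarrow> h y = f y"
    using assms unfolding smooth_on_def by meson
  have "h differentiable (at x)"
    using W(3)[of 1] W(1,2) by (simp add: differentiable_on_eq_differentiable_at)
  then have "h differentiable (at x within V)" by (rule differentiable_at_withinI)
  then obtain h' where h': "(h has_derivative h') (at x within V)" unfolding differentiable_def by blast
  obtain e where e: "e > 0" "ball x e \<subseteq> W" using W(1,2) open_contains_ball by blast
  have "(f has_derivative h') (at x within V)"
    by (rule has_derivative_transform_within[OF h' e(1) assms(2)])
      (use e W(4) in \<open>auto simp: subset_iff dist_commute\<close>)
  then show ?thesis unfolding differentiable_def by blast
qed

lemma smooth_on_continuous: "smooth_on V f \<Longrightarrow> continuous_on V f"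
  using smooth_on_differentiable differentiable_imp_continuous_within
  unfolding continuous_on_eq_continuous_within by blast

section \<open>Connections determined by the Koszul formula\<close>

text \<open>The derivatives are taken within \<open>V\<close>, so that the notion covers charts at
  the boundary of the block as well as Euclidean space with vanishing Christoffel symbols.\<close>

locale connection =
  fixes V :: "'f::euclidean_space set" and G :: "'f \<Rightarrow> 'f \<Rightarrow> 'f \<Rightarrow> real"
    and dG :: "'f \<Rightarrow> 'f \<Rightarrow> 'f \<Rightarrow> 'f \<Rightarrow> real" and \<Gamma> :: "'f \<Rightarrow> 'f \<Rightarrow> 'f \<Rightarrow> 'f"
  assumes bilinear: "x \<in> V \<Longrightarrow> bilinear (G x)"
    and sym: "x \<in> V \<Longrightarrow> G x a b = G x b a"
    and deriv: "x \<in> V \<Longrightarrow> ((\<lambda>y. G y a b) has_derivative (\<lambda>u. dG x u a b)) (at x within V)"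
    and dG_bilinear: "x \<in> V \<Longrightarrow> bilinear (dG x u)"
    and koszul: "x \<in> V \<Longrightarrow> 2 * G x (\<Gamma> x a b) w = dG x a b w + dG x b a w - dG x w a b"

lemma bilinear_expand:
  fixes B :: "'f::euclidean_space \<Rightarrow> 'f \<Rightarrow> real"
  assumes "bilinear B"
  shows "B a b = (\<Sum>i\<in>Basis. \<Sum>j\<in>Basis. (a \<bullet> i) * (b \<bullet> j) * B i j)"
proof -
  have "B a b = B (\<Sum>i\<in>Basis. (a \<bullet> i) *\<^sub>R i) (\<Sum>j\<in>Basis. (b \<bullet> j) *\<^sub>R j)" by (simp add: euclidean_representation)
  also have "\<dots> = (\<Sum>i\<in>Basis. \<Sum>j\<in>Basis. B ((a \<bullet> i) *\<^sub>R i) ((b \<bullet> j) *\<^sub>R j))"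
    using bilinear_sum[OF assms, of "\<lambda>i. (a \<bullet> i) *\<^sub>R i" Basis "\<lambda>j. (b \<bullet> j) *\<^sub>R j" Basis] by (simp add: sum.cartesian_product)
  also have "\<dots> = (\<Sum>i\<in>Basis. \<Sum>j\<in>Basis. (a \<bullet> i) * (b \<bullet> j) * B i j)"
    by (simp add: bilinear_lmul[OF assms] bilinear_rmul[OF assms] mult.assoc mult.left_commute)
  finally show ?thesis .
qed

lemma (in connection) pulled_back_derivative:
  fixes H :: "'e::euclidean_space \<Rightarrow> 'f"
  assumes H: "C2_map W H H' H''" and HV: "H ` W \<subseteq> V" and y: "y \<in> W"
  shows "((\<lambda>z. G (H z) (H' z v) (H' z w)) has_derivative
    (\<lambda>u. dG (H y) (H' y u) (H' y v) (H' y w) + G (H y) (H'' y u v) (H' y w) + G (H y) (H' y v) (H'' y u w))) (at y)"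
proof -
  have W: "open W" using H by (simp add: C2_map_def)
  have Hy: "H y \<in> V" using HV y by blast
  have dH: "(H has_derivative H' y) (at y)" and dH': "\<And>v. ((\<lambda>z. H' z v) has_derivative (\<lambda>u. H'' y u v)) (at y)"
    using H y by (auto simp: C2_map_def)
  have dGH: "((\<lambda>z. G (H z) i j) has_derivative (\<lambda>u. dG (H y) (H' y u) i j)) (at y)" for i j
  proof -
    have "(H has_derivative H' y) (at y within W)" using dH by (rule has_derivative_at_withinI)
    moreover have "((\<lambda>y. G y i j) has_derivative (\<lambda>u. dG (H y) u i j)) (at (H y) within H ` W)"
      using deriv[OF Hy] HV by (rule has_derivative_subset)
    ultimately have "((\<lambda>z. G (H z) i j) has_derivative (\<lambda>u. dG (H y) (H' y u) i j)) (at y within W)"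
      by (rule has_derivative_in_compose)
    then show ?thesis by (simp only: at_within_open[OF y W])
  qed
  \<comment> \<open>Only the entries of \<open>G\<close> for fixed vectors are known to be
    differentiable, so the form is expanded in the standard basis before the product rule is
    applied.\<close>
  let ?S = "\<lambda>z. \<Sum>i\<in>Basis. \<Sum>j\<in>Basis. (H' z v \<bullet> i) * (H' z w \<bullet> j) * G (H z) i j"
  have "(?S has_derivative (\<lambda>u. \<Sum>i\<in>Basis. \<Sum>j\<in>Basis.
      (H' y v \<bullet> i) * (H' y w \<bullet> j) * dG (H y) (H' y u) i j
      + ((H' y v \<bullet> i) * (H'' y u w \<bullet> j) + (H'' y u v \<bullet> i) * (H' y w \<bullet> j)) * G (H y) i j)) (at y)"
    by (auto intro!: derivative_eq_intros dGH dH' simp: algebra_simps)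
  also have "(\<lambda>u. \<Sum>i\<in>Basis. \<Sum>j\<in>Basis.
      (H' y v \<bullet> i) * (H' y w \<bullet> j) * dG (H y) (H' y u) i j
      + ((H' y v \<bullet> i) * (H'' y u w \<bullet> j) + (H'' y u v \<bullet> i) * (H' y w \<bullet> j)) * G (H y) i j)
     = (\<lambda>u. dG (H y) (H' y u) (H' y v) (H' y w) + G (H y) (H'' y u v) (H' y w) + G (H y) (H' y v) (H'' y u w))"
    unfolding bilinear_expand[OF dG_bilinear[OF Hy], of _ "H' y v" "H' y w"]
      bilinear_expand[OF bilinear[OF Hy], of _ "H' y w"] bilinear_expand[OF bilinear[OF Hy], of "H' y v"]
    by (simp add: sum.distrib algebra_simps)
  finally show ?thesis
    by (rule has_derivative_transform_within_open[OF _ W y])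
      (rule bilinear_expand[OF bilinear, symmetric], use HV in blast)
qed

text \<open>Koszul's formula expresses the tangential part of the acceleration through first
  derivatives of the induced metric alone. Two maps inducing the same metric therefore give the same
  value, even with targets of different dimension.\<close>

lemma koszul_two_embeddings:
  fixes H1 :: "'e::euclidean_space \<Rightarrow> 'f1::euclidean_space" and H2 :: "'e \<Rightarrow> 'f2::euclidean_space"
  assumes c1: "connection V1 G1 dG1 \<Gamma>1" and H1: "C2_map W H1 H1' H1''" "H1 ` W \<subseteq> V1"
    and c2: "connection V2 G2 dG2 \<Gamma>2" and H2: "C2_map W H2 H2' H2''" "H2 ` W \<subseteq> V2"
    and eq: "\<And>z v w. z \<in> W \<Longrightarrow> G1 (H1 z) (H1' z v) (H1' z w) = G2 (H2 z) (H2' z v) (H2' z w)"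
    and y: "y \<in> W"
  shows "G1 (H1 y) (\<Gamma>1 (H1 y) (H1' y u) (H1' y v) + H1'' y u v) (H1' y w)
       = G2 (H2 y) (\<Gamma>2 (H2 y) (H2' y u) (H2' y v) + H2'' y u v) (H2' y w)"
proof -
  have W: "open W" using H1 by (simp add: C2_map_def)
  have gen: "\<exists>dg. (\<forall>v w. ((\<lambda>z. G (H z) (H' z v) (H' z w)) has_derivative (\<lambda>u. dg u v w)) (at y)) \<and>
      (\<forall>u v w. 2 * G (H y) (\<Gamma> (H y) (H' y u) (H' y v) + H'' y u v) (H' y w) = dg u v w + dg v u w - dg w u v)"
    if "connection V G dG \<Gamma>" and H: "C2_map W H H' H''" "H ` W \<subseteq> V"
    for V :: "'f::euclidean_space set" and G dG \<Gamma> and H :: "'e \<Rightarrow> 'f" and H' H''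
  proof -
    interpret connection V G dG \<Gamma> by fact
    have Hy: "H y \<in> V" using H y by blast
    note s = C2_map_symmetric[OF H(1) y]
    \<comment> \<open>The derivative of the induced metric. In the Koszul combination the terms with
      second derivatives cancel by symmetry, except for those on the left-hand side.\<close>
    let ?dg = "\<lambda>u v w. dG (H y) (H' y u) (H' y v) (H' y w) + G (H y) (H'' y u v) (H' y w) + G (H y) (H' y v) (H'' y u w)"
    have "2 * G (H y) (\<Gamma> (H y) (H' y u) (H' y v) + H'' y u v) (H' y w) = ?dg u v w + ?dg v u w - ?dg w u v" for u v w
      using koszul[OF Hy, of "H' y u" "H' y v" "H' y w"] s[of v u] s[of w u] s[of w v]
        sym[OF Hy, of "H' y v" "H'' y u w"]
      by (simp add: bilinear_ladd[OF bilinear[OF Hy]])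
    then show ?thesis using pulled_back_derivative[OF H y] by (intro exI[of _ ?dg]) blast
  qed
  obtain d1 where d1: "\<And>v w. ((\<lambda>z. G1 (H1 z) (H1' z v) (H1' z w)) has_derivative (\<lambda>u. d1 u v w)) (at y)"
    "\<And>u v w. 2 * G1 (H1 y) (\<Gamma>1 (H1 y) (H1' y u) (H1' y v) + H1'' y u v) (H1' y w) = d1 u v w + d1 v u w - d1 w u v"
    using gen[OF c1 H1] by blast
  obtain d2 where d2: "\<And>v w. ((\<lambda>z. G2 (H2 z) (H2' z v) (H2' z w)) has_derivative (\<lambda>u. d2 u v w)) (at y)"
    "\<And>u v w. 2 * G2 (H2 y) (\<Gamma>2 (H2 y) (H2' y u) (H2' y v) + H2'' y u v) (H2' y w) = d2 u v w + d2 v u w - d2 w u v"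
    using gen[OF c2 H2] by blast
  have "((\<lambda>z. G2 (H2 z) (H2' z v) (H2' z w)) has_derivative (\<lambda>u. d1 u v w)) (at y)" for v w
    by (rule has_derivative_transform_within_open[OF d1(1) W y]) (rule eq)
  then have "(\<lambda>u. d1 u v w) = (\<lambda>u. d2 u v w)" for v w
    using d2(1) has_derivative_unique by blast
  then have "d1 u v w = d2 u v w" for u v w by meson
  then show ?thesis using d1(2)[of u v w] d2(2)[of u v w] by simp
qed

section \<open>Standard tori\<close>

text \<open>A map from a convex set to the circle has a continuous logarithm, whose real part
  vanishes because the values have norm 1.\<close>

lemma lifting_circle: "lifting TYPE('z::real_normed_vector) (top_of_set (sphere 0 1)) cis"
  unfolding lifting_def
proof (intro allI impI; elim conjE)
  fix S :: "'z set" and f :: "'z \<Rightarrow> complex"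
  assume S: "convex S" and f: "continuous_map (top_of_set S) (top_of_set (sphere 0 1)) f"
  have c: "continuous_on S f" and n: "\<And>x. x \<in> S \<Longrightarrow> norm (f x) = 1"
    using f by (auto simp: continuous_map_in_subtopology image_subset_iff)
  have nz: "f x \<noteq> 0" if "x \<in> S" for x using n[OF that] by auto
  obtain g where g: "continuous_on S g" "\<And>x. x \<in> S \<Longrightarrow> f x = exp (g x)"
    using continuous_logarithm_on_contractible[OF c convex_imp_contractible[OF S] nz] by metis
  have "cis (Im (g t)) = f t" if "t \<in> S" for t
  proof -
    have "exp (Re (g t)) = 1" using n[OF that] g(2)[OF that] by (simp add: norm_exp_eq_Re)
    then have "Re (g t) = 0" by simp
    then show ?thesis using g(2)[OF that] by (simp add: exp_eq_polar)
  qed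
  moreover have "continuous_on S (\<lambda>t. Im (g t))" by (intro continuous_intros g)
  ultimately show "\<exists>g. continuous_on S g \<and> (\<forall>t\<in>S. cis (g t) = f t)" by blast
qed

lemma lifting_prod:
  assumes "lifting TYPE('z::real_normed_vector) X p" "lifting TYPE('z) Y q"
  shows "lifting TYPE('z) (prod_topology X Y) (map_prod p q)"
  unfolding lifting_def
proof (intro allI impI; elim conjE)
  fix S :: "'z set" and f
  assume S: "convex S" and f: "continuous_map (top_of_set S) (prod_topology X Y) f"
  obtain g where g: "continuous_on S g" "\<And>t. t \<in> S \<Longrightarrow> p (g t) = fst (f t)"
    using assms(1) S f unfolding lifting_def continuous_map_pairwise by (metis comp_apply)
  obtain h where h: "continuous_on S h" "\<And>t. t \<in> S \<Longrightarrow> q (h t) = snd (f t)"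
    using assms(2) S f unfolding lifting_def continuous_map_pairwise by (metis comp_apply)
  show "\<exists>g. continuous_on S g \<and> (\<forall>t\<in>S. map_prod p q (g t) = f t)"
    by (rule exI[of _ "\<lambda>t. (g t, h t)"]) (use g h in \<open>auto intro!: continuous_intros\<close>)
qed

lemma period_lattice_real: "x \<in> period_lattice \<longleftrightarrow> (\<exists>k::int. x = 2 * pi * of_int k)" for x :: real
  by (simp add: period_lattice_def)

lemma period_lattice_prod: "(x, y) \<in> period_lattice \<longleftrightarrow> x \<in> period_lattice \<and> y \<in> period_lattice"
  by (auto simp: period_lattice_def Basis_prod_def ball_Un)

lemma cis_eq_iff: "cis x = cis y \<longleftrightarrow> x - y \<in> period_lattice"
proof -
  have "cis x = cis y \<longleftrightarrow> sin x = sin y \<and> cos x = cos y" by (auto simp: complex_eq_iff)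
  also have "\<dots> \<longleftrightarrow> (\<exists>n::int. x = y + 2 * of_int n * pi)" using sin_cos_eq_iff[of x y] by (simp add: ac_simps)
  also have "\<dots> \<longleftrightarrow> x - y \<in> period_lattice" unfolding period_lattice_real by (auto simp: algebra_simps)
  finally show ?thesis .
qed

text \<open>The charts are local inverses of one covering map. Hence metric coefficients in charts
  can be compared directly with functions on the cover, and changes of charts are locally lattice
  translations.\<close>

locale torus_mfd =
  fixes T :: "('x, 'e::euclidean_space) mfd" and p :: "'e \<Rightarrow> 'x"
  assumes continuous_param: "continuous_map euclidean (mtop T) p"
    and param_eq_iff: "p x = p y \<longleftrightarrow> x - y \<in> period_lattice"
    and range_param: "range p = topspace (mtop T)"
    and chart_dom: "c \<in> matlas T \<Longrightarrow> openin (mtop T) (cdom c)"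
    and chart_img: "c \<in> matlas T \<Longrightarrow> open (cimg c)"
    and chart_dom_eq: "c \<in> matlas T \<Longrightarrow> cdom c = p ` cimg c"
    and chart_map: "c \<in> matlas T \<Longrightarrow> y \<in> cimg c \<Longrightarrow> cmap c (p y) = y"
    and chart_at: "\<exists>c\<in>matlas T. x \<in> cimg c"
begin

lemma chart_inverse: "c \<in> matlas T \<Longrightarrow> y \<in> cimg c \<Longrightarrow> cinv c y = p y"
proof -
  assume c: "c \<in> matlas T" "y \<in> cimg c"
  have "inj_on (cmap c) (cdom c)"
    using chart_dom_eq[OF c(1)] chart_map[OF c(1)] by (auto simp: inj_on_def)
  then show ?thesis unfolding cinv_def
    using chart_dom_eq[OF c(1)] chart_map[OF c] c by (metis imageI the_inv_into_f_f)
qed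

lemma chart_map_param:
  assumes "c \<in> matlas T" "p y \<in> cdom c"
  shows "cmap c (p y) \<in> cimg c" "p (cmap c (p y)) = p y" "cmap c (p y) - y \<in> period_lattice"
proof -
  obtain y' where y': "y' \<in> cimg c" "p y = p y'" using assms chart_dom_eq by auto
  then show 1: "cmap c (p y) \<in> cimg c" "p (cmap c (p y)) = p y"
    using chart_map[OF assms(1)] by auto
  show "cmap c (p y) - y \<in> period_lattice" using 1(2) param_eq_iff by metis
qed

end

lemma prod_chart_img: "cimg (prod_chart c d) = cimg c \<times> cimg d"
  by (auto simp: cimg_def prod_chart_def image_iff)

lemma prod_chart_simps [simp]:
  "cdom (prod_chart c d) = cdom c \<times> cdom d"
  "cmap (prod_chart c d) = map_prod (cmap c) (cmap d)"
  "chalf (prod_chart c d) = (chalf c, 0)"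
  by (simp_all add: prod_chart_def)

lemma torus_mfd_prod:
  assumes "torus_mfd T p" "torus_mfd T' q"
  shows "torus_mfd (prod_mfd T T') (map_prod p q)"
proof -
  interpret T: torus_mfd T p by fact
  interpret T': torus_mfd T' q by fact
  show ?thesis
  proof
    show "continuous_map euclidean (mtop (prod_mfd T T')) (map_prod p q)"
      using T.continuous_param T'.continuous_param
      by (simp add: prod_mfd_def continuous_map_prod_top map_prod_def flip: prod_topology_euclidean)
    show "map_prod p q x = map_prod p q y \<longleftrightarrow> x - y \<in> period_lattice" for x y
      by (cases x; cases y) (simp add: T.param_eq_iff T'.param_eq_iff period_lattice_prod)
    show "range (map_prod p q) = topspace (mtop (prod_mfd T T'))"
      by (simp add: prod_mfd_def T.range_param[symmetric] T'.range_param[symmetric] map_prod_surj_on flip: UNIV_Times_UNIV)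
    fix c assume "c \<in> matlas (prod_mfd T T')"
    then obtain a b where c: "c = prod_chart a b" "a \<in> matlas T" "b \<in> matlas T'"
      by (auto simp: prod_mfd_def)
    show "openin (mtop (prod_mfd T T')) (cdom c)"
      using T.chart_dom[OF c(2)] T'.chart_dom[OF c(3)] by (simp add: c(1) prod_mfd_def openin_prod_Times_iff)
    show "open (cimg c)" using T.chart_img[OF c(2)] T'.chart_img[OF c(3)] by (simp add: c(1) prod_chart_img open_Times)
    show "cdom c = map_prod p q ` cimg c"
      using T.chart_dom_eq[OF c(2)] T'.chart_dom_eq[OF c(3)] by (simp add: c(1) prod_chart_img map_prod_surj_on)
    show "cmap c (map_prod p q y) = y" if "y \<in> cimg c" for y
      using that T.chart_map[OF c(2)] T'.chart_map[OF c(3)] by (auto simp: c(1) prod_chart_img)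
  next
    fix x :: "'b \<times> 'd"
    obtain a b where "a \<in> matlas T" "fst x \<in> cimg a" "b \<in> matlas T'" "snd x \<in> cimg b"
      using T.chart_at T'.chart_at by metis
    then show "\<exists>c\<in>matlas (prod_mfd T T'). x \<in> cimg c"
      by (intro bexI[of _ "prod_chart a b"]) (auto simp: prod_chart_img prod_mfd_def mem_Times_iff)
  qed
qed

lemma inj_on_cis: "inj_on cis {a<..<a + 2 * pi}"
proof (rule inj_onI)
  fix x y assume xy: "x \<in> {a<..<a + 2 * pi}" "y \<in> {a<..<a + 2 * pi}" "cis x = cis y"
  then obtain k :: int where k: "x - y = 2 * pi * of_int k" by (auto simp: cis_eq_iff period_lattice_real)
  have "\<bar>2 * pi * of_int k\<bar> < 2 * pi * 1" using xy(1,2) k[symmetric] by auto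
  then have "\<bar>real_of_int k\<bar> < 1" by (simp add: abs_mult)
  then have "k = 0" by linarith
  then show "x = y" using k by simp
qed

lemma circle_chart_img: "cimg (circle_chart a) = {a<..<a + 2 * pi}"
  using the_inv_into_onto[OF inj_on_cis[of a]] by (simp add: cimg_def circle_chart_def)

lemma cis_surj_circle: "norm z = 1 \<Longrightarrow> \<exists>x. z = cis x"
  using cis_Arg[of z] by (intro exI[of _ "Arg z"]) (cases "z = 0"; simp add: sgn_div_norm)

lemma torus_mfd_circle: "torus_mfd circle cis"
proof
  show "continuous_map euclidean (mtop circle) cis"
    by (auto simp: circle_def continuous_map_in_subtopology intro!: continuous_intros)
  show "cis x = cis y \<longleftrightarrow> x - y \<in> period_lattice" for x y by (rule cis_eq_iff)
  show "range cis = topspace (mtop circle)"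
  proof -
    have "z \<in> range cis" if "norm z = 1" for z using cis_surj_circle[OF that] by auto
    then show ?thesis by (auto simp: circle_def)
  qed
  fix c assume "c \<in> matlas circle"
  then obtain a where c: "c = circle_chart a" by (auto simp: circle_def)
  \<comment> \<open>The domain of an angular chart is the circle without one point, which is visibly
    open.\<close>
  have dom: "cis ` {a<..<a + 2 * pi} = sphere 0 1 - {cis a}"
  proof (intro equalityI subsetI)
    fix z assume "z \<in> cis ` {a<..<a + 2 * pi}"
    then obtain x where x: "z = cis x" "a < x" "x < a + 2 * pi" by auto
    have "z \<noteq> cis a"
    proof
      assume "z = cis a"
      then obtain k :: int where k: "x - a = 2 * pi * of_int k" using x by (auto simp: cis_eq_iff period_lattice_real)
      then have b: "0 < 2 * pi * real_of_int k" "2 * pi * real_of_int k < 2 * pi * 1" using x by linarith+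
      have "0 < real_of_int k" using b(1) by (simp add: zero_less_mult_iff)
      moreover have "real_of_int k < 1" using b(2) by (metis mult_less_cancel_left_pos pi_gt_zero mult_pos_pos zero_less_numeral)
      ultimately have "0 < k" "k < 1" by linarith+
      then show False by linarith
    qed
    then show "z \<in> sphere 0 1 - {cis a}" using x by simp
  next
    fix z assume z: "z \<in> sphere 0 1 - {cis a}"
    have "norm z = 1" using z by simp
    then obtain x where x: "z = cis x" using cis_surj_circle by blast
    \<comment> \<open>The angle is first brought into the closed interval of length 2 pi; its ends
      correspond to \<open>cis a\<close>, which is excluded.\<close>
    obtain w l where w: "l \<in> period_lattice" "w \<in> cbox 0 ((2 * pi) *\<^sub>R One)" "x - a = w + l"
      by (rule lattice_fundamental)
    have w2: "0 \<le> w" "w \<le> 2 * pi" using w(2) by auto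
    have eq: "cis (a + w) = z"
      unfolding x cis_eq_iff using w(1,3) lattice_minus[OF w(1)] by (simp add: algebra_simps)
    have "w \<noteq> 0" using eq z by auto
    moreover have "w \<noteq> 2 * pi"
    proof
      assume "w = 2 * pi"
      then have "z = cis a" using eq by (simp add: cis_mult[symmetric])
      then show False using z by simp
    qed
    ultimately show "z \<in> cis ` {a<..<a + 2 * pi}" using w2 eq by (intro image_eqI[of _ _ "a + w"]) auto
  qed
  have "openin (top_of_set (sphere 0 1)) (sphere 0 1 - {cis a})"
    by (intro openin_diff) (auto intro!: closed_subset)
  then show "openin (mtop circle) (cdom c)" unfolding c by (simp add: circle_def circle_chart_def dom)
  show "open (cimg c)" by (simp add: c circle_chart_img)
  show "cdom c = cis ` cimg c" unfolding c circle_chart_img by (simp add: circle_chart_def)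
  show "cmap c (cis y) = y" if "y \<in> cimg c" for y
    using that the_inv_into_f_f[OF inj_on_cis[of a]] unfolding c circle_chart_img by (simp add: circle_chart_def)
next
  fix x :: real
  have "x \<in> cimg (circle_chart (x - pi))" by (simp add: circle_chart_img)
  then show "\<exists>c\<in>matlas circle. x \<in> cimg c" by (auto simp: circle_def)
qed

definition param2 :: "real \<times> real \<Rightarrow> complex \<times> complex" where
  "param2 = map_prod cis cis"

definition param3 :: "real \<times> real \<times> real \<Rightarrow> complex \<times> complex \<times> complex" where
  "param3 = map_prod cis param2"

interpretation circle: torus_mfd circle cis by (rule torus_mfd_circle)

interpretation torus2: torus_mfd torus2 param2
  unfolding torus2_def param2_def by (intro torus_mfd_prod torus_mfd_circle)

interpretation torus3: torus_mfd torus3 param3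
  unfolding torus3_def param3_def by (intro torus_mfd_prod torus_mfd_circle torus2.torus_mfd_axioms)

lemma lifting_torus2: "lifting TYPE('z::real_normed_vector) (mtop torus2) param2"
  using lifting_prod[OF lifting_circle lifting_circle]
  by (simp add: torus2_def prod_mfd_def circle_def param2_def)

lemma lifting_torus3: "lifting TYPE('z::real_normed_vector) (mtop torus3) param3"
  using lifting_prod[OF lifting_circle lifting_torus2]
  by (simp add: torus3_def prod_mfd_def circle_def param3_def)

lemma lattice_cover_torus2: "lattice_cover (mtop torus2) param2"
  by unfold_locales (use torus2.continuous_param torus2.param_eq_iff torus2.range_param lifting_torus2 in auto)

lemma lattice_cover_torus3: "lattice_cover (mtop torus3) param3"
  by unfold_locales (use torus3.continuous_param torus3.param_eq_iff torus3.range_param lifting_torus3 in auto)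

lemma lifting_homeomorphic:
  assumes p: "lifting TYPE('z::real_normed_vector) X p" and h: "homeomorphic_map X Y h"
  shows "lifting TYPE('z) Y (h \<circ> p)"
  unfolding lifting_def
proof (intro allI impI; elim conjE)
  fix S :: "'z set" and f
  assume S: "convex S" and f: "continuous_map (top_of_set S) Y f"
  obtain k where k: "homeomorphic_maps X Y h k" using h homeomorphic_map_maps by blast
  then have "continuous_map (top_of_set S) X (k \<circ> f)"
    using continuous_map_compose[OF f] unfolding homeomorphic_maps_def by blast
  then obtain g where g: "continuous_on S g" "\<And>t. t \<in> S \<Longrightarrow> p (g t) = k (f t)"
    using p S unfolding lifting_def by (metis comp_apply)
  have "h (k (f t)) = f t" if "t \<in> S" for t
    using k f that unfolding homeomorphic_maps_def continuous_map_def by auto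
  then show "\<exists>g. continuous_on S g \<and> (\<forall>t\<in>S. (h \<circ> p) (g t) = f t)" using g by auto
qed

lemma lattice_cover_homeomorphic:
  assumes "lattice_cover X p" and h: "homeomorphic_map X Y h"
  shows "lattice_cover Y (h \<circ> p)"
proof -
  interpret lattice_cover X p by fact
  have inj: "inj_on h (topspace X)" and surj: "h ` topspace X = topspace Y"
    using h by (auto simp: homeomorphic_map_def homeomorphic_imp_surjective_map)
  show ?thesis
  proof
    show "continuous_map euclidean Y (h \<circ> p)"
      using continuous_map_compose[OF continuous_cover homeomorphic_imp_continuous_map[OF h]] .
    show "(h \<circ> p) x = (h \<circ> p) y \<longleftrightarrow> x - y \<in> period_lattice" for x y
      using inj range_cover cover_eq_iff by (metis comp_apply inj_on_eq_iff rangeI)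
    show "range (h \<circ> p) = topspace Y" using surj range_cover by (metis image_comp)
    show "lifting TYPE(real) Y (h \<circ> p)" by (rule lifting_homeomorphic[OF lift_path h])
    show "lifting TYPE(real \<times> real) Y (h \<circ> p)" by (rule lifting_homeomorphic[OF lift_square h])
    show "lifting TYPE('b) Y (h \<circ> p)" by (rule lifting_homeomorphic[OF lift_self h])
  qed
qed

section \<open>Metrics in coordinates on the universal cover\<close>

lemma frechet_derivative_within_open_cong:
  assumes "open A" "y \<in> A" "\<And>x. x \<in> A \<Longrightarrow> f x = g x"
  shows "frechet_derivative f (at y within A) = frechet_derivative g (at y)"
proof -
  have "(f has_derivative f') (at y within A) \<longleftrightarrow> (g has_derivative f') (at y)" for f'
    using has_derivative_transform_within_open[of f f' y UNIV A g]
      has_derivative_transform_within_open[of g f' y UNIV A f] assms at_within_open[OF assms(2,1)]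
    by auto
  then show ?thesis unfolding frechet_derivative_def by simp
qed

text \<open>What \<open>M\<close>, \<open>S\<close> and the block share. Transitions need to be
  differentiable only once and only within their domains, which is enough to transform a metric and
  is easily inherited by products with a torus.\<close>

locale charted =
  fixes N :: "('b, 'f::euclidean_space) mfd"
  assumes dom_open: "d \<in> matlas N \<Longrightarrow> openin (mtop N) (cdom d)"
    and dom_cover: "(\<Union>d\<in>matlas N. cdom d) = topspace (mtop N)"
    and chart_inj: "d \<in> matlas N \<Longrightarrow> inj_on (cmap d) (cdom d)"
    and img_open: "d \<in> matlas N \<Longrightarrow> openin (top_of_set {x. 0 \<le> chalf d \<bullet> x}) (cimg d)"
    and transition: "c \<in> matlas N \<Longrightarrow> d \<in> matlas N \<Longrightarrow> x \<in> loc_dom c d (topspace (mtop N)) id \<Longrightarrow>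
      loc_rep c d id differentiable (at x within loc_dom c d (topspace (mtop N)) id)"
begin

lemma some_chart:
  assumes "q \<in> topspace (mtop N)" "d = (SOME d. d \<in> matlas N \<and> q \<in> cdom d)"
  shows "d \<in> matlas N" "q \<in> cdom d"
proof -
  have "\<exists>d. d \<in> matlas N \<and> q \<in> cdom d" using assms(1) dom_cover by blast
  from someI_ex[OF this] show "d \<in> matlas N" "q \<in> cdom d" unfolding assms(2) by auto
qed

lemma inverse_chart: "d \<in> matlas N \<Longrightarrow> q \<in> cdom d \<Longrightarrow> cinv d (cmap d q) = q"
  unfolding cinv_def using chart_inj by (simp add: the_inv_into_f_f)

lemma img_chart: "q \<in> cdom d \<Longrightarrow> cmap d q \<in> cimg d"
  by (auto simp: cimg_def)

end

lemma smooth_manifold_charted: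
  assumes "smooth_manifold N" shows "charted N"
proof
  fix d assume d: "d \<in> matlas N"
  then have ch: "is_chart (mtop N) d" using assms by (simp add: smooth_manifold_def)
  then show op: "openin (mtop N) (cdom d)" "openin (top_of_set {x. 0 \<le> chalf d \<bullet> x}) (cimg d)"
    by (simp_all add: is_chart_def)
  have h: "homeomorphic_map (subtopology (mtop N) (cdom d)) (top_of_set (cimg d)) (cmap d)"
    using ch by (simp add: is_chart_def)
  have "topspace (subtopology (mtop N) (cdom d)) = cdom d"
    using openin_subset[OF op(1)] by auto
  then show "inj_on (cmap d) (cdom d)" using homeomorphic_imp_injective_map[OF h] by simp
next
  show "(\<Union>d\<in>matlas N. cdom d) = topspace (mtop N)" using assms by (simp add: smooth_manifold_def)
  fix c d x assume "c \<in> matlas N" "d \<in> matlas N" and x: "x \<in> loc_dom c d (topspace (mtop N)) id"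
  then have "smooth_on (loc_dom c d (topspace (mtop N)) id) (loc_rep c d id)"
    using assms by (simp add: smooth_manifold_def)
  then show "loc_rep c d id differentiable (at x within loc_dom c d (topspace (mtop N)) id)"
    by (rule smooth_on_differentiable[OF _ x])
qed

section \<open>Metrics pulled back to Euclidean space\<close>

text \<open>The pullback of \<open>g\<close> along a map from Euclidean space, written in standard
  coordinates so that charts of the source no longer occur. For a Riemannian metric the chart chosen
  in the target is immaterial.\<close>

definition cover_metric :: "('b, 'f::euclidean_space) mfd \<Rightarrow> ('e::euclidean_space \<Rightarrow> 'b) \<Rightarrow> ('b, 'f) metric \<Rightarrow>
    'e \<Rightarrow> 'e \<Rightarrow> 'e \<Rightarrow> real" where
  "cover_metric N \<theta> g y v w =
    (let d = (SOME d. d \<in> matlas N \<and> \<theta> y \<in> cdom d); D = frechet_derivative (cmap d \<circ> \<theta>) (at y)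
     in g d (cmap d (\<theta> y)) (D v) (D w))"

definition chart_differentiable :: "('b, 'f::euclidean_space) mfd \<Rightarrow> ('e::euclidean_space \<Rightarrow> 'b) \<Rightarrow> bool" where
  "chart_differentiable N \<theta> \<longleftrightarrow> continuous_map euclidean (mtop N) \<theta> \<and>
    (\<forall>y. \<forall>d\<in>matlas N. \<theta> y \<in> cdom d \<longrightarrow> (cmap d \<circ> \<theta>) differentiable (at y))"

lemma chart_differentiable_derivative:
  assumes "chart_differentiable N \<theta>" "d \<in> matlas N" "\<theta> y \<in> cdom d"
  shows "((cmap d \<circ> \<theta>) has_derivative frechet_derivative (cmap d \<circ> \<theta>) (at y)) (at y)"
  using assms unfolding chart_differentiable_def by (simp add: frechet_derivative_works)

lemma open_preimage_continuous_map:
  assumes "continuous_map euclidean X \<theta>" "openin X U" shows "open {z. \<theta> z \<in> U}"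
  using openin_continuous_map_preimage[OF assms] by simp

text \<open>The transformation law of the metric, combined with the chain rule. The chain rule holds
  for whichever derivative within its domain \<open>loc_deriv\<close> selects, so uniqueness of that
  derivative at boundary points is not at issue.\<close>

lemma (in charted) cover_metric_chart:
  assumes g: "riemannian_metric N g" and \<theta>: "chart_differentiable N \<theta>" and d: "d \<in> matlas N" "\<theta> y \<in> cdom d"
    and D: "((cmap d \<circ> \<theta>) has_derivative D) (at y)"
  shows "cover_metric N \<theta> g y v w = g d (cmap d (\<theta> y)) (D v) (D w)"
proof -
  define c where "c = (SOME d. d \<in> matlas N \<and> \<theta> y \<in> cdom d)"
  have cont: "continuous_map euclidean (mtop N) \<theta>" using \<theta> by (simp add: chart_differentiable_def)
  have top: "\<theta> z \<in> topspace (mtop N)" for z using cont by (auto simp: continuous_map_def)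
  have c: "c \<in> matlas N" "\<theta> y \<in> cdom c" using some_chart[OF top c_def] .
  define Dc where "Dc = frechet_derivative (cmap c \<circ> \<theta>) (at y)"
  have Dc: "((cmap c \<circ> \<theta>) has_derivative Dc) (at y)"
    unfolding Dc_def by (rule chart_differentiable_derivative[OF \<theta> c])
  let ?L = "loc_dom c d (topspace (mtop N)) id"
  let ?x = "cmap c (\<theta> y)"
  define O' where "O' = {z. \<theta> z \<in> cdom c} \<inter> {z. \<theta> z \<in> cdom d}"
  have O': "open O'" "y \<in> O'" unfolding O'_def
    using open_preimage_continuous_map[OF cont dom_open] c d by auto
  have inL: "cmap c (\<theta> z) \<in> ?L" if "z \<in> O'" for z
    using that top by (auto simp: loc_dom_def O'_def)
  have rep: "loc_rep c d id (cmap c (\<theta> z)) = cmap d (\<theta> z)" if "z \<in> O'" for z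
    using that inverse_chart[OF c(1)] by (simp add: loc_rep_def O'_def)
  define \<tau>' where "\<tau>' = loc_deriv c d (topspace (mtop N)) id ?x"
  have \<tau>': "(loc_rep c d id has_derivative \<tau>') (at ?x within ?L)"
    using transition[OF c(1) d(1) inL[OF O'(2)]] unfolding \<tau>'_def loc_deriv_def by (simp add: frechet_derivative_works)
  have "((\<lambda>z. loc_rep c d id ((cmap c \<circ> \<theta>) z)) has_derivative (\<lambda>v. \<tau>' (Dc v))) (at y within O')"
  proof (rule has_derivative_in_compose[OF has_derivative_at_withinI[OF Dc]])
    show "(loc_rep c d id has_derivative \<tau>') (at ((cmap c \<circ> \<theta>) y) within (cmap c \<circ> \<theta>) ` O')"
      using has_derivative_subset[OF \<tau>', of "(cmap c \<circ> \<theta>) ` O'"] inL by (auto simp: image_subset_iff)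
  qed
  then have "((\<lambda>z. loc_rep c d id ((cmap c \<circ> \<theta>) z)) has_derivative (\<lambda>v. \<tau>' (Dc v))) (at y)"
    by (simp only: at_within_open[OF O'(2,1)])
  then have "((cmap d \<circ> \<theta>) has_derivative (\<lambda>v. \<tau>' (Dc v))) (at y)"
    by (rule has_derivative_transform_within_open[OF _ O']) (simp add: rep)
  then have Deq: "D = (\<lambda>v. \<tau>' (Dc v))" using D has_derivative_unique by blast
  have "cover_metric N \<theta> g y v w = g c ?x (Dc v) (Dc w)"
    unfolding cover_metric_def Let_def c_def[symmetric] Dc_def ..
  also have "\<dots> = g d (loc_rep c d id ?x) (\<tau>' (Dc v)) (\<tau>' (Dc w))"
    using g c(1) d(1) inL[OF O'(2)] unfolding riemannian_metric_def \<tau>'_def by blast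
  finally show ?thesis using rep[OF O'(2)] Deq by simp
qed

lemma (in charted) cover_metric_compose:
  assumes \<theta>: "chart_differentiable N \<theta>" and f: "(f has_derivative f') (at y)"
  shows "cover_metric N (\<theta> \<circ> f) g y v w = cover_metric N \<theta> g (f y) (f' v) (f' w)"
proof -
  define d where "d = (SOME d. d \<in> matlas N \<and> \<theta> (f y) \<in> cdom d)"
  have "continuous_map euclidean (mtop N) \<theta>" using \<theta> by (simp add: chart_differentiable_def)
  then have "\<theta> (f y) \<in> topspace (mtop N)" by (auto simp: continuous_map_def)
  then have d: "d \<in> matlas N" "\<theta> (f y) \<in> cdom d" using some_chart[OF _ d_def] by auto
  have "((cmap d \<circ> \<theta> \<circ> f) has_derivative (frechet_derivative (cmap d \<circ> \<theta>) (at (f y)) \<circ> f')) (at y)"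
    by (rule diff_chain_at[OF f chart_differentiable_derivative[OF \<theta> d]])
  then have "frechet_derivative (cmap d \<circ> (\<theta> \<circ> f)) (at y) = frechet_derivative (cmap d \<circ> \<theta>) (at (f y)) \<circ> f'"
    using frechet_derivative_at by (metis o_assoc)
  then show ?thesis unfolding cover_metric_def Let_def comp_apply[of \<theta> f] d_def[symmetric] by simp
qed

text \<open>The set \<open>A\<close> may be a boundary torus, where \<open>loc_rep\<close> is
  differentiable only within its domain; composition with \<open>\<theta>\<close> yields an honest
  derivative at a point of Euclidean space.\<close>

lemma smooth_map_on_has_derivative:
  assumes "charted B" and M: "openin (mtop M) (cdom e)"
    and \<theta>: "chart_differentiable B \<theta>" "range \<theta> \<subseteq> A" and f: "smooth_map_on B A M f"
    and d: "d \<in> matlas B" "\<theta> y \<in> cdom d" and e: "e \<in> matlas M" "f (\<theta> y) \<in> cdom e"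
  shows "((cmap e \<circ> (f \<circ> \<theta>)) has_derivative
      (\<lambda>v. loc_deriv d e A f (cmap d (\<theta> y)) (frechet_derivative (cmap d \<circ> \<theta>) (at y) v))) (at y)"
proof -
  interpret B: charted B by fact
  have cont: "continuous_map euclidean (mtop B) \<theta>" using \<theta> by (simp add: chart_differentiable_def)
  then have "continuous_map euclidean (subtopology (mtop B) A) \<theta>"
    using \<theta>(2) by (auto simp: continuous_map_in_subtopology)
  then have cont2: "continuous_map euclidean (mtop M) (f \<circ> \<theta>)"
    using f continuous_map_compose unfolding smooth_map_on_def by blast
  let ?L = "loc_dom d e A f"
  let ?x = "cmap d (\<theta> y)"
  define O' where "O' = {z. \<theta> z \<in> cdom d} \<inter> {z. (f \<circ> \<theta>) z \<in> cdom e}"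
  have O': "open O'" "y \<in> O'" unfolding O'_def
    using open_preimage_continuous_map[OF cont B.dom_open] open_preimage_continuous_map[OF cont2 M] d e
    by auto
  have inL: "cmap d (\<theta> z) \<in> ?L" if "z \<in> O'" for z
    using that \<theta>(2) by (auto simp: loc_dom_def O'_def)
  have rep: "loc_rep d e f (cmap d (\<theta> z)) = cmap e (f (\<theta> z))" if "z \<in> O'" for z
    using that B.inverse_chart[OF d(1)] by (simp add: loc_rep_def O'_def)
  have "smooth_on ?L (loc_rep d e f)" using f d e by (simp add: smooth_map_on_def)
  then have "loc_rep d e f differentiable (at ?x within ?L)"
    by (rule smooth_on_differentiable) (rule inL[OF O'(2)])
  then have \<tau>': "(loc_rep d e f has_derivative loc_deriv d e A f ?x) (at ?x within ?L)"
    unfolding loc_deriv_def by (simp add: frechet_derivative_works)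
  have "((\<lambda>z. loc_rep d e f ((cmap d \<circ> \<theta>) z)) has_derivative
      (\<lambda>v. loc_deriv d e A f ?x (frechet_derivative (cmap d \<circ> \<theta>) (at y) v))) (at y within O')"
  proof (rule has_derivative_in_compose[OF has_derivative_at_withinI[OF chart_differentiable_derivative[OF \<theta>(1) d]]])
    show "(loc_rep d e f has_derivative loc_deriv d e A f ?x) (at ((cmap d \<circ> \<theta>) y) within (cmap d \<circ> \<theta>) ` O')"
      using has_derivative_subset[OF \<tau>', of "(cmap d \<circ> \<theta>) ` O'"] inL by (auto simp: image_subset_iff)
  qed
  then have "((\<lambda>z. loc_rep d e f ((cmap d \<circ> \<theta>) z)) has_derivative
      (\<lambda>v. loc_deriv d e A f ?x (frechet_derivative (cmap d \<circ> \<theta>) (at y) v))) (at y)"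
    by (simp only: at_within_open[OF O'(2,1)])
  then show ?thesis by (rule has_derivative_transform_within_open[OF _ O']) (simp add: rep)
qed

lemma smooth_map_on_chart_differentiable:
  assumes "charted B" and M: "\<And>e. e \<in> matlas M \<Longrightarrow> openin (mtop M) (cdom e)"
    and \<theta>: "chart_differentiable B \<theta>" "range \<theta> \<subseteq> A" and f: "smooth_map_on B A M f"
  shows "chart_differentiable M (f \<circ> \<theta>)"
  unfolding chart_differentiable_def
proof (intro conjI allI ballI impI)
  interpret B: charted B by fact
  have cont: "continuous_map euclidean (mtop B) \<theta>" using \<theta> by (simp add: chart_differentiable_def)
  then have "continuous_map euclidean (subtopology (mtop B) A) \<theta>"
    using \<theta>(2) by (auto simp: continuous_map_in_subtopology)
  then show "continuous_map euclidean (mtop M) (f \<circ> \<theta>)"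
    using f continuous_map_compose unfolding smooth_map_on_def by blast
  fix y e assume e: "e \<in> matlas M" "(f \<circ> \<theta>) y \<in> cdom e"
  have "\<theta> y \<in> topspace (mtop B)" using cont by (auto simp: continuous_map_def)
  then obtain d where "d \<in> matlas B" "\<theta> y \<in> cdom d" using B.dom_cover by blast
  then show "(cmap e \<circ> (f \<circ> \<theta>)) differentiable (at y)"
    using smooth_map_on_has_derivative[OF assms(1) M[OF e(1)] \<theta> f] e by (metis comp_apply differentiable_def)
qed

lemma chart_differentiable_fst:
  assumes \<theta>: "chart_differentiable (prod_mfd N N') \<theta>"
    and N': "\<And>q. q \<in> topspace (mtop N') \<Longrightarrow> \<exists>c\<in>matlas N'. q \<in> cdom c"
  shows "chart_differentiable N (fst \<circ> \<theta>)"
  unfolding chart_differentiable_def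
proof (intro conjI allI ballI impI)
  have cont: "continuous_map euclidean (prod_topology (mtop N) (mtop N')) \<theta>"
    using \<theta> by (simp add: chart_differentiable_def prod_mfd_def)
  then show "continuous_map euclidean (mtop N) (fst \<circ> \<theta>)" by (simp add: continuous_map_pairwise)
  fix y c assume c: "c \<in> matlas N" "(fst \<circ> \<theta>) y \<in> cdom c"
  have "\<theta> y \<in> topspace (prod_topology (mtop N) (mtop N'))" using cont by (auto simp: continuous_map_def)
  then obtain c' where c': "c' \<in> matlas N'" "snd (\<theta> y) \<in> cdom c'" using N' by (cases "\<theta> y") auto
  have "prod_chart c c' \<in> matlas (prod_mfd N N')" "\<theta> y \<in> cdom (prod_chart c c')"
    using c c' by (auto simp: prod_mfd_def mem_Times_iff)
  then have "(cmap (prod_chart c c') \<circ> \<theta>) differentiable (at y)"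
    using \<theta> unfolding chart_differentiable_def by blast
  then have "(fst \<circ> (cmap (prod_chart c c') \<circ> \<theta>)) differentiable (at y)"
    by (intro differentiable_chain_at) (simp_all add: bounded_linear_imp_differentiable bounded_linear_fst)
  then show "(cmap c \<circ> (fst \<circ> \<theta>)) differentiable (at y)" by (simp add: o_def)
qed

lemma chart_differentiable_snd:
  assumes \<theta>: "chart_differentiable (prod_mfd N N') \<theta>"
    and N: "\<And>q. q \<in> topspace (mtop N) \<Longrightarrow> \<exists>c\<in>matlas N. q \<in> cdom c"
  shows "chart_differentiable N' (snd \<circ> \<theta>)"
  unfolding chart_differentiable_def
proof (intro conjI allI ballI impI)
  have cont: "continuous_map euclidean (prod_topology (mtop N) (mtop N')) \<theta>"
    using \<theta> by (simp add: chart_differentiable_def prod_mfd_def)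
  then show "continuous_map euclidean (mtop N') (snd \<circ> \<theta>)" by (simp add: continuous_map_pairwise)
  fix y c assume c: "c \<in> matlas N'" "(snd \<circ> \<theta>) y \<in> cdom c"
  have "\<theta> y \<in> topspace (prod_topology (mtop N) (mtop N'))" using cont by (auto simp: continuous_map_def)
  then obtain c' where c': "c' \<in> matlas N" "fst (\<theta> y) \<in> cdom c'" using N by (cases "\<theta> y") auto
  have "prod_chart c' c \<in> matlas (prod_mfd N N')" "\<theta> y \<in> cdom (prod_chart c' c)"
    using c c' by (auto simp: prod_mfd_def mem_Times_iff)
  then have "(cmap (prod_chart c' c) \<circ> \<theta>) differentiable (at y)"
    using \<theta> unfolding chart_differentiable_def by blast
  then have "(snd \<circ> (cmap (prod_chart c' c) \<circ> \<theta>)) differentiable (at y)"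
    by (intro differentiable_chain_at) (simp_all add: bounded_linear_imp_differentiable bounded_linear_snd)
  then show "(cmap c \<circ> (snd \<circ> \<theta>)) differentiable (at y)" by (simp add: o_def)
qed

text \<open>Near each point the lift is the coordinate expression of the map below, since charts
  invert \<open>p\<close>.\<close>

lemma (in torus_mfd) lift_differentiable:
  assumes \<theta>: "chart_differentiable T (p \<circ> F)" and F: "continuous_on UNIV F"
  shows "F differentiable (at x)"
proof -
  obtain c where c: "c \<in> matlas T" "F x \<in> cimg c" using chart_at by blast
  have oN: "open (F -` cimg c)" by (rule open_vimage[OF chart_img[OF c(1)] F])
  have "(cmap c \<circ> (p \<circ> F)) differentiable (at x)"
    using \<theta> c chart_dom_eq[OF c(1)] unfolding chart_differentiable_def by auto
  then obtain F' where "((cmap c \<circ> (p \<circ> F)) has_derivative F') (at x)" unfolding differentiable_def by blast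
  then have "(F has_derivative F') (at x)"
    by (rule has_derivative_transform_within_open[OF _ oN]) (use c chart_map[OF c(1)] in auto)
  then show ?thesis unfolding differentiable_def by blast
qed

text \<open>\<open>pullback\<close> and \<open>cover_metric\<close> select the chart of
  \<open>M\<close> by the same choice term, so the chain rule suffices and no transformation law of
  \<open>g\<close> enters.\<close>

lemma cover_metric_pullback:
  assumes "charted B" "charted M" and \<theta>: "chart_differentiable B \<theta>"
    and \<pi>: "smooth_map_on B (topspace (mtop B)) M \<pi>"
  shows "cover_metric B \<theta> (pullback B M \<pi> g) y v w = cover_metric M (\<pi> \<circ> \<theta>) g y v w"
    and "chart_differentiable M (\<pi> \<circ> \<theta>)"
proof -
  interpret B: charted B by fact
  interpret M: charted M by fact
  have cont: "continuous_map euclidean (mtop B) \<theta>" using \<theta> by (simp add: chart_differentiable_def)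
  have cont\<pi>: "continuous_map (mtop B) (mtop M) \<pi>" using \<pi> by (simp add: smooth_map_on_def)
  have cont2: "continuous_map euclidean (mtop M) (\<pi> \<circ> \<theta>)" using continuous_map_compose[OF cont cont\<pi>] .
  have top: "\<theta> z \<in> topspace (mtop B)" "\<pi> (\<theta> z) \<in> topspace (mtop M)" for z
    using cont cont2 by (auto simp: continuous_map_def)
  note key = smooth_map_on_has_derivative[OF assms(1) M.dom_open \<theta> _ \<pi>]
  have range: "range \<theta> \<subseteq> topspace (mtop B)" using top(1) by auto
  show "chart_differentiable M (\<pi> \<circ> \<theta>)"
    by (rule smooth_map_on_chart_differentiable[OF assms(1) M.dom_open \<theta> range \<pi>])
  define d where "d = (SOME d. d \<in> matlas B \<and> \<theta> y \<in> cdom d)"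
  define e where "e = (SOME e. e \<in> matlas M \<and> \<pi> (\<theta> y) \<in> cdom e)"
  have d: "d \<in> matlas B" "\<theta> y \<in> cdom d" using B.some_chart[OF top(1) d_def] .
  have e: "e \<in> matlas M" "\<pi> (\<theta> y) \<in> cdom e" using M.some_chart[OF top(2) e_def] .
  have fr: "frechet_derivative (cmap e \<circ> (\<pi> \<circ> \<theta>)) (at y) =
     (\<lambda>v. loc_deriv d e (topspace (mtop B)) \<pi> (cmap d (\<theta> y)) (frechet_derivative (cmap d \<circ> \<theta>) (at y) v))"
    using frechet_derivative_at[OF key[OF e(1) range d e]] by simp
  have ci: "cinv d (cmap d (\<theta> y)) = \<theta> y" by (rule B.inverse_chart[OF d])
  show "cover_metric B \<theta> (pullback B M \<pi> g) y v w = cover_metric M (\<pi> \<circ> \<theta>) g y v w"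
    unfolding cover_metric_def Let_def comp_apply[of \<pi> \<theta>] d_def[symmetric] e_def[symmetric] fr pullback_def ci
    by (simp add: loc_rep_def ci)
qed

text \<open>Since charts of the torus invert \<open>p\<close>, the coefficients in every chart are
  those on the cover. This turns the geometric conditions on pullbacks into statements about one
  function on Euclidean space.\<close>

lemma (in torus_mfd) pullback_cover_metric:
  assumes "charted N" and c: "c \<in> matlas T" "y \<in> cimg c" and j: "continuous_map (mtop T) (mtop N) j"
  shows "pullback T N j g c y v w = cover_metric N (j \<circ> p) g y v w"
proof -
  interpret N: charted N by fact
  define d where "d = (SOME d. d \<in> matlas N \<and> j (p y) \<in> cdom d)"
  have cont: "continuous_map euclidean (mtop N) (j \<circ> p)" using continuous_map_compose[OF continuous_param j] .
  then have "j (p y) \<in> topspace (mtop N)" by (auto simp: continuous_map_def)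
  then have d: "d \<in> matlas N" "j (p y) \<in> cdom d" using N.some_chart[OF _ d_def] by auto
  have ci: "cinv c z = p z" if "z \<in> cimg c" for z by (rule chart_inverse[OF c(1) that])
  have L: "loc_dom c d (topspace (mtop T)) j = cimg c \<inter> {z. (j \<circ> p) z \<in> cdom d}"
    unfolding loc_dom_def chart_dom_eq[OF c(1)] using chart_map[OF c(1)] range_param by force
  have "open (cimg c \<inter> {z. (j \<circ> p) z \<in> cdom d})"
    using chart_img[OF c(1)] open_preimage_continuous_map[OF cont N.dom_open[OF d(1)]] by blast
  then have "loc_deriv c d (topspace (mtop T)) j y = frechet_derivative (cmap d \<circ> (j \<circ> p)) (at y)"
    unfolding loc_deriv_def L using c(2) d
    by (intro frechet_derivative_within_open_cong) (auto simp: loc_rep_def ci)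
  then show ?thesis
    unfolding pullback_def cover_metric_def Let_def ci[OF c(2)] comp_apply[of j p] d_def[symmetric]
    by (simp add: loc_rep_def ci[OF c(2)])
qed

section \<open>Flat tori as local models of Euclidean space\<close>

abbreviation euclid_chart :: "('e, 'e::euclidean_space) chart" where
  "euclid_chart \<equiv> \<lparr>cdom = UNIV, cmap = id, chalf = 0\<rparr>"

lemma cinv_euclid_chart: "cinv euclid_chart y = y"
  unfolding cinv_def using the_inv_into_f_f[of id UNIV y] by simp

text \<open>A local isometry given by flatness is read in one chart and restricted until it and its
  inverse are defined and smooth on open sets of Euclidean space.\<close>

lemma (in torus_mfd) flat_local:
  fixes x0 :: 'e
  assumes flat: "flat T h"
  obtains c W V and \<phi> \<sigma> :: "'e \<Rightarrow> 'e" where "c \<in> matlas T" "open W" "x0 \<in> W" "W \<subseteq> cimg c" "open V"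
    "homeomorphism W V \<phi> \<sigma>" "\<And>k. Ck_on k W \<phi>" "\<And>k. Ck_on k V \<sigma>"
    "\<And>c' y v w. c' \<in> matlas T \<Longrightarrow> y \<in> W \<Longrightarrow> y \<in> cimg c' \<Longrightarrow>
       h c' y v w = frechet_derivative \<phi> (at y) v \<bullet> frechet_derivative \<phi> (at y) w"
proof -
  have "p x0 \<in> topspace (mtop T)" using range_param by blast
  then obtain U V0 f where U: "p x0 \<in> U" and iso: "isometry_betw T h U (euclid :: ('e, 'e) mfd) (\<lambda>c x v w. v \<bullet> w) V0 f"
    using flat unfolding flat_def by meson
  have oU: "openin (mtop T) U" and oV0: "open V0" and df: "diffeo_betw T U (euclid :: ('e, 'e) mfd) V0 f"
    and isom: "\<And>c x v w. c \<in> matlas T \<Longrightarrow> x \<in> loc_dom c euclid_chart U f \<Longrightarrow>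
       h c x v w = loc_deriv c euclid_chart U f x v \<bullet> loc_deriv c euclid_chart U f x w"
    using iso unfolding isometry_betw_def euclid_def by auto
  have bij: "bij_betw f U V0" and sf: "smooth_map_on T U (euclid :: ('e, 'e) mfd) f"
    and sg: "smooth_map_on (euclid :: ('e, 'e) mfd) V0 T (the_inv_into U f)"
    using df by (auto simp: diffeo_betw_def)
  define k where "k = the_inv_into U f"
  have kf: "k (f q) = q" if "q \<in> U" for q
    using that bij unfolding k_def by (simp add: bij_betw_def the_inv_into_f_f)
  have fk: "f (k y) = y" "k y \<in> U" if "y \<in> V0" for y
    using that bij f_the_inv_into_f_bij_betw[OF bij] bij_betw_the_inv_into[OF bij]
    unfolding k_def by (auto simp: bij_betw_def)
  obtain c where c: "c \<in> matlas T" "x0 \<in> cimg c" using chart_at by blast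
  define \<phi> where "\<phi> = f \<circ> p"
  define \<sigma> where "\<sigma> = cmap c \<circ> k"
  have ci: "cinv c' z = p z" if "c' \<in> matlas T" "z \<in> cimg c'" for c' z by (rule chart_inverse[OF that])
  have pU: "open {z. p z \<in> U}" by (rule open_preimage_continuous_map[OF continuous_param oU])
  have L: "loc_dom c' euclid_chart U f = cimg c' \<inter> {z. p z \<in> U}" if "c' \<in> matlas T" for c'
    unfolding loc_dom_def chart_dom_eq[OF that] using chart_map[OF that] by force
  have rep: "loc_rep c' euclid_chart f z = \<phi> z" if "c' \<in> matlas T" "z \<in> cimg c'" for c' z
    using ci[OF that] by (simp add: loc_rep_def \<phi>_def)
  have "\<forall>c\<in>matlas T. smooth_on (loc_dom c euclid_chart U f) (loc_rep c euclid_chart f)"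
    using sf by (simp add: smooth_map_on_def euclid_def)
  from bspec[OF this c(1)] have "smooth_on (cimg c \<inter> {z. p z \<in> U}) (loc_rep c euclid_chart f)"
    by (simp only: L[OF c(1)])
  then obtain W1 where W1: "open W1" "x0 \<in> W1" "W1 \<subseteq> cimg c \<inter> {z. p z \<in> U}" "\<And>n. Ck_on n W1 (loc_rep c euclid_chart f)"
    by (rule smooth_on_open) (use chart_img[OF c(1)] pU c(2) U in auto)
  have W1\<phi>: "Ck_on n W1 \<phi>" for n
    by (rule Ck_on_cong[OF W1(1) _ W1(4)]) (use rep[OF c(1)] W1(3) in auto)
  have L2: "loc_dom euclid_chart c V0 k = V0 \<inter> k -` cdom c"
    by (auto simp: loc_dom_def)
  have rep2: "loc_rep euclid_chart c k = \<sigma>"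
    by (auto simp: loc_rep_def \<sigma>_def cinv_euclid_chart fun_eq_iff)
  have "\<forall>c\<in>matlas T. smooth_on (loc_dom euclid_chart c V0 k) (loc_rep euclid_chart c k)"
    using sg by (simp add: smooth_map_on_def euclid_def k_def)
  from bspec[OF this c(1)] have "smooth_on (V0 \<inter> k -` cdom c) \<sigma>" by (simp only: L2 rep2)
  moreover have "open (V0 \<inter> k -` cdom c)"
  proof -
    have "continuous_map (top_of_set V0) (mtop T) k"
      using sg by (simp add: smooth_map_on_def euclid_def k_def)
    then have "openin (top_of_set V0) {x \<in> topspace (top_of_set V0). k x \<in> cdom c}"
      using chart_dom[OF c(1)] openin_continuous_map_preimage by blast
    moreover have "{x \<in> topspace (top_of_set V0). k x \<in> cdom c} = V0 \<inter> k -` cdom c" by auto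
    ultimately show ?thesis using oV0 openin_open_trans by auto
  qed
  moreover have "\<phi> x0 \<in> V0 \<inter> k -` cdom c"
    using U bij kf[OF U] c(2) chart_dom_eq[OF c(1)] unfolding \<phi>_def by (auto simp: bij_betw_def)
  ultimately obtain V1 where V1: "open V1" "\<phi> x0 \<in> V1" "V1 \<subseteq> V0 \<inter> k -` cdom c" "\<And>n. Ck_on n V1 \<sigma>"
    by (rule smooth_on_open) blast
  have c\<phi>: "continuous_on W1 \<phi>" and c\<sigma>: "continuous_on V1 \<sigma>" using W1\<phi>[of 0] V1(4)[of 0] by auto
  \<comment> \<open>Smoothness is available for the map on \<open>W1\<close> and for its inverse on
    \<open>V1\<close>; the two restrictions make them inverse to each other.\<close>
  define W where "W = W1 \<inter> \<phi> -` V1"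
  define V where "V = V1 \<inter> \<sigma> -` W"
  have oW: "open W" unfolding W_def using continuous_open_preimage[OF c\<phi> W1(1) V1(1)] .
  have oV: "open V" unfolding V_def using continuous_open_preimage[OF c\<sigma> V1(1) oW] .
  have \<sigma>\<phi>: "\<sigma> (\<phi> x) = x" if "x \<in> W" for x
  proof -
    have "x \<in> cimg c" "p x \<in> U" using that W1(3) by (auto simp: W_def)
    then show ?thesis using kf[of "p x"] chart_map[OF c(1), of x] by (simp add: \<sigma>_def \<phi>_def)
  qed
  have \<phi>\<sigma>: "\<phi> (\<sigma> y) = y" if "y \<in> V" for y
  proof -
    have y: "y \<in> V0" "k y \<in> cdom c" using that V1(3) by (auto simp: V_def)
    then obtain z where z: "z \<in> cimg c" "k y = p z" using chart_dom_eq[OF c(1)] by auto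
    then have "p (\<sigma> y) = k y" using chart_map[OF c(1)] by (simp add: \<sigma>_def)
    then show ?thesis using fk(1)[OF y(1)] by (simp add: \<phi>_def)
  qed
  have "\<phi> ` W \<subseteq> V" using \<sigma>\<phi> by (auto simp: V_def W_def)
  moreover have "\<sigma> ` V \<subseteq> W" by (auto simp: V_def)
  ultimately have hom: "homeomorphism W V \<phi> \<sigma>"
    using \<sigma>\<phi> \<phi>\<sigma> c\<phi> c\<sigma>
    by (intro homeomorphismI) (auto simp: W_def V_def intro: continuous_on_subset)
  have iso2: "h c' y v w = frechet_derivative \<phi> (at y) v \<bullet> frechet_derivative \<phi> (at y) w"
    if c': "c' \<in> matlas T" and y: "y \<in> W" "y \<in> cimg c'" for c' y v w
  proof -
    have yL: "y \<in> cimg c' \<inter> {z. p z \<in> U}" using y W1(3) by (auto simp: W_def)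
    have "loc_deriv c' euclid_chart U f y = frechet_derivative \<phi> (at y)"
      unfolding loc_deriv_def L[OF c']
      by (rule frechet_derivative_within_open_cong) (use chart_img[OF c'] pU yL rep[OF c'] in auto)
    then show ?thesis using isom[OF c', of y v w] yL L[OF c'] by simp
  qed
  show ?thesis
    by (rule that[OF c(1) oW _ _ oV hom]) (use W1 V1 W1\<phi> iso2 in \<open>auto simp: W_def V_def intro: Ck_on_subset\<close>)
qed

lemma homeomorphism_derivative_inj:
  fixes \<phi> :: "'e::euclidean_space \<Rightarrow> 'e"
  assumes h: "homeomorphism W V \<phi> \<sigma>" and W: "open W" "x \<in> W"
    and \<phi>: "(\<phi> has_derivative \<phi>') (at x)" and \<sigma>: "\<sigma> differentiable (at (\<phi> x))"
  shows "inj \<phi>'"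
proof -
  obtain s' where s': "(\<sigma> has_derivative s') (at (\<phi> x))" using \<sigma> differentiable_def by blast
  have "((\<sigma> \<circ> \<phi>) has_derivative (s' \<circ> \<phi>')) (at x)" by (rule diff_chain_at[OF \<phi> s'])
  then have "(id has_derivative (s' \<circ> \<phi>')) (at x)"
    by (rule has_derivative_transform_within_open[OF _ W]) (use h in \<open>auto simp: homeomorphism_def\<close>)
  then have "s' \<circ> \<phi>' = id" using has_derivative_unique has_derivative_id unfolding id_def by blast
  then show ?thesis by (metis inj_on_id inj_on_imageI2)
qed

text \<open>The same local isometry is kept in two roles: as a developing map, to be glued to a
  global one, and with two derivatives, for the geodesic equation.\<close>

lemma (in torus_mfd) flat_local_developing:
  fixes x0 :: 'e
  assumes flat: "flat T h" and G: "\<And>c y. c \<in> matlas T \<Longrightarrow> y \<in> cimg c \<Longrightarrow> h c y = G y"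
  obtains W V and \<phi> \<sigma> :: "'e \<Rightarrow> 'e" where "x0 \<in> W" "developing G W \<phi>" "open V"
    "homeomorphism W V \<phi> \<sigma>" "Ck_on 2 W \<phi>" "Ck_on 2 V \<sigma>"
    "\<And>y v w. y \<in> W \<Longrightarrow> G y v w = frechet_derivative \<phi> (at y) v \<bullet> frechet_derivative \<phi> (at y) w"
proof -
  obtain c W V and \<phi> \<sigma> :: "'e \<Rightarrow> 'e" where F: "c \<in> matlas T" "open W" "x0 \<in> W" "W \<subseteq> cimg c" "open V"
    "homeomorphism W V \<phi> \<sigma>" "\<And>k. Ck_on k W \<phi>" "\<And>k. Ck_on k V \<sigma>"
    "\<And>c' y v w. c' \<in> matlas T \<Longrightarrow> y \<in> W \<Longrightarrow> y \<in> cimg c' \<Longrightarrow>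
       h c' y v w = frechet_derivative \<phi> (at y) v \<bullet> frechet_derivative \<phi> (at y) w"
    using flat_local[OF flat, of x0] by metis
  have Geq: "G y v w = frechet_derivative \<phi> (at y) v \<bullet> frechet_derivative \<phi> (at y) w" if "y \<in> W" for y v w
    using F(9)[OF F(1) that] G[OF F(1)] F(4) that by (metis subsetD)
  have d\<phi>: "(\<phi> has_derivative frechet_derivative \<phi> (at y)) (at y)" if "y \<in> W" for y
    using F(7)[of 1] F(2) that by (simp add: differentiable_on_eq_differentiable_at frechet_derivative_works)
  have d\<sigma>: "\<sigma> differentiable (at y)" if "y \<in> V" for y
    using F(8)[of 1] F(5) that by (simp add: differentiable_on_eq_differentiable_at)
  have "developing G W \<phi>"
    unfolding developing_def
  proof (intro conjI ballI)
    fix x assume x: "x \<in> W"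
    show "\<exists>D'. (\<phi> has_derivative D') (at x) \<and> (\<forall>u v. D' u \<bullet> D' v = G x u v)"
      using d\<phi>[OF x] Geq[OF x] by auto
    show "\<exists>U. open U \<and> x \<in> U \<and> inj_on \<phi> U"
      using F(2,6) x by (metis homeomorphism_def inj_on_inverseI)
    have "inj (frechet_derivative \<phi> (at x))"
      by (rule homeomorphism_derivative_inj[OF F(6,2) x d\<phi>[OF x] d\<sigma>]) (use F(6) x in \<open>auto simp: homeomorphism_def\<close>)
    then have "frechet_derivative \<phi> (at x) v \<noteq> 0" if "v \<noteq> 0" for v
      using that linear_injective_0[OF has_derivative_linear[OF d\<phi>[OF x]]] by blast
    then show "\<forall>v. v \<noteq> 0 \<longrightarrow> 0 < G x v v" using Geq[OF x] by simp
  qed (rule F(2))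
  then show ?thesis using that F Geq by blast
qed

lemma (in torus_mfd) flat_torus_exists:
  assumes flat: "flat T h" and G: "\<And>c y. c \<in> matlas T \<Longrightarrow> y \<in> cimg c \<Longrightarrow> h c y = G y"
    and per: "\<And>l x. l \<in> period_lattice \<Longrightarrow> G (x + l) = G x"
  obtains D where "flat_torus G D"
proof -
  have "\<exists>W D. x \<in> W \<and> developing G W D" for x
    using flat_local_developing[OF flat G, of x] by metis
  then obtain D where "developing G UNIV D" using developing_UNIV by metis
  then show ?thesis using that per unfolding flat_torus_def by blast
qed

text \<open>A chart inverts \<open>p\<close> only up to the lattice, and the lattice vector is
  locally constant.\<close>

lemma (in torus_mfd) chart_translation:
  assumes d: "d \<in> matlas T" "p y0 \<in> cdom d"
  obtains l N where "l \<in> period_lattice" "open N" "y0 \<in> N" "\<And>z. z \<in> N \<Longrightarrow> p z \<in> cdom d"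
    "\<And>z. z \<in> N \<Longrightarrow> cmap d (p z) = z + l"
proof -
  define l where "l = cmap d (p y0) - y0"
  have l: "l \<in> period_lattice" "y0 + l \<in> cimg d"
    using chart_map_param[OF d] by (auto simp: l_def)
  define N where "N = (\<lambda>z. z + l) -` cimg d"
  have "open N" unfolding N_def
    by (intro open_vimage chart_img d continuous_intros)
  moreover have "p z \<in> cdom d \<and> cmap d (p z) = z + l" if "z \<in> N" for z
  proof -
    have z: "z + l \<in> cimg d" using that by (simp add: N_def)
    have "p z = p (z + l)" using param_eq_iff lattice_minus[OF l(1)] by simp
    then show ?thesis using chart_map[OF d(1) z] chart_dom_eq[OF d(1)] z by auto
  qed
  ultimately show ?thesis using that[OF l(1), of N] l(2) by (auto simp: N_def)
qed

lemma (in torus_mfd) dom_cover: "(\<Union>d\<in>matlas T. cdom d) = topspace (mtop T)"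
proof (intro equalityI subsetI)
  fix q assume "q \<in> topspace (mtop T)"
  then obtain x where "q = p x" using range_param by auto
  then show "q \<in> (\<Union>d\<in>matlas T. cdom d)" using chart_at[of x] chart_dom_eq by auto
next
  fix q assume "q \<in> (\<Union>d\<in>matlas T. cdom d)"
  then show "q \<in> topspace (mtop T)" using chart_dom openin_subset by blast
qed

text \<open>In the torus factor, transitions are locally translations, so they contribute the
  identity to the derivative.\<close>

lemma charted_prod_torus:
  fixes N :: "('b, 'f::euclidean_space) mfd" and T :: "('x, 'e::euclidean_space) mfd"
  assumes "charted N" and "torus_mfd T p"
  shows "charted (prod_mfd N T)"
proof -
  interpret N: charted N by fact
  interpret T: torus_mfd T p by fact
  have chartE: "\<exists>c1 c2. c = prod_chart c1 c2 \<and> c1 \<in> matlas N \<and> c2 \<in> matlas T" if "c \<in> matlas (prod_mfd N T)" for c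
    using that by (auto simp: prod_mfd_def)
  have top: "topspace (mtop (prod_mfd N T)) = topspace (mtop N) \<times> topspace (mtop T)"
    by (simp add: prod_mfd_def)
  show ?thesis
  proof
    fix d assume "d \<in> matlas (prod_mfd N T)"
    then obtain d1 d2 where d: "d = prod_chart d1 d2" "d1 \<in> matlas N" "d2 \<in> matlas T" using chartE by blast
    show "openin (mtop (prod_mfd N T)) (cdom d)"
      using N.dom_open[OF d(2)] T.chart_dom[OF d(3)] by (simp add: d(1) prod_mfd_def openin_prod_Times_iff)
    have "inj_on (cmap d2) (cdom d2)"
      using T.chart_dom_eq[OF d(3)] T.chart_map[OF d(3)] by (auto simp: inj_on_def)
    then show "inj_on (cmap d) (cdom d)" using N.chart_inj[OF d(2)] by (simp add: d(1) map_prod_inj_on)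
    have "{x. 0 \<le> chalf d \<bullet> x} = {x. 0 \<le> chalf d1 \<bullet> x} \<times> UNIV" by (auto simp: d(1) inner_prod_def)
    moreover have "openin (top_of_set ({x. 0 \<le> chalf d1 \<bullet> x} \<times> UNIV)) (cimg d1 \<times> cimg d2)"
      using N.img_open[OF d(2)] T.chart_img[OF d(3)] by (intro openin_Times) auto
    ultimately show "openin (top_of_set {x. 0 \<le> chalf d \<bullet> x}) (cimg d)" by (simp add: d(1) prod_chart_img)
  next
    have "(\<Union>d\<in>matlas (prod_mfd N T). cdom d) = (\<Union>c\<in>matlas N. cdom c) \<times> (\<Union>c\<in>matlas T. cdom c)"
      by (fastforce simp: prod_mfd_def)
    then show "(\<Union>d\<in>matlas (prod_mfd N T). cdom d) = topspace (mtop (prod_mfd N T))"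
      by (simp add: top N.dom_cover T.dom_cover)
  next
    fix c d x
    assume cd: "c \<in> matlas (prod_mfd N T)" "d \<in> matlas (prod_mfd N T)"
      and x: "x \<in> loc_dom c d (topspace (mtop (prod_mfd N T))) id"
    obtain c1 c2 where c: "c = prod_chart c1 c2" "c1 \<in> matlas N" "c2 \<in> matlas T" using chartE[OF cd(1)] by blast
    obtain d1 d2 where d: "d = prod_chart d1 d2" "d1 \<in> matlas N" "d2 \<in> matlas T" using chartE[OF cd(2)] by blast
    let ?L = "loc_dom c d (topspace (mtop (prod_mfd N T))) id"
    let ?L1 = "loc_dom c1 d1 (topspace (mtop N)) id" and ?L2 = "loc_dom c2 d2 (topspace (mtop T)) id"
    have L: "fst ` ?L \<subseteq> ?L1" "snd ` ?L \<subseteq> ?L2"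
      by (auto simp: loc_dom_def c(1) d(1) top)
    have rep: "loc_rep c d id z = (loc_rep c1 d1 id (fst z), loc_rep c2 d2 id (snd z))" if z: "z \<in> ?L" for z
    proof -
      obtain a b where ab: "z = (cmap c1 a, cmap c2 b)" "a \<in> cdom c1" "b \<in> cdom c2"
        using z by (auto simp: loc_dom_def c(1))
      have i2: "inj_on (cmap c2) (cdom c2)"
        using T.chart_dom_eq[OF c(3)] T.chart_map[OF c(3)] by (auto simp: inj_on_def)
      have "inj_on (cmap c) (cdom c)" using N.chart_inj[OF c(2)] i2 by (simp add: c(1) map_prod_inj_on)
      then have "cinv c z = (a, b)"
        using ab unfolding cinv_def by (intro the_inv_into_f_eq) (auto simp: c(1))
      moreover have "cinv c1 (cmap c1 a) = a" by (rule N.inverse_chart[OF c(2) ab(2)])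
      moreover have "cinv c2 (cmap c2 b) = b" using i2 ab(3) by (simp add: cinv_def the_inv_into_f_f)
      ultimately show ?thesis by (simp add: loc_rep_def d(1) ab(1))
    qed
    obtain D1 where D1: "(loc_rep c1 d1 id has_derivative D1) (at (fst x) within ?L1)"
      using N.transition[OF c(2) d(2), of "fst x"] L(1) x unfolding differentiable_def by blast
    have x2: "snd x \<in> ?L2" using L(2) x by blast
    then obtain b where b: "snd x = cmap c2 b" "b \<in> cdom c2" "b \<in> cdom d2" by (auto simp: loc_dom_def)
    have xi: "snd x \<in> cimg c2" "b = p (snd x)"
      using b T.chart_dom_eq[OF c(3)] T.chart_map[OF c(3)] by auto
    obtain l N where lN: "open N" "snd x \<in> N" "\<And>z. z \<in> N \<Longrightarrow> cmap d2 (p z) = z + l"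
      using T.chart_translation[of d2 "snd x"] d(3) b(3) xi(2) by metis
    have D2: "(loc_rep c2 d2 id has_derivative (\<lambda>v. v)) (at (snd x))"
    proof (rule has_derivative_transform_within_open[of "\<lambda>z. z + l"])
      show "((\<lambda>z. z + l) has_derivative (\<lambda>v. v)) (at (snd x))" by (auto intro!: derivative_eq_intros)
      show "open (N \<inter> cimg c2)" using lN T.chart_img[OF c(3)] by blast
      show "z + l = loc_rep c2 d2 id z" if "z \<in> N \<inter> cimg c2" for z
        using that lN(3) T.chart_inverse[OF c(3)] by (simp add: loc_rep_def)
    qed (use lN xi in auto)
    have "((\<lambda>z. (loc_rep c1 d1 id (fst z), loc_rep c2 d2 id (snd z))) has_derivative (\<lambda>v. (D1 (fst v), snd v))) (at x within ?L)"
    proof (rule has_derivative_Pair)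
      show "((\<lambda>z. loc_rep c1 d1 id (fst z)) has_derivative (\<lambda>v. D1 (fst v))) (at x within ?L)"
        by (rule has_derivative_in_compose[OF has_derivative_fst[OF has_derivative_ident]
            has_derivative_subset[OF D1 L(1)]])
      show "((\<lambda>z. loc_rep c2 d2 id (snd z)) has_derivative (\<lambda>v. snd v)) (at x within ?L)"
        by (rule has_derivative_in_compose[OF has_derivative_snd[OF has_derivative_ident]
            has_derivative_at_withinI[OF D2]])
    qed
    from has_derivative_transform[OF x rep this]
    have "(loc_rep c d id has_derivative (\<lambda>v. (D1 (fst v), snd v))) (at x within ?L)" .
    then show "loc_rep c d id differentiable (at x within ?L)" using differentiable_def by blast
  qed
qed

section \<open>Christoffel symbols up to the boundary and in flat coordinates\<close>

text \<open>Even at a boundary point each coordinate direction can be followed into the half-space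
  on at least one side.\<close>

lemma has_derivative_unique_within_half_space:
  fixes f :: "'f::euclidean_space \<Rightarrow> 'a::real_normed_vector"
  assumes V: "openin (top_of_set {x. 0 \<le> h \<bullet> x}) V" and x: "x \<in> V"
    and f: "(f has_derivative f') (at x within V)" "(f has_derivative f'') (at x within V)"
  shows "f' = f''"
proof (rule frechet_derivative_unique_within[OF f])
  fix i :: 'f and e :: real assume i: "i \<in> Basis" and e: "e > 0"
  obtain O' where O': "open O'" "V = {x. 0 \<le> h \<bullet> x} \<inter> O'" using V by (auto simp: openin_open)
  obtain r where r: "r > 0" "ball x r \<subseteq> O'" using O' x open_contains_ball by (metis IntD2)
  define t where "t = min e r / 2"
  have t: "t > 0" "t < e" "t < r" using e r by (auto simp: t_def)
  \<comment> \<open>The sign is chosen so that the step does not decrease the product with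
    \<open>h\<close>.\<close>
  define d where "d = (if 0 \<le> h \<bullet> i then t else - t)"
  have d: "\<bar>d\<bar> = t" "0 \<le> d * (h \<bullet> i)" using t mult_nonneg_nonpos[of t "h \<bullet> i"] by (auto simp: d_def)
  have "x + d *\<^sub>R i \<in> ball x r" using d t i by (simp add: dist_norm)
  moreover have "0 \<le> h \<bullet> (x + d *\<^sub>R i)" using d(2) x O'(2) by (simp add: inner_add_right)
  ultimately have "x + d *\<^sub>R i \<in> V" using r(2) O'(2) by auto
  then show "\<exists>d. 0 < \<bar>d\<bar> \<and> \<bar>d\<bar> < e \<and> x + d *\<^sub>R i \<in> V" using d t by (intro exI[of _ d]) auto
qed

text \<open>The matrix of a positive form is injective, hence invertible in finite dimension; this
  is Riesz representation for that form.\<close>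

lemma positive_bilinear_representation:
  fixes B :: "'f::euclidean_space \<Rightarrow> 'f \<Rightarrow> real"
  assumes B: "bilinear B" and pos: "\<And>v. v \<noteq> 0 \<Longrightarrow> B v v > 0" and l: "linear l"
  shows "\<exists>!a. \<forall>w. B a w = l w"
proof -
  define A where "A a = (\<Sum>b\<in>Basis. B a b *\<^sub>R b)" for a
  have Ab: "A a \<bullet> b = B a b" if "b \<in> Basis" for a b
    using that by (simp add: A_def inner_sum_left inner_Basis if_distrib cong: if_cong)
  have linA: "linear A" unfolding A_def
    by (intro linearI)
      (simp_all add: bilinear_ladd[OF B] bilinear_lmul[OF B] scaleR_add_left sum.distrib scaleR_sum_right)
  have lin2: "linear (B a)" for a using B by (simp add: bilinear_def)
  have ext: "(\<forall>w. B a w = m w) \<longleftrightarrow> (\<forall>b\<in>Basis. B a b = m b)" if "linear m" for a m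
  proof (intro iffI ballI allI)
    fix w assume eq: "\<forall>b\<in>Basis. B a b = m b"
    show "B a w = m w" using linear_eq_stdbasis[OF lin2 that] eq by metis
  qed simp
  have "inj A"
  proof (subst linear_injective_0[OF linA], intro allI impI)
    fix a assume "A a = 0"
    then have "\<forall>b\<in>Basis. B a b = (\<lambda>_. 0) b" using Ab by (metis inner_zero_left)
    then have "B a a = 0" using ext[of "\<lambda>_. 0" a] by (simp add: linear_zero)
    then show "a = 0" using pos by fastforce
  qed
  then have bij: "bij A" using linear_injective_imp_surjective[OF linA] by (simp add: bij_def)
  have eq: "(\<forall>w. B a w = l w) \<longleftrightarrow> A a = (\<Sum>b\<in>Basis. l b *\<^sub>R b)" for a
    unfolding ext[OF l]
  proof
    assume "\<forall>b\<in>Basis. B a b = l b" then show "A a = (\<Sum>b\<in>Basis. l b *\<^sub>R b)" by (simp add: A_def)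
  next
    assume "A a = (\<Sum>b\<in>Basis. l b *\<^sub>R b)"
    then have "A a \<bullet> b = l b" if "b \<in> Basis" for b
      using that by (simp add: inner_sum_left inner_Basis if_distrib cong: if_cong)
    then show "\<forall>b\<in>Basis. B a b = l b" using Ab by auto
  qed
  obtain a where "A a = (\<Sum>b\<in>Basis. l b *\<^sub>R b)" using bij by (metis bij_pointE)
  moreover have "a' = a" if "A a' = A a" for a' using that bij by (simp add: bij_def inj_eq)
  ultimately show ?thesis unfolding eq by (intro ex1I[of _ a]) metis+
qed

text \<open>Uniqueness of derivatives within the half-space makes \<open>dderiv\<close> of the
  coefficients linear in each vector. So the right-hand side of Koszul's formula is linear in w, and
  the definite description in \<open>christoffel\<close> denotes something.\<close>

lemma (in charted) connection_chart:
  assumes g: "riemannian_metric N g" and d: "d \<in> matlas N"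
  shows "connection (cimg d) (g d) (\<lambda>x u a b. dderiv (cimg d) (\<lambda>y. g d y a b) x u) (christoffel (cimg d) (g d))"
proof -
  let ?V = "cimg d"
  have sm: "smooth_on ?V (\<lambda>x. g d x v w)" for v w using g d by (simp add: riemannian_metric_def)
  have bil: "bilinear (g d x)" and symm: "g d x v w = g d x w v" and pos: "v \<noteq> 0 \<Longrightarrow> g d x v v > 0"
    if "x \<in> ?V" for x v w using g d that unfolding riemannian_metric_def by blast+
  have der: "((\<lambda>y. g d y a b) has_derivative dderiv ?V (\<lambda>y. g d y a b) x) (at x within ?V)" if "x \<in> ?V" for x a b
  proof -
    have "(\<lambda>x. g d x a b) differentiable (at x within ?V)" using smooth_on_differentiable[OF sm that] .
    then show ?thesis by (simp add: dderiv_def[abs_def] frechet_derivative_works)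
  qed
  have uniq: "dderiv ?V f x = f'" if "x \<in> ?V" "(f has_derivative f') (at x within ?V)" for f f' x
  proof -
    have "(f has_derivative frechet_derivative f (at x within ?V)) (at x within ?V)"
      using that(2) differentiable_def frechet_derivative_works by blast
    then show ?thesis using has_derivative_unique_within_half_space[OF img_open[OF d] that(1) _ that(2)]
      by (simp add: dderiv_def[abs_def])
  qed
  have ladd: "dderiv ?V (\<lambda>y. g d y (a + a') b) x u = dderiv ?V (\<lambda>y. g d y a b) x u + dderiv ?V (\<lambda>y. g d y a' b) x u"
    and lmul: "dderiv ?V (\<lambda>y. g d y (r *\<^sub>R a) b) x u = r * dderiv ?V (\<lambda>y. g d y a b) x u"
    and swap: "dderiv ?V (\<lambda>y. g d y a b) x u = dderiv ?V (\<lambda>y. g d y b a) x u"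
    if x: "x \<in> ?V" for x u a a' b r
  proof -
    have "((\<lambda>y. g d y (a + a') b) has_derivative (\<lambda>u. dderiv ?V (\<lambda>y. g d y a b) x u + dderiv ?V (\<lambda>y. g d y a' b) x u)) (at x within ?V)"
      by (rule has_derivative_transform[OF x _ has_derivative_add[OF der[OF x] der[OF x]]])
        (simp add: bilinear_ladd[OF bil])
    from uniq[OF x this] show "dderiv ?V (\<lambda>y. g d y (a + a') b) x u = dderiv ?V (\<lambda>y. g d y a b) x u + dderiv ?V (\<lambda>y. g d y a' b) x u" by simp
    have "((\<lambda>y. g d y (r *\<^sub>R a) b) has_derivative (\<lambda>u. r * dderiv ?V (\<lambda>y. g d y a b) x u)) (at x within ?V)"
      by (rule has_derivative_transform[OF x _ has_derivative_mult_right[OF der[OF x]]])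
        (simp add: bilinear_lmul[OF bil])
    from uniq[OF x this] show "dderiv ?V (\<lambda>y. g d y (r *\<^sub>R a) b) x u = r * dderiv ?V (\<lambda>y. g d y a b) x u" by simp
    have "((\<lambda>y. g d y a b) has_derivative dderiv ?V (\<lambda>y. g d y b a) x) (at x within ?V)"
      by (rule has_derivative_transform[OF x _ der[OF x]]) (simp add: symm)
    from uniq[OF x this] show "dderiv ?V (\<lambda>y. g d y a b) x u = dderiv ?V (\<lambda>y. g d y b a) x u" by simp
  qed
  have linu: "linear (dderiv ?V (\<lambda>y. g d y a b) x)" if "x \<in> ?V" for x a b
    using has_derivative_linear[OF der[OF that]] .
  have lin1: "linear (\<lambda>a. dderiv ?V (\<lambda>y. g d y a b) x u)" if "x \<in> ?V" for x u b
    by (intro linearI) (simp_all add: ladd[OF that] lmul[OF that])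
  then have lin2: "linear (\<lambda>b. dderiv ?V (\<lambda>y. g d y a b) x u)" if "x \<in> ?V" for x u a
    unfolding swap[OF that, of a] using that by blast
  show ?thesis
  proof
    fix x a b w assume x: "x \<in> ?V"
    define l where "l w = (dderiv ?V (\<lambda>y. g d y b w) x a + dderiv ?V (\<lambda>y. g d y a w) x b - dderiv ?V (\<lambda>y. g d y a b) x w) / 2" for w
    have "linear l"
    proof (rule linearI)
      show "l (u + v) = l u + l v" for u v
        by (simp add: l_def linear_add[OF lin2[OF x]] linear_add[OF linu[OF x]] field_simps)
      show "l (r *\<^sub>R u) = r *\<^sub>R l u" for r u
        by (simp add: l_def linear_scale[OF lin2[OF x]] linear_scale[OF linu[OF x]] field_simps)
    qed
    from positive_bilinear_representation[OF bil[OF x] pos[OF x] this]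
    have ex: "\<exists>!c. \<forall>w. g d x c w = l w" .
    have "christoffel ?V (g d) x a b = (THE c. \<forall>w. g d x c w = l w)"
      unfolding christoffel_def l_def by (simp add: field_simps)
    then have "g d x (christoffel ?V (g d) x a b) w = l w" using theI'[OF ex] by simp
    then show "2 * g d x (christoffel ?V (g d) x a b) w = dderiv ?V (\<lambda>y. g d y b w) x a + dderiv ?V (\<lambda>y. g d y a w) x b - dderiv ?V (\<lambda>y. g d y a b) x w"
      by (simp add: l_def field_simps)
  next
    show "bilinear (\<lambda>a b. dderiv ?V (\<lambda>y. g d y a b) x u)" if "x \<in> ?V" for x u
      unfolding bilinear_def using lin1[OF that] lin2[OF that] by blast
  qed (use bil symm der in blast)+
qed

lemma connection_euclidean: "connection UNIV (\<lambda>_ v w. v \<bullet> w) (\<lambda>_ _ _ _. 0) (\<lambda>_ _ _. 0)"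
  by unfold_locales
    (auto simp: bilinear_def inner_commute inner_add_left inner_add_right intro!: linearI)

text \<open>An isometry to Euclidean space carries covariant derivatives to ordinary ones. In these
  terms a curve is a geodesic exactly when its image under \<open>\<phi>\<close> has no
  acceleration.\<close>

lemma christoffel_flat:
  fixes \<phi> :: "'e::euclidean_space \<Rightarrow> 'e"
  assumes \<phi>: "C2_map W \<phi> \<phi>' \<phi>''" and y: "y \<in> W" "y \<in> V" "open V"
    and G: "\<And>z v w. z \<in> W \<Longrightarrow> z \<in> V \<Longrightarrow> G z v w = \<phi>' z v \<bullet> \<phi>' z w" and inj: "inj (\<phi>' y)"
  shows "\<phi>' y (christoffel V G y u v) = \<phi>'' y u v"
proof -
  have W: "open W" using \<phi> by (simp add: C2_map_def)
  have linp: "linear (\<phi>' y)" using \<phi> y has_derivative_linear unfolding C2_map_def by blast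
  have surj: "surj (\<phi>' y)" using linear_injective_imp_surjective[OF linp inj] by simp
  have dG: "dderiv V (\<lambda>z. G z v w) y u = \<phi>'' y u v \<bullet> \<phi>' y w + \<phi>' y v \<bullet> \<phi>'' y u w" for u v w
  proof -
    have "((\<lambda>z. \<phi>' z v \<bullet> \<phi>' z w) has_derivative (\<lambda>u. \<phi>'' y u v \<bullet> \<phi>' y w + \<phi>' y v \<bullet> \<phi>'' y u w)) (at y)"
      using \<phi> y(1) unfolding C2_map_def by (auto intro!: derivative_eq_intros)
    then have "((\<lambda>z. G z v w) has_derivative (\<lambda>u. \<phi>'' y u v \<bullet> \<phi>' y w + \<phi>' y v \<bullet> \<phi>'' y u w)) (at y)"
      by (rule has_derivative_transform_within_open[OF _ open_Int[OF W y(3)] IntI[OF y(1,2)]]) (use G in auto)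
    from frechet_derivative_at[OF this] show ?thesis
      unfolding dderiv_def at_within_open[OF y(2,3)] by metis
  qed
  note s = C2_map_symmetric[OF \<phi> y(1)]
  have cond: "(\<forall>w. 2 * G y a w = dderiv V (\<lambda>z. G z v w) y u + dderiv V (\<lambda>z. G z u w) y v - dderiv V (\<lambda>z. G z u v) y w)
     \<longleftrightarrow> \<phi>' y a = \<phi>'' y u v" for a
  proof -
    have "dderiv V (\<lambda>z. G z v w) y u + dderiv V (\<lambda>z. G z u w) y v - dderiv V (\<lambda>z. G z u v) y w
        = 2 * (\<phi>'' y u v \<bullet> \<phi>' y w)" for w
      unfolding dG using s[of v u] s[of w u] s[of w v] by (simp add: inner_commute)
    then have "(\<forall>w. 2 * G y a w = dderiv V (\<lambda>z. G z v w) y u + dderiv V (\<lambda>z. G z u w) y v - dderiv V (\<lambda>z. G z u v) y w)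
      \<longleftrightarrow> (\<forall>w. \<phi>' y a \<bullet> \<phi>' y w = \<phi>'' y u v \<bullet> \<phi>' y w)"
      using G[OF y(1,2)] by simp
    also have "\<dots> \<longleftrightarrow> (\<forall>w. \<phi>' y a \<bullet> w = \<phi>'' y u v \<bullet> w)" using surj by (metis surjD)
    also have "\<dots> \<longleftrightarrow> \<phi>' y a = \<phi>'' y u v" by (metis vector_eq_rdot)
    finally show ?thesis .
  qed
  obtain a where a: "\<phi>' y a = \<phi>'' y u v" using surj by (metis surjD)
  have "christoffel V G y u v = a"
    unfolding christoffel_def cond
  proof (rule the_equality)
    show "\<phi>' y a = \<phi>'' y u v" by (rule a)
    show "x = a" if "\<phi>' y x = \<phi>'' y u v" for x using injD[OF inj, of x a] that a by simp
  qed
  then show ?thesis using a by simp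
qed

text \<open>The chain rule along a curve, to second order; it translates between accelerations in
  different coordinates.\<close>

lemma C2_map_along:
  assumes H: "C2_map W H H' H''" and xt: "x t \<in> W"
    and x: "(x has_vector_derivative x' t) (at t)" "(x' has_vector_derivative x'') (at t)"
  shows "((\<lambda>s. H (x s)) has_vector_derivative H' (x t) (x' t)) (at t)"
    and "((\<lambda>s. H' (x s) (x' s)) has_vector_derivative (H'' (x t) (x' t) (x' t) + H' (x t) x'')) (at t)"
proof -
  have W: "open W" using H by (simp add: C2_map_def)
  have dH: "(H has_derivative H' y) (at y)" if "y \<in> W" for y using H that by (simp add: C2_map_def)
  have dH': "((\<lambda>z. H' z v) has_derivative (\<lambda>u. H'' (x t) u v)) (at (x t))" for v
    using H xt by (simp add: C2_map_def)
  have xd: "(x has_derivative (\<lambda>h. h *\<^sub>R x' t)) (at t)" and xd': "(x' has_derivative (\<lambda>h. h *\<^sub>R x'')) (at t)"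
    using x by (simp_all add: has_vector_derivative_def)
  have linH: "linear (H' y)" if "y \<in> W" for y using has_derivative_linear[OF dH[OF that]] .
  show "((\<lambda>s. H (x s)) has_vector_derivative H' (x t) (x' t)) (at t)"
    using has_derivative_compose[OF xd dH[OF xt]] by (simp add: has_vector_derivative_def linear_scale[OF linH[OF xt]])
  have lin'': "linear (\<lambda>u. H'' (x t) u v)" for v using has_derivative_linear[OF dH'] .
  \<comment> \<open>\<open>H'\<close> is known to be differentiable only for fixed vectors, whereas
    here the vector moves too, so it is expanded in the basis.\<close>
  have "((\<lambda>s. \<Sum>b\<in>Basis. (x' s \<bullet> b) *\<^sub>R H' (x s) b) has_derivative
     (\<lambda>h. \<Sum>b\<in>Basis. (x' t \<bullet> b) *\<^sub>R H'' (x t) (h *\<^sub>R x' t) b + (h *\<^sub>R x'' \<bullet> b) *\<^sub>R H' (x t) b)) (at t)"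
    by (auto intro!: derivative_eq_intros xd' has_derivative_compose[OF xd dH'])
  moreover have "(\<Sum>b\<in>Basis. (x' t \<bullet> b) *\<^sub>R H'' (x t) (h *\<^sub>R x' t) b + (h *\<^sub>R x'' \<bullet> b) *\<^sub>R H' (x t) b)
     = h *\<^sub>R (H'' (x t) (x' t) (x' t) + H' (x t) x'')" for h
  proof -
    have 1: "H' (x t) w = (\<Sum>b\<in>Basis. (w \<bullet> b) *\<^sub>R H' (x t) b)" for w
      using linear_sum[OF linH[OF xt], of "\<lambda>b. (w \<bullet> b) *\<^sub>R b" Basis]
      by (simp add: euclidean_representation linear_scale[OF linH[OF xt]])
    have lin2: "linear (H'' (x t) u)" for u
      unfolding C2_map_symmetric[OF H xt, of u, abs_def] using lin'' by simp
    have 2: "H'' (x t) u w = (\<Sum>b\<in>Basis. (w \<bullet> b) *\<^sub>R H'' (x t) u b)" for u w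
      using linear_sum[OF lin2, of u "\<lambda>b. (w \<bullet> b) *\<^sub>R b" Basis]
      by (simp add: euclidean_representation linear_scale[OF lin2])
    show ?thesis
      unfolding 1[of x''] 2[of "x' t" "x' t"]
      by (simp add: sum.distrib scaleR_add_right scaleR_sum_right linear_scale[OF lin''] ac_simps)
  qed
  ultimately have d: "((\<lambda>s. \<Sum>b\<in>Basis. (x' s \<bullet> b) *\<^sub>R H' (x s) b) has_derivative
     (\<lambda>h. h *\<^sub>R (H'' (x t) (x' t) (x' t) + H' (x t) x''))) (at t)" by simp
  have "continuous (at t) x" using x(1) has_vector_derivative_continuous by blast
  then have "eventually (\<lambda>s. x s \<in> W) (at t)" "x t \<in> W"
    using W xt unfolding continuous_at by (auto simp: tendsto_def)
  then have ev: "eventually (\<lambda>s. x s \<in> W) (nhds t)" by (simp add: eventually_nhds_conv_at)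
  then obtain N where N: "open N" "t \<in> N" "\<And>s. s \<in> N \<Longrightarrow> x s \<in> W" unfolding eventually_nhds by blast
  have "((\<lambda>s. H' (x s) (x' s)) has_derivative (\<lambda>h. h *\<^sub>R (H'' (x t) (x' t) (x' t) + H' (x t) x''))) (at t)"
  proof (rule has_derivative_transform_within_open[OF d N(1,2)])
    fix s assume "s \<in> N"
    then have l: "linear (H' (x s))" using N(3) linH by blast
    show "(\<Sum>b\<in>Basis. (x' s \<bullet> b) *\<^sub>R H' (x s) b) = H' (x s) (x' s)"
      using linear_sum[OF l, of "\<lambda>b. (x' s \<bullet> b) *\<^sub>R b" Basis]
      by (simp add: euclidean_representation linear_scale[OF l])
  qed
  then show "((\<lambda>s. H' (x s) (x' s)) has_vector_derivative (H'' (x t) (x' t) (x' t) + H' (x t) x'')) (at t)"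
    by (simp add: has_vector_derivative_def)
qed

section \<open>The fibers of a geometrized block\<close>

text \<open>The last hypothesis says that the developed curve has no acceleration. Every chart sees
  \<open>x\<close> up to a lattice translation, which the periodic metric does not notice.\<close>

lemma (in torus_mfd) geodesic_straight:
  assumes h: "\<And>c y. c \<in> matlas T \<Longrightarrow> y \<in> cimg c \<Longrightarrow> h c y = G y"
    and per: "\<And>l x. l \<in> period_lattice \<Longrightarrow> G (x + l) = G x"
    and \<phi>: "C2_map W \<phi> \<phi>' \<phi>''" and G: "\<And>z v w. z \<in> W \<Longrightarrow> G z v w = \<phi>' z v \<bullet> \<phi>' z w"
    and inj: "\<And>z. z \<in> W \<Longrightarrow> inj (\<phi>' z :: 'e \<Rightarrow> 'e)"
    and I: "open I" and x: "\<And>t. t \<in> I \<Longrightarrow> x t \<in> W"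
      "\<And>t. t \<in> I \<Longrightarrow> (x has_vector_derivative x1 t) (at t)"
      "\<And>t. t \<in> I \<Longrightarrow> (x1 has_vector_derivative x2 t) (at t)"
      "\<And>t. t \<in> I \<Longrightarrow> \<phi>'' (x t) (x1 t) (x1 t) + \<phi>' (x t) (x2 t) = 0"
  shows "geodesic T h I (p \<circ> x)"
  unfolding geodesic_def
proof (intro conjI ballI)
  have "continuous_on I x" using x(2) by (meson continuous_at_imp_continuous_on has_vector_derivative_continuous)
  then show "continuous_map (top_of_set I) (mtop T) (p \<circ> x)"
    by (intro continuous_map_compose[OF _ continuous_param]) simp
  fix c assume c: "c \<in> matlas T"
  have W: "open W" using \<phi> by (simp add: C2_map_def)
  show "\<exists>x'. \<forall>t\<in>I. (p \<circ> x) t \<in> cdom c \<longrightarrow>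
        ((cmap c \<circ> (p \<circ> x)) has_vector_derivative x' t) (at t) \<and>
        (x' has_vector_derivative - christoffel (cimg c) (h c) (cmap c ((p \<circ> x) t)) (x' t) (x' t)) (at t)"
  proof (intro exI[of _ x1] ballI impI)
    fix t assume t: "t \<in> I" and ct: "(p \<circ> x) t \<in> cdom c"
    obtain l N where lN: "l \<in> period_lattice" "open N" "x t \<in> N" "\<And>z. z \<in> N \<Longrightarrow> p z \<in> cdom c"
      "\<And>z. z \<in> N \<Longrightarrow> cmap c (p z) = z + l"
      using chart_translation[OF c, of "x t"] ct by auto
    have oN: "open (I \<inter> x -` N)" using continuous_open_preimage[OF \<open>continuous_on I x\<close> I lN(2)] .
    have "((\<lambda>t. x t + l) has_vector_derivative x1 t) (at t)"
      using x(2)[OF t] by (auto intro!: derivative_eq_intros)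
    then have 1: "((cmap c \<circ> (p \<circ> x)) has_vector_derivative x1 t) (at t)"
      by (rule has_vector_derivative_transform_within_open[OF _ oN]) (use t lN in auto)
    let ?y = "x t + l"
    have y: "cmap c (p (x t)) = ?y" using lN by simp
    have yc: "?y \<in> cimg c" using chart_map_param(1)[OF c, of "x t"] ct y by simp
    \<comment> \<open>The chart reads the curve as x t + l, so the flat coordinates are shifted
      accordingly.\<close>
    define Wl where "Wl = (\<lambda>z. z - l) -` W"
    have \<phi>l: "C2_map Wl (\<lambda>z. \<phi> (z - l)) (\<lambda>z. \<phi>' (z - l)) (\<lambda>z. \<phi>'' (z - l))"
      unfolding C2_map_def
    proof (intro conjI ballI allI)
      show "open Wl" unfolding Wl_def by (intro open_vimage W continuous_intros)
      fix z v assume "z \<in> Wl"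
      then have "z - l \<in> W" by (simp add: Wl_def)
      then show "((\<lambda>z. \<phi> (z - l)) has_derivative \<phi>' (z - l)) (at z)"
        "((\<lambda>z. \<phi>' (z - l) v) has_derivative (\<lambda>u. \<phi>'' (z - l) u v)) (at z)"
        using \<phi> has_derivative_translate[of _ _ z "- l"] unfolding C2_map_def by auto
    qed
    have "\<phi>' (?y - l) (christoffel (cimg c) (h c) ?y (x1 t) (x1 t)) = \<phi>'' (?y - l) (x1 t) (x1 t)"
    proof (rule christoffel_flat[OF \<phi>l _ yc chart_img[OF c]])
      show "?y \<in> Wl" using x(1)[OF t] by (simp add: Wl_def)
      show "inj (\<phi>' (?y - l))" using inj[OF x(1)[OF t]] by simp
      fix z v w assume z: "z \<in> Wl" "z \<in> cimg c"
      have "h c z v w = G (z - l + l) v w" using h[OF c z(2)] by simp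
      also have "\<dots> = G (z - l) v w" by (simp only: per[OF lN(1)])
      finally show "h c z v w = \<phi>' (z - l) v \<bullet> \<phi>' (z - l) w" using G[of "z - l"] z(1) by (simp add: Wl_def)
    qed
    then have e: "\<phi>' (x t) (christoffel (cimg c) (h c) ?y (x1 t) (x1 t)) = \<phi>'' (x t) (x1 t) (x1 t)" by simp
    have lin: "linear (\<phi>' (x t))" using \<phi> x(1)[OF t] has_derivative_linear unfolding C2_map_def by blast
    have "\<phi>' (x t) (- christoffel (cimg c) (h c) ?y (x1 t) (x1 t)) = \<phi>' (x t) (x2 t)"
      using e x(4)[OF t] by (simp add: linear_neg[OF lin] add_eq_0_iff)
    then have "x2 t = - christoffel (cimg c) (h c) ?y (x1 t) (x1 t)"
      using injD[OF inj[OF x(1)[OF t]]] by metis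
    then show "((cmap c \<circ> (p \<circ> x)) has_vector_derivative x1 t) (at t) \<and>
        (x1 has_vector_derivative - christoffel (cimg c) (h c) (cmap c ((p \<circ> x) t)) (x1 t) (x1 t)) (at t)"
      using 1 x(3)[OF t] y by simp
  qed
qed

lemma affine_of_zero_acceleration:
  fixes y :: "real \<Rightarrow> 'a::real_normed_vector"
  assumes I: "open I" "is_interval I" "0 \<in> I" "t \<in> I"
    and y: "\<And>t. t \<in> I \<Longrightarrow> (y has_vector_derivative y1 t) (at t)" "\<And>t. t \<in> I \<Longrightarrow> (y1 has_vector_derivative 0) (at t)"
  shows "y t = y 0 + t *\<^sub>R y1 0"
proof -
  have conv: "convex I" using I(2) by (simp add: is_interval_convex)
  obtain c where c: "\<And>t. t \<in> I \<Longrightarrow> y1 t = c"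
    using has_vector_derivative_zero_constant[OF conv, of y1] has_vector_derivative_at_within[OF y(2)] by metis
  have "((\<lambda>t. y t - t *\<^sub>R c) has_vector_derivative 0) (at t within I)" if "t \<in> I" for t
  proof (rule has_vector_derivative_at_within)
    have "((\<lambda>t. t *\<^sub>R c) has_vector_derivative 1 *\<^sub>R c) (at t)"
      by (auto simp: has_vector_derivative_def intro!: derivative_eq_intros)
    from has_vector_derivative_diff[OF y(1)[OF that] this]
    show "((\<lambda>t. y t - t *\<^sub>R c) has_vector_derivative 0) (at t)" by (simp add: c[OF that])
  qed
  then obtain k where "\<And>t. t \<in> I \<Longrightarrow> y t - t *\<^sub>R c = k"
    using has_vector_derivative_zero_constant[OF conv, of "\<lambda>t. y t - t *\<^sub>R c"] by metis
  from this[OF I(4)] this[OF I(3)] c[OF I(3)] show ?thesis by (simp add: algebra_simps)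
qed

text \<open>The form of a boundary cover in a product chart: \<open>k\<close> is the boundary circle
  read in a chart of \<open>S\<close>, and the torus coordinates are only translated.\<close>

lemma C2_map_product_translation:
  fixes k :: "'a::euclidean_space \<Rightarrow> 'c::euclidean_space" and l :: "'e::euclidean_space"
  assumes k: "C2_map W k k' k''"
  shows "C2_map (W \<times> UNIV) (\<lambda>z. (k (fst z), snd z + l)) (\<lambda>z v. (k' (fst z) (fst v), snd v))
     (\<lambda>z u v. (k'' (fst z) (fst u) (fst v), 0))"
  unfolding C2_map_def
proof (intro conjI ballI allI)
  show "open (W \<times> (UNIV :: 'e set))" using k by (simp add: C2_map_def open_Times)
  fix z v :: "'a \<times> 'e" assume "z \<in> W \<times> UNIV"
  then have z: "fst z \<in> W" by auto
  have dk: "(k has_derivative k' (fst z)) (at (fst z))" "((\<lambda>z. k' z (fst v)) has_derivative (\<lambda>u. k'' (fst z) u (fst v))) (at (fst z))"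
    using k z by (auto simp: C2_map_def)
  have f: "(fst has_derivative fst) (at z)" by (auto intro!: derivative_eq_intros)
  have 1: "((\<lambda>z. k (fst z)) has_derivative (\<lambda>v. k' (fst z) (fst v))) (at z)"
    by (rule has_derivative_compose[where f = fst and f' = fst and g = k, OF f dk(1)])
  have 2: "((\<lambda>z. k' (fst z) (fst v)) has_derivative (\<lambda>u. k'' (fst z) (fst u) (fst v))) (at z)"
    by (rule has_derivative_compose[where f = fst and f' = fst and g = "\<lambda>z. k' z (fst v)", OF f dk(2)])
  show "((\<lambda>z. (k (fst z), snd z + l)) has_derivative (\<lambda>v. (k' (fst z) (fst v), snd v))) (at z)"
    using 1 by (auto intro!: derivative_eq_intros)
  show "((\<lambda>z. (k' (fst z) (fst v), snd v)) has_derivative (\<lambda>u. (k'' (fst z) (fst u) (fst v), 0))) (at z)"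
    using 2 by (auto intro!: derivative_eq_intros)
qed

lemma C2_map_cong:
  assumes "C2_map W H H' H''" "\<And>z. z \<in> W \<Longrightarrow> K z = H z"
  shows "C2_map W K H' H''"
  unfolding C2_map_def
proof (intro conjI ballI allI)
  show W: "open W" using assms(1) by (simp add: C2_map_def)
  fix y v assume y: "y \<in> W"
  have "(H has_derivative H' y) (at y)" using assms(1) y by (simp add: C2_map_def)
  then show "(K has_derivative H' y) (at y)"
    by (rule has_derivative_transform_within_open[OF _ W y]) (simp add: assms(2))
  show "((\<lambda>z. H' z v) has_derivative (\<lambda>u. H'' y u v)) (at y)" using assms(1) y by (simp add: C2_map_def)
qed

section \<open>Covers and metrics of boundary tori and fibers\<close>

locale geometrized_block =
  fixes S :: "('a, real^2) mfd" and I :: "int set" and \<kappa> :: "int \<Rightarrow> complex \<Rightarrow> 'a"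
    and gb :: "('a \<times> complex \<times> complex, (real^2) \<times> real \<times> real) metric"
  assumes smooth_S: "smooth_manifold S"
    and circles: "boundary_circles S I \<kappa>"
    and geometrization: "block_geometrization S I \<kappa> gb"
begin

definition bd_cover :: "int \<Rightarrow> real \<times> real \<times> real \<Rightarrow> 'a \<times> complex \<times> complex" where
  "bd_cover i = bd_param \<kappa> i \<circ> param3"

definition fiber_cover :: "'a \<Rightarrow> real \<times> real \<Rightarrow> 'a \<times> complex \<times> complex" where
  "fiber_cover s = fiber s \<circ> param2"

definition bd_metric :: "int \<Rightarrow> real \<times> real \<times> real \<Rightarrow> real \<times> real \<times> real \<Rightarrow> real \<times> real \<times> real \<Rightarrow> real" where
  "bd_metric i = cover_metric (block S) (bd_cover i) gb"

definition fiber_metric :: "'a \<Rightarrow> real \<times> real \<Rightarrow> real \<times> real \<Rightarrow> real \<times> real \<Rightarrow> real" where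
  "fiber_metric s = cover_metric (block S) (fiber_cover s) gb"

sublocale charted_S: charted S
  by (rule smooth_manifold_charted[OF smooth_S])

sublocale charted_block: charted "block S"
  unfolding block_def by (rule charted_prod_torus[OF charted_S.charted_axioms torus2.torus_mfd_axioms])

lemma riemannian: "riemannian_metric (block S) gb"
  using geometrization by (simp add: block_geometrization_def)

lemma fiber_cover_apply: "fiber_cover s x = (s, param2 x)"
  by (simp add: fiber_cover_def fiber_def)

lemma bd_cover_apply: "bd_cover i z = (\<kappa> i (cis (fst z)), param2 (snd z))"
  by (cases z) (simp add: bd_cover_def bd_param_def param3_def)

text \<open>The base point 1 of the circle has angle 0, so its fiber is the slice with first
  coordinate 0.\<close>

lemma bd_cover_fiber: "bd_cover i (0, x) = fiber_cover (\<kappa> i 1) x"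
  by (simp add: bd_cover_apply fiber_cover_apply)

lemma block_chartE:
  assumes "d \<in> matlas (block S)"
  obtains c1 c2 where "d = prod_chart c1 c2" "c1 \<in> matlas S" "c2 \<in> matlas torus2"
  using assms by (auto simp: block_def prod_mfd_def)

lemma circle_diffeo:
  assumes "i \<in> I"
  shows "bij_betw (\<kappa> i) (sphere 0 1) (\<kappa> i ` sphere 0 1)" "smooth_map_on circle (sphere 0 1) S (\<kappa> i)"
    "smooth_map_on S (\<kappa> i ` sphere 0 1) circle (the_inv_into (sphere 0 1) (\<kappa> i))"
proof -
  have "diffeo_betw circle (sphere 0 1) S (\<kappa> i ` sphere 0 1) (\<kappa> i)"
    using circles assms unfolding boundary_circles_def by blast
  then show "bij_betw (\<kappa> i) (sphere 0 1) (\<kappa> i ` sphere 0 1)" "smooth_map_on circle (sphere 0 1) S (\<kappa> i)"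
    "smooth_map_on S (\<kappa> i ` sphere 0 1) circle (the_inv_into (sphere 0 1) (\<kappa> i))"
    by (simp_all add: diffeo_betw_def)
qed

lemma continuous_circle: "i \<in> I \<Longrightarrow> continuous_map (top_of_set (sphere 0 1)) (mtop S) (\<kappa> i)"
  using circle_diffeo(2)[of i] by (simp add: smooth_map_on_def circle_def subtopology_subtopology)

lemma circle_C2:
  assumes i: "i \<in> I" and c: "c \<in> matlas S" "\<kappa> i (cis t0) \<in> cdom c"
  obtains W k' k'' where "t0 \<in> W" "C2_map W (\<lambda>t. cmap c (\<kappa> i (cis t))) k' k''" "\<And>t. t \<in> W \<Longrightarrow> \<kappa> i (cis t) \<in> cdom c"
proof -
  obtain a where a: "a \<in> matlas circle" "t0 \<in> cimg a" using circle.chart_at by blast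
  have L: "loc_dom a c (sphere 0 1) (\<kappa> i) = cimg a \<inter> {t. (\<kappa> i \<circ> cis) t \<in> cdom c}"
    unfolding loc_dom_def circle.chart_dom_eq[OF a(1)] using circle.chart_map[OF a(1)] by force
  have rep: "loc_rep a c (\<kappa> i) t = cmap c (\<kappa> i (cis t))" if "t \<in> cimg a" for t
    using circle.chart_inverse[OF a(1) that] by (simp add: loc_rep_def)
  have "continuous_map euclidean (top_of_set (sphere 0 1)) cis"
    using circle.continuous_param by (simp add: circle_def)
  then have cont: "continuous_map euclidean (mtop S) (\<kappa> i \<circ> cis)"
    using continuous_map_compose continuous_circle[OF i] by blast
  have op: "open (loc_dom a c (sphere 0 1) (\<kappa> i))" unfolding L
    using circle.chart_img[OF a(1)] open_preimage_continuous_map[OF cont charted_S.dom_open[OF c(1)]] by blast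
  have "smooth_on (loc_dom a c (sphere 0 1) (\<kappa> i)) (loc_rep a c (\<kappa> i))"
    using circle_diffeo(2)[OF i] a(1) c(1) by (simp add: smooth_map_on_def)
  then obtain W where W: "open W" "t0 \<in> W" "W \<subseteq> loc_dom a c (sphere 0 1) (\<kappa> i)" "\<And>n. Ck_on n W (loc_rep a c (\<kappa> i))"
    by (rule smooth_on_open[OF _ op]) (use a c L in auto)
  have "C2_map W (\<lambda>t. cmap c (\<kappa> i (cis t))) (\<lambda>y. frechet_derivative (loc_rep a c (\<kappa> i)) (at y))
     (\<lambda>y u v. frechet_derivative (\<lambda>z. frechet_derivative (loc_rep a c (\<kappa> i)) (at z) v) (at y) u)"
    by (rule C2_map_cong[OF Ck_on_C2_map[OF W(1) W(4)]]) (use W(3) L rep in auto)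
  then show ?thesis by (rule that[OF W(2)]) (use W(3) L in auto)
qed

lemma bd_cover_C2:
  assumes i: "i \<in> I" and d: "d \<in> matlas (block S)" "bd_cover i y0 \<in> cdom d"
  obtains W K' K'' where "y0 \<in> W" "C2_map W (cmap d \<circ> bd_cover i) K' K''" "\<And>y. y \<in> W \<Longrightarrow> bd_cover i y \<in> cdom d"
proof -
  obtain c1 c2 where c: "d = prod_chart c1 c2" "c1 \<in> matlas S" "c2 \<in> matlas torus2"
    using block_chartE[OF d(1)] .
  have y: "\<kappa> i (cis (fst y0)) \<in> cdom c1" "param2 (snd y0) \<in> cdom c2" using d(2) by (auto simp: c(1) bd_cover_apply)
  obtain W k' k'' where W: "fst y0 \<in> W" "C2_map W (\<lambda>t. cmap c1 (\<kappa> i (cis t))) k' k''" "\<And>t. t \<in> W \<Longrightarrow> \<kappa> i (cis t) \<in> cdom c1"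
    using circle_C2[OF i c(2) y(1)] by metis
  obtain l N where lN: "l \<in> period_lattice" "open N" "snd y0 \<in> N" "\<And>z. z \<in> N \<Longrightarrow> param2 z \<in> cdom c2"
    "\<And>z. z \<in> N \<Longrightarrow> cmap c2 (param2 z) = z + l" using torus2.chart_translation[OF c(3) y(2)] by metis
  have "open W" using W(2) by (simp add: C2_map_def)
  have "C2_map (W \<times> N) (\<lambda>z. (cmap c1 (\<kappa> i (cis (fst z))), snd z + l)) (\<lambda>z v. (k' (fst z) (fst v), snd v))
     (\<lambda>z u v. (k'' (fst z) (fst u) (fst v), 0))"
    by (rule C2_map_subset[OF C2_map_product_translation[OF W(2)]]) (use \<open>open W\<close> lN(2) open_Times in auto)
  then have C2: "C2_map (W \<times> N) (cmap d \<circ> bd_cover i) (\<lambda>z v. (k' (fst z) (fst v), snd v))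
     (\<lambda>z u v. (k'' (fst z) (fst u) (fst v), 0))"
    by (rule C2_map_cong) (use lN(5) in \<open>auto simp: c(1) bd_cover_apply\<close>)
  have y0: "y0 \<in> W \<times> N" using W(1) lN(3) by (cases y0) auto
  show ?thesis by (rule that[OF y0 C2]) (use W(3) lN(4) in \<open>auto simp: c(1) bd_cover_apply\<close>)
qed

lemma continuous_bd_param: "i \<in> I \<Longrightarrow> continuous_map (mtop torus3) (mtop (block S)) (bd_param \<kappa> i)"
  using continuous_circle[of i]
  by (auto simp: torus3_def block_def prod_mfd_def bd_param_def map_prod_def circle_def id_def intro!: continuous_map_prod_top[THEN iffD2])

lemma continuous_fiber:
  assumes "s \<in> topspace (mtop S)"
  shows "continuous_map (mtop torus2) (mtop (block S)) (fiber s)"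
  using assms by (auto simp: block_def prod_mfd_def fiber_def[abs_def] intro!: continuous_map_pairedI)

lemma bd_cover_differentiable:
  assumes i: "i \<in> I" shows "chart_differentiable (block S) (bd_cover i)"
  unfolding chart_differentiable_def
proof (intro conjI allI ballI impI)
  show "continuous_map euclidean (mtop (block S)) (bd_cover i)"
    unfolding bd_cover_def using continuous_map_compose[OF torus3.continuous_param continuous_bd_param[OF i]] .
  fix y d assume "d \<in> matlas (block S)" "bd_cover i y \<in> cdom d"
  then obtain W K' K'' where "y \<in> W" "C2_map W (cmap d \<circ> bd_cover i) K' K''" using bd_cover_C2[OF i] by metis
  then show "(cmap d \<circ> bd_cover i) differentiable (at y)" unfolding C2_map_def differentiable_def by blast
qed

lemma fiber_cover_derivative:
  assumes d: "d \<in> matlas (block S)" "fiber_cover s y \<in> cdom d"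
  shows "((cmap d \<circ> fiber_cover s) has_derivative (\<lambda>v. (0, v))) (at y)"
proof -
  obtain c1 c2 where c: "d = prod_chart c1 c2" "c1 \<in> matlas S" "c2 \<in> matlas torus2"
    using block_chartE[OF d(1)] .
  have y: "param2 y \<in> cdom c2" using d(2) by (auto simp: c(1) fiber_cover_apply)
  obtain l N where lN: "l \<in> period_lattice" "open N" "y \<in> N" "\<And>z. z \<in> N \<Longrightarrow> param2 z \<in> cdom c2"
    "\<And>z. z \<in> N \<Longrightarrow> cmap c2 (param2 z) = z + l" using torus2.chart_translation[OF c(3) y] by metis
  have "((\<lambda>z. (cmap c1 s, z + l)) has_derivative (\<lambda>v. (0, v))) (at y)"
    by (auto intro!: derivative_eq_intros)
  then show ?thesis
    by (rule has_derivative_transform_within_open[OF _ lN(2,3)]) (simp add: c(1) fiber_cover_apply lN(5))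
qed

lemma fiber_cover_differentiable:
  assumes s: "s \<in> topspace (mtop S)" shows "chart_differentiable (block S) (fiber_cover s)"
  unfolding chart_differentiable_def
proof (intro conjI allI ballI impI)
  show "continuous_map euclidean (mtop (block S)) (fiber_cover s)"
    unfolding fiber_cover_def using continuous_map_compose[OF torus2.continuous_param continuous_fiber[OF s]] .
qed (use fiber_cover_derivative differentiable_def in blast)

lemma circle_point: "i \<in> I \<Longrightarrow> norm z = 1 \<Longrightarrow> \<kappa> i z \<in> topspace (mtop S)"
  using continuous_circle[of i] by (auto simp: continuous_map_def)

lemma param_shift: "l \<in> period_lattice \<Longrightarrow> param2 (x + l) = param2 x"
  using torus2.param_eq_iff by simp

lemma param3_shift: "l \<in> period_lattice \<Longrightarrow> param3 (x + l) = param3 x"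
  using torus3.param_eq_iff by simp

lemma cover_metric_periodic:
  assumes "chart_differentiable (block S) \<theta>" and "\<And>x. \<theta> (x + l) = \<theta> x"
  shows "cover_metric (block S) \<theta> gb (x + l) = cover_metric (block S) \<theta> gb x"
proof (intro ext)
  fix v w
  have "((\<lambda>x. x + l) has_derivative (\<lambda>v. v)) (at x)" by (auto intro!: derivative_eq_intros)
  from charted_block.cover_metric_compose[OF assms(1) this, of gb v w]
  show "cover_metric (block S) \<theta> gb (x + l) v w = cover_metric (block S) \<theta> gb x v w"
    using assms(2) by (simp add: o_def)
qed

lemma bd_metric_periodic: "i \<in> I \<Longrightarrow> l \<in> period_lattice \<Longrightarrow> bd_metric i (x + l) = bd_metric i x"
  unfolding bd_metric_def
  by (intro cover_metric_periodic bd_cover_differentiable) (simp_all add: bd_cover_def param3_shift)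

lemma fiber_metric_periodic: "s \<in> topspace (mtop S) \<Longrightarrow> l \<in> period_lattice \<Longrightarrow> fiber_metric s (x + l) = fiber_metric s x"
  unfolding fiber_metric_def
  by (intro cover_metric_periodic fiber_cover_differentiable) (simp_all add: fiber_cover_def param_shift)

lemma pullback_bd_metric:
  assumes "i \<in> I" "c \<in> matlas torus3" "y \<in> cimg c"
  shows "pullback torus3 (block S) (bd_param \<kappa> i) gb c y = bd_metric i y"
  unfolding bd_metric_def bd_cover_def
  by (intro ext torus3.pullback_cover_metric charted_block.charted_axioms assms continuous_bd_param)

lemma pullback_fiber_metric:
  assumes "s \<in> topspace (mtop S)" "c \<in> matlas torus2" "y \<in> cimg c"
  shows "pullback torus2 (block S) (fiber s) gb c y = fiber_metric s y"
  unfolding fiber_metric_def fiber_cover_def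
  by (intro ext torus2.pullback_cover_metric charted_block.charted_axioms assms continuous_fiber)

lemma flat_bd: "i \<in> I \<Longrightarrow> flat torus3 (pullback torus3 (block S) (bd_param \<kappa> i) gb)"
  and flat_fiber: "s \<in> topspace (mtop S) \<Longrightarrow> flat torus2 (pullback torus2 (block S) (fiber s) gb)"
  and geodesic_fiber: "s \<in> topspace (mtop S) \<Longrightarrow> totally_geodesic torus2 (block S) gb (fiber s)"
  using geometrization by (auto simp: block_geometrization_def)

lemma flat_torus_bd: assumes "i \<in> I" obtains D where "flat_torus (bd_metric i) D"
  using torus3.flat_torus_exists[OF flat_bd[OF assms] pullback_bd_metric[OF assms] bd_metric_periodic[OF assms]] .

lemma flat_torus_fiber: assumes "s \<in> topspace (mtop S)" obtains D where "flat_torus (fiber_metric s) D"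
  using torus2.flat_torus_exists[OF flat_fiber[OF assms] pullback_fiber_metric[OF assms] fiber_metric_periodic[OF assms]] .

lemma bd_metric_chart:
  assumes "i \<in> I" "d \<in> matlas (block S)" "bd_cover i y \<in> cdom d" "((cmap d \<circ> bd_cover i) has_derivative K') (at y)"
  shows "bd_metric i y v w = gb d (cmap d (bd_cover i y)) (K' v) (K' w)"
  unfolding bd_metric_def
  by (rule charted_block.cover_metric_chart[OF riemannian bd_cover_differentiable[OF assms(1)] assms(2-4)])

lemma fiber_metric_chart:
  assumes "s \<in> topspace (mtop S)" "d \<in> matlas (block S)" "fiber_cover s y \<in> cdom d"
  shows "fiber_metric s y v w = gb d (cmap d (fiber_cover s y)) (0, v) (0, w)"
  unfolding fiber_metric_def
  by (rule charted_block.cover_metric_chart[OF riemannian fiber_cover_differentiable[OF assms(1)] assms(2-3)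
      fiber_cover_derivative[OF assms(2,3)]])

lemma bd_metric_fiber:
  assumes i: "i \<in> I"
  shows "bd_metric i (0, x) (0, v) (0, w) = fiber_metric (\<kappa> i 1) x v w"
proof -
  have "((\<lambda>x. (0, x)) has_derivative (\<lambda>v. (0::real, v))) (at x)" by (auto intro!: derivative_eq_intros)
  from charted_block.cover_metric_compose[OF bd_cover_differentiable[OF i] this, of gb v w]
  show ?thesis unfolding bd_metric_def fiber_metric_def by (simp add: o_def bd_cover_fiber)
qed

end

lemma Ck_on_differentiable:
  assumes "Ck_on 2 W f" "open W" "x \<in> W"
  shows "(f has_derivative frechet_derivative f (at x)) (at x)"
  using assms by (simp add: numeral_2_eq_2 differentiable_on_eq_differentiable_at frechet_derivative_works)

section \<open>Fibers are straight in the boundary tori\<close>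

context geometrized_block
begin

text \<open>A fiber geodesic is a geodesic of the block, so its acceleration there vanishes. The
  part tangent to the boundary torus depends only on the induced metric and can equally be computed
  in the flat coordinates \<open>\<phi>3\<close>, where it is the whole acceleration.\<close>

lemma fiber_straight_in_boundary:
  assumes i: "i \<in> I" and W3: "C2_map W3 \<phi>3 \<phi>3' \<phi>3''"
    and G3: "\<And>z v w. z \<in> W3 \<Longrightarrow> bd_metric i z v w = \<phi>3' z v \<bullet> \<phi>3' z w"
    and surj: "\<And>z. z \<in> W3 \<Longrightarrow> surj (\<phi>3' z)"
    and d: "d \<in> matlas (block S)" and WK: "C2_map WK (cmap d \<circ> bd_cover i) K' K''" "\<And>z. z \<in> WK \<Longrightarrow> bd_cover i z \<in> cdom d"
    and J: "open J" "is_interval J" and geod: "geodesic torus2 (pullback torus2 (block S) (fiber (\<kappa> i 1)) gb) J (param2 \<circ> x)"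
    and x: "\<And>t. t \<in> J \<Longrightarrow> (0, x t) \<in> W3 \<inter> WK"
      "\<And>t. t \<in> J \<Longrightarrow> (x has_vector_derivative x1 t) (at t)"
      "\<And>t. t \<in> J \<Longrightarrow> (x1 has_vector_derivative x2 t) (at t)"
    and t: "t \<in> J"
  shows "((\<lambda>t. \<phi>3 (0, x t)) has_vector_derivative \<phi>3' (0, x t) (0, x1 t)) (at t)"
    and "((\<lambda>t. \<phi>3' (0, x t) (0, x1 t)) has_vector_derivative 0) (at t)"
proof -
  let ?s = "\<kappa> i 1"
  let ?\<Gamma> = "christoffel (cimg d) (gb d)"
  have s: "?s \<in> topspace (mtop S)" by (rule circle_point[OF i]) simp
  have "geodesic (block S) gb J (fiber ?s \<circ> (param2 \<circ> x))"
    using geodesic_fiber[OF s] J geod unfolding totally_geodesic_def by blast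
  then obtain X' where X': "\<And>t. t \<in> J \<Longrightarrow> (fiber ?s \<circ> (param2 \<circ> x)) t \<in> cdom d \<Longrightarrow>
        ((cmap d \<circ> (fiber ?s \<circ> (param2 \<circ> x))) has_vector_derivative X' t) (at t) \<and>
        (X' has_vector_derivative - ?\<Gamma> (cmap d ((fiber ?s \<circ> (param2 \<circ> x)) t)) (X' t) (X' t)) (at t)"
    using d unfolding geodesic_def by meson
  have pt: "(fiber ?s \<circ> (param2 \<circ> x)) t = bd_cover i (0, x t)" for t
    by (simp add: bd_cover_fiber fiber_cover_def)
  define K where "K = cmap d \<circ> bd_cover i"
  have curve: "cmap d \<circ> (fiber ?s \<circ> (param2 \<circ> x)) = (\<lambda>t. K (0, x t))"
    by (simp add: fun_eq_iff K_def bd_cover_fiber fiber_cover_def)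
  have jx: "((\<lambda>t. (0::real, x t)) has_vector_derivative (0, x1 t)) (at t)"
    and jx1: "((\<lambda>t. (0::real, x1 t)) has_vector_derivative (0, x2 t)) (at t)" if "t \<in> J" for t
    using x(2,3)[OF that] by (auto intro!: has_vector_derivative_Pair has_vector_derivative_const)
  have W3t: "(0, x t) \<in> W3" and WKt: "(0, x t) \<in> WK" if "t \<in> J" for t using x(1)[OF that] by auto
  note K_along = C2_map_along[OF WK(1)[folded K_def], of "\<lambda>t. (0, x t)" _ "\<lambda>t. (0, x1 t)"]
  have X'_eq: "X' t = K' (0, x t) (0, x1 t)"
    and X'_der: "(X' has_vector_derivative - ?\<Gamma> (K (0, x t)) (X' t) (X' t)) (at t)" if "t \<in> J" for t
  proof -
    have c: "(fiber ?s \<circ> (param2 \<circ> x)) t \<in> cdom d" unfolding pt using WK(2) WKt[OF that] by blast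
    have "((\<lambda>t. K (0, x t)) has_vector_derivative X' t) (at t)" using X'[OF that c] unfolding curve by blast
    moreover have "((\<lambda>t. K (0, x t)) has_vector_derivative K' (0, x t) (0, x1 t)) (at t)"
      using K_along(1)[OF WKt[OF that] jx[OF that] jx1[OF that]] .
    ultimately show "X' t = K' (0, x t) (0, x1 t)" using vector_derivative_unique_at by blast
    show "(X' has_vector_derivative - ?\<Gamma> (K (0, x t)) (X' t) (X' t)) (at t)"
      using X'[OF that c] unfolding pt by (simp add: K_def)
  qed
  let ?v = "(0, x1 t)" and ?a = "(0, x2 t)" and ?z = "(0, x t)"
  \<comment> \<open>The geodesic equation in the block, rewritten with the second derivatives of the
    boundary cover.\<close>
  have acc: "- ?\<Gamma> (K ?z) (K' ?z ?v) (K' ?z ?v) = K'' ?z ?v ?v + K' ?z ?a"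
  proof -
    have "((\<lambda>t. K' (0, x t) (0, x1 t)) has_vector_derivative (K'' ?z ?v ?v + K' ?z ?a)) (at t)"
      using K_along(2)[OF WKt[OF t] jx[OF t] jx1[OF t]] .
    moreover have "((\<lambda>t. K' (0, x t) (0, x1 t)) has_vector_derivative - ?\<Gamma> (K ?z) (X' t) (X' t)) (at t)"
      by (rule has_vector_derivative_transform_within_open[OF X'_der[OF t] J(1) t]) (rule X'_eq)
    ultimately show ?thesis unfolding X'_eq[OF t] using vector_derivative_unique_at by blast
  qed
  note \<phi>_along = C2_map_along[OF W3, of "\<lambda>t. (0, x t)" t "\<lambda>t. (0, x1 t)" ?a, OF W3t[OF t] jx[OF t] jx1[OF t]]
  show "((\<lambda>t. \<phi>3 (0, x t)) has_vector_derivative \<phi>3' (0, x t) (0, x1 t)) (at t)" by (rule \<phi>_along(1))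
  define W where "W = W3 \<inter> WK"
  have zW: "?z \<in> W" using x(1)[OF t] by (simp add: W_def)
  have oW: "open W" using W3 WK(1) by (auto simp: W_def C2_map_def)
  have C1: "C2_map W \<phi>3 \<phi>3' \<phi>3''" and C2: "C2_map W K K' K''"
    using C2_map_subset[OF W3 oW] C2_map_subset[OF WK(1) oW] by (auto simp: W_def K_def)
  have con: "connection (cimg d) (gb d) (\<lambda>x u a b. dderiv (cimg d) (\<lambda>y. gb d y a b) x u) ?\<Gamma>"
    by (rule charted_block.connection_chart[OF riemannian d])
  have KW: "K ` W \<subseteq> cimg d" 
  proof (rule image_subsetI)
    show "K z \<in> cimg d" if "z \<in> W" for z
      using charted_block.img_chart[OF WK(2)[of z]] that by (simp add: K_def W_def)
  qed
  have metric: "\<phi>3' z v \<bullet> \<phi>3' z w = gb d (K z) (K' z v) (K' z w)" if "z \<in> W" for z v w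
  proof -
    have "bd_metric i z v w = gb d (cmap d (bd_cover i z)) (K' z v) (K' z w)"
      by (rule bd_metric_chart[OF i d]) (use that WK in \<open>auto simp: W_def C2_map_def\<close>)
    then show ?thesis using G3[of z] that by (simp add: W_def K_def)
  qed
  have "\<phi>3'' ?z ?v ?v + \<phi>3' ?z ?a = 0"
  proof -
    have "(\<phi>3'' ?z ?v ?v + \<phi>3' ?z ?a) \<bullet> \<phi>3' ?z w = 0" for w
    proof -
      have bil: "bilinear (gb d (K ?z))" using connection.bilinear[OF con] KW zW by blast
      have "(0 + \<phi>3'' ?z ?v ?v) \<bullet> \<phi>3' ?z w = gb d (K ?z) (?\<Gamma> (K ?z) (K' ?z ?v) (K' ?z ?v) + K'' ?z ?v ?v) (K' ?z w)"
        by (rule koszul_two_embeddings[OF connection_euclidean C1 _ con C2 KW metric zW]) simp_all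
      then have "(\<phi>3'' ?z ?v ?v + \<phi>3' ?z ?a) \<bullet> \<phi>3' ?z w
         = gb d (K ?z) (?\<Gamma> (K ?z) (K' ?z ?v) (K' ?z ?v) + K'' ?z ?v ?v + K' ?z ?a) (K' ?z w)"
        using metric[OF zW, of ?a w] by (simp add: inner_add_left bilinear_ladd[OF bil])
      also have "?\<Gamma> (K ?z) (K' ?z ?v) (K' ?z ?v) + K'' ?z ?v ?v + K' ?z ?a = 0"
        unfolding add.assoc acc[symmetric] by simp
      finally show ?thesis by (simp add: bilinear_lzero[OF bil])
    qed
    then have "(\<phi>3'' ?z ?v ?v + \<phi>3' ?z ?a) \<bullet> u = 0" for u using surj[OF W3t[OF t]] by (metis surjD)
    then show ?thesis by (metis inner_eq_zero_iff)
  qed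
  then show "((\<lambda>t. \<phi>3' (0, x t) (0, x1 t)) has_vector_derivative 0) (at t)" using \<phi>_along(2) by simp
qed

text \<open>Straight segments issuing from a point of the developed fiber go to straight segments in
  the developed boundary torus, with initial velocity depending linearly on the direction. Following
  each for unit time gives an affine map.\<close>

lemma fiber_affine_local:
  assumes i: "i \<in> I" and D2: "developing (fiber_metric (\<kappa> i 1)) UNIV D2" and D3: "developing (bd_metric i) UNIV D3"
  obtains U A b where "open U" "x0 \<in> U" "linear A" "\<And>x. x \<in> U \<Longrightarrow> D3 (0, x) = A (D2 x) + b"
proof -
  let ?s = "\<kappa> i 1"
  have s: "?s \<in> topspace (mtop S)" by (rule circle_point[OF i]) simp
  obtain W2 V2 \<phi>2 \<sigma>2 where F2: "x0 \<in> W2" "developing (fiber_metric ?s) W2 \<phi>2" "open V2"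
    "homeomorphism W2 V2 \<phi>2 \<sigma>2" "Ck_on 2 W2 \<phi>2" "Ck_on 2 V2 \<sigma>2"
    "\<And>y v w. y \<in> W2 \<Longrightarrow> fiber_metric ?s y v w = frechet_derivative \<phi>2 (at y) v \<bullet> frechet_derivative \<phi>2 (at y) w"
    using torus2.flat_local_developing[OF flat_fiber[OF s] pullback_fiber_metric[OF s], of x0] by metis
  obtain W3 V3 \<phi>3 \<sigma>3 where F3: "(0, x0) \<in> W3" "developing (bd_metric i) W3 \<phi>3" "open V3"
    "homeomorphism W3 V3 \<phi>3 \<sigma>3" "Ck_on 2 W3 \<phi>3" "Ck_on 2 V3 \<sigma>3"
    "\<And>y v w. y \<in> W3 \<Longrightarrow> bd_metric i y v w = frechet_derivative \<phi>3 (at y) v \<bullet> frechet_derivative \<phi>3 (at y) w"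
    using torus3.flat_local_developing[OF flat_bd[OF i] pullback_bd_metric[OF i], of "(0, x0)"] by metis
  have oW2: "open W2" and oW3: "open W3" using F2(2) F3(2) developing_open by blast+
  define \<phi>2' where "\<phi>2' y = frechet_derivative \<phi>2 (at y)" for y
  define \<phi>2'' where "\<phi>2'' y u v = frechet_derivative (\<lambda>z. frechet_derivative \<phi>2 (at z) v) (at y) u" for y u v
  define \<phi>3' where "\<phi>3' y = frechet_derivative \<phi>3 (at y)" for y
  define \<phi>3'' where "\<phi>3'' y u v = frechet_derivative (\<lambda>z. frechet_derivative \<phi>3 (at z) v) (at y) u" for y u v
  define \<sigma>' where "\<sigma>' y = frechet_derivative \<sigma>2 (at y)" for y
  define \<sigma>'' where "\<sigma>'' y u v = frechet_derivative (\<lambda>z. frechet_derivative \<sigma>2 (at z) v) (at y) u" for y u v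
  have C\<phi>2: "C2_map W2 \<phi>2 \<phi>2' \<phi>2''" and C\<phi>3: "C2_map W3 \<phi>3 \<phi>3' \<phi>3''" and C\<sigma>: "C2_map V2 \<sigma>2 \<sigma>' \<sigma>''"
    using Ck_on_C2_map[OF oW2 F2(5)] Ck_on_C2_map[OF oW3 F3(5)] Ck_on_C2_map[OF F2(3) F2(6)]
    unfolding \<phi>2'_def[abs_def] \<phi>2''_def[abs_def] \<phi>3'_def[abs_def] \<phi>3''_def[abs_def] \<sigma>'_def[abs_def] \<sigma>''_def[abs_def] by auto
  have inj_lin: "linear (frechet_derivative \<phi> (at z)) \<and> inj (frechet_derivative \<phi> (at z))"
    if "developing G W \<phi>" "Ck_on 2 W \<phi>" "z \<in> W"
      "\<And>v w. G z v w = frechet_derivative \<phi> (at z) v \<bullet> frechet_derivative \<phi> (at z) w"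
    for G W z and \<phi> :: "'e::euclidean_space \<Rightarrow> 'e"
  proof
    show l: "linear (frechet_derivative \<phi> (at z))"
      using Ck_on_differentiable[OF that(2) developing_open[OF that(1)] that(3)] has_derivative_linear by blast
    have "frechet_derivative \<phi> (at z) v \<noteq> 0" if "v \<noteq> 0" for v
    proof -
      have "G z v v > 0" using \<open>developing G W \<phi>\<close> \<open>z \<in> W\<close> that unfolding developing_def by blast
      then show ?thesis using \<open>\<And>v w. G z v w = _ v w\<close>[of v v] by auto
    qed
    then show "inj (frechet_derivative \<phi> (at z))" using linear_injective_0[OF l] by blast
  qed
  have inj2: "linear (\<phi>2' z)" "inj (\<phi>2' z)" if "z \<in> W2" for z
    using inj_lin[OF F2(2,5) that F2(7)[OF that]] by (simp_all add: \<phi>2'_def)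
  have surj3: "surj (\<phi>3' z)" if "z \<in> W3" for z
    using inj_lin[OF F3(2,5) that F3(7)[OF that]] linear_injective_imp_surjective[of "frechet_derivative \<phi>3 (at z)"] by (simp add: \<phi>3'_def)
  have bt: "bd_cover i (0, x0) \<in> topspace (mtop (block S))"
    using bd_cover_differentiable[OF i] by (auto simp: chart_differentiable_def continuous_map_def)
  obtain d where d: "d \<in> matlas (block S)" "bd_cover i (0, x0) \<in> cdom d"
    using charted_block.dom_cover bt by blast
  obtain WK K' K'' where WK: "(0, x0) \<in> WK" "C2_map WK (cmap d \<circ> bd_cover i) K' K''" "\<And>y. y \<in> WK \<Longrightarrow> bd_cover i y \<in> cdom d"
    using bd_cover_C2[OF i d] by metis
  have oWK: "open WK" using WK(2) by (simp add: C2_map_def)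
  define y0 where "y0 = \<phi>2 x0"
  have y0: "y0 \<in> V2" "\<sigma>2 y0 = x0" using F2(1,4) by (auto simp: y0_def homeomorphism_def)
  have c\<sigma>: "continuous_on V2 \<sigma>2" using F2(4) by (simp add: homeomorphism_def)
  \<comment> \<open>Developed fiber points at which both the flat coordinates and the chosen chart
    of the block are available.\<close>
  define Q where "Q = V2 \<inter> (\<lambda>y. (0::real, \<sigma>2 y)) -` (W3 \<inter> WK)"
  have "continuous_on V2 (\<lambda>y. (0::real, \<sigma>2 y))" by (intro continuous_intros c\<sigma>)
  then have "open Q" unfolding Q_def using continuous_open_preimage[OF _ F2(3)] oW3 oWK by blast
  moreover have "y0 \<in> Q" using y0 F3(1) WK(1) by (simp add: Q_def)
  ultimately obtain r where r: "r > 0" "ball y0 r \<subseteq> Q" using open_contains_ball by blast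
  have \<phi>\<sigma>: "\<phi>2 (\<sigma>2 y) = y" "\<sigma>2 y \<in> W2" if "y \<in> V2" for y using F2(4) that by (auto simp: homeomorphism_def)
  \<comment> \<open>The differential, at the base point, of the fiber inclusion in developed
    coordinates.\<close>
  define A where "A v = \<phi>3' (0, x0) (0, \<sigma>' y0 v)" for v
  have linA: "linear A"
  proof -
    have 1: "linear (\<sigma>' y0)" using C\<sigma> y0(1) has_derivative_linear unfolding C2_map_def by blast
    have 2: "linear (\<phi>3' (0, x0))" using C\<phi>3 F3(1) has_derivative_linear unfolding C2_map_def by blast
    have 3: "linear (\<lambda>v. (0::real, v :: real \<times> real))" by (intro linearI) auto
    show ?thesis
      using linear_compose[OF linear_compose[OF 1 3] 2] unfolding A_def[abs_def] by (simp add: o_def)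
  qed
  have aff: "\<phi>3 (0, \<sigma>2 (y0 + v)) = \<phi>3 (0, x0) + A v" if v: "norm v < r" for v
  proof (cases "v = 0")
    case True
    then show ?thesis using y0 linear_0[OF linA] by simp
  next
    case False
    \<comment> \<open>The times for which the segment stays in the ball; 1 is among them because
      \<open>v\<close> is shorter than \<open>r\<close>.\<close>
    define J where "J = {- (r / norm v)<..<r / norm v}"
    have "r / norm v > 1" using False v by (simp add: pos_less_divide_eq)
    then have J: "open J" "is_interval J" "0 \<in> J" "1 \<in> J"
      by (auto simp: J_def is_interval_oo)
    have JQ: "y0 + t *\<^sub>R v \<in> Q" if "t \<in> J" for t
    proof -
      have "\<bar>t\<bar> < r / norm v" using that by (auto simp: J_def)
      then have "\<bar>t\<bar> * norm v < r" using False by (simp add: pos_less_divide_eq)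
      then have "y0 + t *\<^sub>R v \<in> ball y0 r" by (simp add: dist_norm)
      then show ?thesis using r(2) by blast
    qed
    define x where "x t = \<sigma>2 (y0 + t *\<^sub>R v)" for t
    define x1 where "x1 t = \<sigma>' (y0 + t *\<^sub>R v) v" for t
    define x2 where "x2 t = \<sigma>'' (y0 + t *\<^sub>R v) v v" for t
    have line: "((\<lambda>t. y0 + t *\<^sub>R v) has_vector_derivative v) (at t)" for t
      by (auto simp: has_vector_derivative_def intro!: derivative_eq_intros)
    have cst: "((\<lambda>t. v) has_vector_derivative 0) (at t)" for t :: real by simp
    have JV: "y0 + t *\<^sub>R v \<in> V2" if "t \<in> J" for t using JQ[OF that] by (simp add: Q_def)
    have lin\<sigma>: "linear (\<sigma>' (y0 + t *\<^sub>R v))" if "t \<in> J" for t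
      using C\<sigma> JV[OF that] has_derivative_linear unfolding C2_map_def by blast
    have xd: "(x has_vector_derivative x1 t) (at t)" "(x1 has_vector_derivative x2 t) (at t)" if "t \<in> J" for t
      using C2_map_along[OF C\<sigma>, of "\<lambda>t. y0 + t *\<^sub>R v" t "\<lambda>t. v", OF JV[OF that] line cst]
      by (simp_all add: x_def[abs_def] x1_def[abs_def] x2_def linear_0[OF lin\<sigma>[OF that]])
    have xW2: "x t \<in> W2" and \<phi>x: "\<phi>2 (x t) = y0 + t *\<^sub>R v" if "t \<in> J" for t
      using \<phi>\<sigma>[OF JV[OF that]] by (simp_all add: x_def)
    have speed: "\<phi>2' (x t) (x1 t) = v" if "t \<in> J" for t
    proof -
      have "((\<lambda>t. \<phi>2 (x t)) has_vector_derivative \<phi>2' (x t) (x1 t)) (at t)"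
        using C2_map_along(1)[OF C\<phi>2, of x t x1, OF xW2[OF that] xd[OF that]] .
      then have "((\<lambda>t. y0 + t *\<^sub>R v) has_vector_derivative \<phi>2' (x t) (x1 t)) (at t)"
        by (rule has_vector_derivative_transform_within_open[OF _ J(1) that]) (rule \<phi>x)
      then show ?thesis using line vector_derivative_unique_at by blast
    qed
    have accel: "\<phi>2'' (x t) (x1 t) (x1 t) + \<phi>2' (x t) (x2 t) = 0" if "t \<in> J" for t
    proof -
      have "((\<lambda>t. \<phi>2' (x t) (x1 t)) has_vector_derivative (\<phi>2'' (x t) (x1 t) (x1 t) + \<phi>2' (x t) (x2 t))) (at t)"
        using C2_map_along(2)[OF C\<phi>2, of x t x1, OF xW2[OF that] xd[OF that]] .
      then have "((\<lambda>t. v) has_vector_derivative (\<phi>2'' (x t) (x1 t) (x1 t) + \<phi>2' (x t) (x2 t))) (at t)"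
        by (rule has_vector_derivative_transform_within_open[OF _ J(1) that]) (rule speed)
      then show ?thesis using cst vector_derivative_unique_at by blast
    qed
    have "geodesic torus2 (pullback torus2 (block S) (fiber ?s) gb) J (param2 \<circ> x)"
      by (rule torus2.geodesic_straight[OF pullback_fiber_metric[OF s] fiber_metric_periodic[OF s] C\<phi>2 _ inj2(2) J(1) xW2 xd accel])
        (simp_all add: F2(7) \<phi>2'_def)
    note straight = fiber_straight_in_boundary[OF i C\<phi>3 F3(7)[folded \<phi>3'_def] surj3 d(1) WK(2,3) J(1,2) this _ xd]
    have jxW: "(0, x t) \<in> W3 \<inter> WK" if "t \<in> J" for t using JQ[OF that] by (simp add: Q_def x_def)
    have "\<phi>3 (0, x 1) = \<phi>3 (0, x 0) + 1 *\<^sub>R \<phi>3' (0, x 0) (0, x1 0)"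
      by (rule affine_of_zero_acceleration[OF J, of "\<lambda>t. \<phi>3 (0, x t)" "\<lambda>t. \<phi>3' (0, x t) (0, x1 t)"])
        (use straight jxW in auto)
    then show ?thesis by (simp add: x_def x1_def y0 A_def)
  qed
  \<comment> \<open>The local isometries differ from the given developing maps by rigid motions,
    under which an affine relation persists.\<close>
  obtain U2 L2 b2 where U2: "open U2" "x0 \<in> U2" "U2 \<subseteq> W2 \<inter> UNIV" "orthogonal_transformation L2" "\<And>y. y \<in> U2 \<Longrightarrow> \<phi>2 y = L2 (D2 y) + b2"
    using developing_unique_local[OF F2(2) D2 F2(1) UNIV_I] by metis
  obtain U3 L3 b3 where U3: "open U3" "(0, x0) \<in> U3" "U3 \<subseteq> UNIV \<inter> W3" "orthogonal_transformation L3" "\<And>y. y \<in> U3 \<Longrightarrow> D3 y = L3 (\<phi>3 y) + b3"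
    using developing_unique_local[OF D3 F3(2) UNIV_I F3(1)] by metis
  have l2: "linear L2" and l3: "linear L3" using U2(4) U3(4) orthogonal_transformation_linear by blast+
  define U where "U = U2 \<inter> (\<lambda>x. (0, x)) -` U3 \<inter> (W2 \<inter> \<phi>2 -` ball y0 r)"
  have "continuous_on W2 \<phi>2" using F2(4) by (simp add: homeomorphism_def)
  then have "open U" unfolding U_def
    by (intro open_Int U2(1) open_vimage U3(1) continuous_intros continuous_open_preimage oW2 open_ball)
  moreover have "x0 \<in> U" using U2(2) U3(2) F2(1) r(1) by (simp add: U_def y0_def)
  moreover have "linear (\<lambda>v. L3 (A (L2 v)))"
    using linear_compose[OF linear_compose[OF l2 linA] l3] by (simp add: o_def)
  moreover have "D3 (0, x) = L3 (A (L2 (D2 x))) + (L3 (A (b2 - y0)) + L3 (\<phi>3 (0, x0)) + b3)" if "x \<in> U" for x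
  proof -
    have x: "x \<in> U2" "(0, x) \<in> U3" "x \<in> W2" "norm (\<phi>2 x - y0) < r"
      using that by (auto simp: U_def dist_norm norm_minus_commute)
    have "\<sigma>2 (\<phi>2 x) = x" using F2(4) x(3) by (auto simp: homeomorphism_def)
    then have "\<phi>3 (0, x) = \<phi>3 (0, x0) + A (\<phi>2 x - y0)" using aff[OF x(4)] by simp
    moreover have "\<phi>2 x - y0 = L2 (D2 x) + (b2 - y0)" using U2(5)[OF x(1)] by simp
    ultimately have "\<phi>3 (0, x) = \<phi>3 (0, x0) + A (L2 (D2 x)) + A (b2 - y0)" by (simp only: linear_add[OF linA] add.assoc)
    then show ?thesis using U3(5)[OF x(2)] by (simp add: linear_add[OF l3])
  qed
  ultimately show ?thesis by (rule that)
qed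

end

text \<open>A locally affine relation to a developing map is globally affine, since the image of an open
  set under the developing map determines the affine map.\<close>

lemma developing_affine_global:
  fixes D :: "'e::euclidean_space \<Rightarrow> 'e" and F :: "'e \<Rightarrow> 'f::real_normed_vector"
  assumes D: "developing G UNIV D"
    and loc: "\<And>x. \<exists>U A b. open U \<and> x \<in> U \<and> linear A \<and> (\<forall>y\<in>U. F y = A (D y) + b)"
  obtains A b where "linear A" "\<And>x. F x = A (D x) + b"
proof -
  obtain U0 A b where U0: "open U0" "0 \<in> U0" "linear A" "\<And>y. y \<in> U0 \<Longrightarrow> F y = A (D y) + b"
    using loc[of 0] by blast
  define P where "P = \<Union>{U. open U \<and> (\<forall>y\<in>U. F y = A (D y) + b)}"
  define Q where "Q = \<Union>{U. open U \<and> U \<inter> P = {}}"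
  have oP: "open P" and oQ: "open Q" unfolding P_def Q_def by (auto intro: open_Union)
  have "UNIV \<subseteq> P \<union> Q"
  proof
    fix x :: 'e
    obtain U A' b' where U: "open U" "x \<in> U" "linear A'" "\<And>y. y \<in> U \<Longrightarrow> F y = A' (D y) + b'"
      using loc[of x] by blast
    show "x \<in> P \<union> Q"
    proof (cases "U \<inter> P = {}")
      case True then show ?thesis using U by (auto simp: Q_def)
    next
      case False
      have eqP: "F y = A (D y) + b" if "y \<in> P" for y using that by (auto simp: P_def)
      have eq: "A (D y) + b = A' (D y) + b'" if "y \<in> U \<inter> P" for y
        using that eqP[of y] U(4)[of y] by auto
      have "A = A'" "b = b'"
        using developing_affine_agree[OF D open_Int[OF U(1) oP] False subset_UNIV U0(3) U(3) eq] by auto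
      then have "x \<in> P" using U by (auto simp: P_def)
      then show ?thesis by simp
    qed
  qed
  moreover have "P \<inter> Q = {}" by (auto simp: Q_def)
  moreover have "0 \<in> P" using U0 by (auto simp: P_def)
  ultimately have "Q = {}" using connectedD[OF connected_UNIV oP oQ] by blast
  then have "P = UNIV" using \<open>UNIV \<subseteq> P \<union> Q\<close> by blast
  moreover have "F y = A (D y) + b" if "y \<in> P" for y using that by (auto simp: P_def)
  ultimately show ?thesis using that[OF U0(3), of b] by blast
qed

text \<open>The affine relation between the two developing maps holds globally, and its linear part
  preserves norms because the boundary metric restricts to the fiber metric. The inclusion is linear
  itself, so the error bound is 0.\<close>

lemma (in geometrized_block) fiber_period:
  assumes i: "i \<in> I" and D2: "flat_torus (fiber_metric (\<kappa> i 1)) D2" and D3: "flat_torus (bd_metric i) D3"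
  shows "norm (period_map D3 (0, v)) = norm (period_map D2 v)"
proof -
  interpret T2: flat_torus "fiber_metric (\<kappa> i 1)" D2 by fact
  interpret T3: flat_torus "bd_metric i" D3 by fact
  obtain A b where A: "linear A" "\<And>x. D3 (0, x) = A (D2 x) + b"
  proof (rule developing_affine_global[OF T2.dev, of "\<lambda>x. D3 (0, x)"])
    fix x
    show "\<exists>U A b. open U \<and> x \<in> U \<and> linear A \<and> (\<forall>y\<in>U. D3 (0, y) = A (D2 y) + b)"
      using fiber_affine_local[OF i T2.dev T3.dev, of x] by metis
  qed blast
  have bA: "bounded_linear A" using A(1) linear_conv_bounded_linear by blast
  have An: "norm (A u) = norm u" for u
  proof -
    obtain D2' where D2': "(D2 has_derivative D2') (at 0)" "\<And>u v. D2' u \<bullet> D2' v = fiber_metric (\<kappa> i 1) 0 u v"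
      using developing_derivative[OF T2.dev UNIV_I] by metis
    obtain D3' where D3': "(D3 has_derivative D3') (at (0, 0))" "\<And>u v. D3' u \<bullet> D3' v = bd_metric i (0, 0) u v"
      using developing_derivative[OF T3.dev UNIV_I] by metis
    have "((\<lambda>x. (0::real, x)) has_derivative (\<lambda>v. (0, v))) (at (0 :: real \<times> real))"
      by (auto intro!: derivative_eq_intros)
    from has_derivative_compose[OF this, of D3 D3'] D3'(1)
    have "((\<lambda>x. D3 (0, x)) has_derivative (\<lambda>v. D3' (0, v))) (at 0)" by simp
    moreover have "((\<lambda>x. A (D2 x) + b) has_derivative (\<lambda>v. A (D2' v))) (at 0)"
      using has_derivative_add[OF bounded_linear.has_derivative[OF bA D2'(1)] has_derivative_const, of b] by simp
    ultimately have eq: "D3' (0, v) = A (D2' v)" for v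
      unfolding A(2) using has_derivative_unique by metis
    have l: "linear D2'" using D2'(1) has_derivative_linear by blast
    have "inj D2'"
    proof (subst linear_injective_0[OF l], intro allI impI)
      fix v assume "D2' v = 0"
      then have "fiber_metric (\<kappa> i 1) 0 v v = 0" using D2'(2)[of v v] by simp
      then show "v = 0" using T2.dev unfolding developing_def by (metis UNIV_I less_irrefl)
    qed
    then obtain v where v: "u = D2' v" using linear_injective_imp_surjective[OF l] by (metis surjD)
    have "A u \<bullet> A u = u \<bullet> u"
      unfolding v eq[symmetric] D3'(2) D2'(2) bd_metric_fiber[OF i] ..
    then show ?thesis by (simp add: norm_eq_sqrt_inner)
  qed
  show ?thesis
  proof (rule period_map_isometric[OF D2 D3, of "\<lambda>v. (0, v)" "\<lambda>v. (0, v)" 0])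
    show "linear (\<lambda>v. (0::real, v :: real \<times> real))" by (intro linearI) auto
    show "norm (D3 (0, x) - D3 (0, 0)) = norm (D2 x - D2 0)" for x
      using An[of "D2 x - D2 0"] by (simp add: A(2) linear_diff[OF A(1)])
  qed simp
qed

section \<open>Maps between flat tori\<close>

lemma period_lattice_small:
  fixes l :: "'e::euclidean_space"
  assumes "l \<in> period_lattice" "norm l < 2 * pi" shows "l = 0"
proof (rule euclidean_eqI)
  fix b :: 'e assume b: "b \<in> Basis"
  obtain k :: int where k: "l \<bullet> b = 2 * pi * of_int k" using assms(1) b by (auto simp: period_lattice_def)
  have "\<bar>2 * pi * of_int k\<bar> < 2 * pi * 1" using Basis_le_norm[OF b, of l] assms(2) k by simp
  then have "\<bar>real_of_int k\<bar> < 1" by (simp add: abs_mult)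
  then have "k = 0" by linarith
  then show "l \<bullet> b = 0 \<bullet> b" using k by simp
qed

text \<open>An isometric lift pulls a developing map back to a developing map, so it changes the norm of
  periods only by the linear part of the lift.\<close>

lemma isometric_lift_period:
  fixes F :: "'e::euclidean_space \<Rightarrow> 'e"
  assumes T: "flat_torus G D" and T': "flat_torus G' D'"
    and cont: "continuous_on UNIV F"
    and shift: "\<forall>x. \<forall>l\<in>period_lattice. F (x + l) - F x \<in> period_lattice"
    and inj: "\<forall>x y. F x = F y \<longrightarrow> x - y \<in> period_lattice"
    and iso: "\<And>x. \<exists>F'. (F has_derivative F') (at x) \<and> (\<forall>v w. G' (F x) (F' v) (F' w) = G x v w)"
  shows "\<And>x l. l \<in> period_lattice \<Longrightarrow> F (x + l) = F x + period_map F l"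
    and "\<And>l. l \<in> period_lattice \<Longrightarrow> period_map F l \<in> period_lattice"
    and "\<And>v. norm (period_map D' (period_map F v)) = norm (period_map D v)"
proof -
  interpret T: flat_torus G D by fact
  interpret T': flat_torus G' D' by fact
  have translation: "F (x + l) = F x + (F l - F 0)" if l: "l \<in> period_lattice" for x l
  proof -
    have "F (x + l) - F x = F (0 + l) - F 0"
    proof (rule period_lattice_discrete[where S = UNIV and g = "\<lambda>x. F (x + l) - F x"])
      show "continuous_on UNIV (\<lambda>x. F (x + l) - F x)"
        by (intro continuous_intros continuous_on_compose2[OF cont]) auto
    qed (use shift l in auto)
    then show ?thesis by (simp add: algebra_simps)
  qed
  show lat: "F (x + l) = F x + period_map F l" if "l \<in> period_lattice" for x l
    using period_map_lattice[OF translation that] .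
  show "period_map F l \<in> period_lattice" if "l \<in> period_lattice" for l
    using shift lat[OF that, of 0] that by (metis add_diff_cancel_left')
  have "developing G UNIV (\<lambda>x. D' (F x))"
    unfolding developing_def
  proof (intro conjI ballI)
    fix x
    obtain F' where F': "(F has_derivative F') (at x)" "\<And>v w. G' (F x) (F' v) (F' w) = G x v w" using iso by blast
    obtain D'' where D'': "(D' has_derivative D'') (at (F x))" "\<And>u v. D'' u \<bullet> D'' v = G' (F x) u v"
      using developing_derivative[OF T'.dev UNIV_I] by metis
    have "((\<lambda>x. D' (F x)) has_derivative (\<lambda>v. D'' (F' v))) (at x)"
      by (rule has_derivative_compose[OF F'(1) D''(1)])
    then show "\<exists>D''. ((\<lambda>x. D' (F x)) has_derivative D'') (at x) \<and> (\<forall>u v. D'' u \<bullet> D'' v = G x u v)"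
      using D''(2) F'(2) by auto
    obtain U where U: "open U" "F x \<in> U" "inj_on D' U" using T'.dev unfolding developing_def by blast
    have "open (F -` U)" by (rule open_vimage[OF U(1) cont])
    \<comment> \<open>Two points of a ball of radius pi are less than 2 pi apart, too close to
      differ by a nonzero lattice vector.\<close>
    moreover have "inj_on (\<lambda>x. D' (F x)) (F -` U \<inter> ball x pi)"
    proof (rule inj_onI)
      fix y z assume y: "y \<in> F -` U \<inter> ball x pi" "z \<in> F -` U \<inter> ball x pi" "D' (F y) = D' (F z)"
      then have "F y = F z" using inj_onD[OF U(3)] by auto
      then have "y - z \<in> period_lattice" using inj by blast
      moreover have "norm (y - z) < 2 * pi" using y(1,2) dist_triangle2[of y z x] by (simp add: dist_norm norm_minus_commute)
      ultimately show "y = z" using period_lattice_small by fastforce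
    qed
    ultimately show "\<exists>U. open U \<and> x \<in> U \<and> inj_on (\<lambda>x. D' (F x)) U"
      using U(2) by (intro exI[of _ "F -` U \<inter> ball x pi"]) auto
    show "\<forall>v. v \<noteq> 0 \<longrightarrow> 0 < G x v v" using T.dev unfolding developing_def by blast
  qed simp
  then obtain A b where A: "orthogonal_transformation A" "\<And>x. D' (F x) = A (D x) + b"
    using developing_unique[OF _ T.dev connected_UNIV, of "\<lambda>x. D' (F x)"] by auto
  have "norm (D' (F x) - D' (F 0)) = norm (D x - D 0)" for x
    using A(1) linear_diff[OF orthogonal_transformation_linear[OF A(1)], of "D x" "D 0"]
    by (simp add: A(2) orthogonal_transformation_norm flip: linear_diff[OF orthogonal_transformation_linear[OF A(1)]])
  moreover obtain K where "\<And>x. norm (F x - period_map F x) \<le> K"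
    using period_map_bounded[OF translation cont] by blast
  ultimately show "norm (period_map D' (period_map F v)) = norm (period_map D v)" for v
    using period_map_isometric[OF T T' linear_period_map[of F], of F K] by blast
qed

lemma lattice_cover_lift:
  fixes p :: "'e::euclidean_space \<Rightarrow> 'x" and q :: "'e \<Rightarrow> 'y"
  assumes "lattice_cover X p" "lattice_cover Y q" and f: "continuous_map X Y f"
  obtains F where "continuous_on UNIV F" "\<And>x. q (F x) = f (p x)"
    "\<forall>x. \<forall>l\<in>period_lattice. F (x + l) - F x \<in> period_lattice"
    "inj_on f (topspace X) \<Longrightarrow> \<forall>x y. F x = F y \<longrightarrow> x - y \<in> period_lattice"
proof -
  interpret X: lattice_cover X p by fact
  interpret Y: lattice_cover Y q by fact
  have "continuous_map (top_of_set UNIV) Y (f \<circ> p)"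
    using continuous_map_compose[OF X.continuous_cover f] by simp
  from Y.lift_self[unfolded lifting_def, rule_format, OF conjI[OF convex_UNIV this]]
  obtain F where F: "continuous_on UNIV F" "\<And>x. q (F x) = f (p x)" by auto
  have "F (x + l) - F x \<in> period_lattice" if "l \<in> period_lattice" for x l
  proof -
    have "p (x + l) = p x" using that by (simp add: X.cover_eq_iff)
    then show ?thesis using F(2) Y.cover_eq_iff by metis
  qed
  moreover have "x - y \<in> period_lattice" if "inj_on f (topspace X)" "F x = F y" for x y
  proof -
    have "f (p x) = f (p y)" using F(2) that(2) by metis
    then have "p x = p y" using that(1) X.range_cover inj_onD by fastforce
    then show ?thesis by (simp add: X.cover_eq_iff)
  qed
  ultimately show ?thesis using that F by blast
qed

text \<open>An isometry may move homology classes. The class \<open>m\<close> is the displacement of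
  a lift over \<open>l\<close>, and the lift pulls one developing map back to another.\<close>

lemma isometry_period:
  fixes p :: "'e::euclidean_space \<Rightarrow> 'x"
  assumes "torus_mfd T p" and cover: "lattice_cover (mtop T) p"
    and h: "\<And>c y. c \<in> matlas T \<Longrightarrow> y \<in> cimg c \<Longrightarrow> h c y = G y"
    and h': "\<And>c y. c \<in> matlas T \<Longrightarrow> y \<in> cimg c \<Longrightarrow> h' c y = G' y"
    and per: "\<And>l x. l \<in> period_lattice \<Longrightarrow> G' (x + l) = G' x"
    and T: "flat_torus G D" and T': "flat_torus G' D'"
    and iso: "isometry_betw T h (topspace (mtop T)) T h' (topspace (mtop T)) f"
    and l: "l \<in> period_lattice"
  obtains m where "m \<in> period_lattice" "norm (period_map D' m) = norm (period_map D l)"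
proof -
  interpret torus_mfd T p by fact
  have df: "diffeo_betw T (topspace (mtop T)) T (topspace (mtop T)) f"
    and metric: "\<And>c d x v w. c \<in> matlas T \<Longrightarrow> d \<in> matlas T \<Longrightarrow> x \<in> loc_dom c d (topspace (mtop T)) f \<Longrightarrow>
      h c x v w = h' d (loc_rep c d f x) (loc_deriv c d (topspace (mtop T)) f x v) (loc_deriv c d (topspace (mtop T)) f x w)"
    using iso unfolding isometry_betw_def by blast+
  have bij: "bij_betw f (topspace (mtop T)) (topspace (mtop T))" and sm: "smooth_map_on T (topspace (mtop T)) T f"
    using df by (auto simp: diffeo_betw_def)
  have cf: "continuous_map (mtop T) (mtop T) f" using sm by (simp add: smooth_map_on_def)
  obtain F where F: "continuous_on UNIV F" "\<And>x. p (F x) = f (p x)"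
    "\<forall>x. \<forall>l\<in>period_lattice. F (x + l) - F x \<in> period_lattice"
    "inj_on f (topspace (mtop T)) \<Longrightarrow> \<forall>x y. F x = F y \<longrightarrow> x - y \<in> period_lattice"
    using lattice_cover_lift[OF cover cover cf] by metis
  have "\<exists>F'. (F has_derivative F') (at x) \<and> (\<forall>v w. G' (F x) (F' v) (F' w) = G x v w)" for x
  proof -
    obtain c where c: "c \<in> matlas T" "x \<in> cimg c" using chart_at by blast
    obtain d where d: "d \<in> matlas T" "F x \<in> cimg d" using chart_at by blast
    let ?L = "loc_dom c d (topspace (mtop T)) f"
    have L: "?L = cimg c \<inter> {z. (f \<circ> p) z \<in> cdom d}"
      unfolding loc_dom_def chart_dom_eq[OF c(1)] using chart_map[OF c(1)] range_param by force
    have oL: "open ?L" unfolding L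
      using chart_img[OF c(1)] open_preimage_continuous_map[OF continuous_map_compose[OF continuous_param cf] chart_dom[OF d(1)]] by blast
    define N where "N = F -` cimg d \<inter> cimg c"
    have oN: "open N" unfolding N_def using open_vimage[OF chart_img[OF d(1)] F(1)] chart_img[OF c(1)] by blast
    have xN: "x \<in> N" using c d by (simp add: N_def)
    have NL: "N \<subseteq> ?L" unfolding L N_def using chart_dom_eq[OF d(1)] F(2) by (auto simp: image_iff) (metis)
    have rep: "loc_rep c d f z = F z" if "z \<in> N" for z
      using that chart_inverse[OF c(1)] chart_map[OF d(1)] F(2) by (simp add: loc_rep_def N_def flip: F(2))
    have "smooth_on ?L (loc_rep c d f)" using sm c d by (simp add: smooth_map_on_def)
    then have "loc_rep c d f differentiable (at x within ?L)"
      by (rule smooth_on_differentiable) (use NL xN in blast)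
    then have "(loc_rep c d f has_derivative loc_deriv c d (topspace (mtop T)) f x) (at x within ?L)"
      unfolding loc_deriv_def by (simp add: frechet_derivative_works)
    then have "(loc_rep c d f has_derivative loc_deriv c d (topspace (mtop T)) f x) (at x)"
      using at_within_open[OF _ oL, of x] NL xN by auto
    then have "(F has_derivative loc_deriv c d (topspace (mtop T)) f x) (at x)"
      by (rule has_derivative_transform_within_open[OF _ oN xN rep])
    moreover have "G' (F x) (loc_deriv c d (topspace (mtop T)) f x v) (loc_deriv c d (topspace (mtop T)) f x w) = G x v w" for v w
      using metric[OF c(1) d(1), of x v w] NL xN rep[OF xN] h[OF c] h'[OF d] by auto
    ultimately show ?thesis by blast
  qed
  then have iso': "\<And>x. \<exists>F'. (F has_derivative F') (at x) \<and> (\<forall>v w. G' (F x) (F' v) (F' w) = G x v w)" by blast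
  note lift = isometric_lift_period[OF T T' F(1,3) F(4)[OF bij_betw_imp_inj_on[OF bij]]]
  show ?thesis by (rule that[OF lift(2)[OF iso' l] lift(3)[OF iso']])
qed

section \<open>All fibers have the same periods\<close>

lemma lattice_countable: "countable (period_lattice :: 'e::euclidean_space set)"
proof -
  have "(period_lattice :: 'e set) \<subseteq> (\<lambda>f. \<Sum>b\<in>Basis. (2 * pi * of_int (f b)) *\<^sub>R b) ` (Basis \<rightarrow>\<^sub>E (UNIV :: int set))"
  proof
    fix x :: 'e assume x: "x \<in> period_lattice"
    then have "\<forall>b\<in>Basis. \<exists>k::int. x \<bullet> b = 2 * pi * of_int k" by (simp add: period_lattice_def)
    from bchoice[OF this] obtain k where k: "\<And>b. b \<in> Basis \<Longrightarrow> x \<bullet> b = 2 * pi * of_int (k b :: int)" by blast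
    have "x = (\<Sum>b\<in>Basis. (x \<bullet> b) *\<^sub>R b)" by (simp add: euclidean_representation)
    also have "\<dots> = (\<Sum>b\<in>Basis. (2 * pi * of_int (restrict k Basis b)) *\<^sub>R b)"
      by (intro sum.cong) (auto simp: k)
    finally show "x \<in> (\<lambda>f. \<Sum>b\<in>Basis. (2 * pi * of_int (f b)) *\<^sub>R b) ` (Basis \<rightarrow>\<^sub>E (UNIV :: int set))"
      by (intro image_eqI[of _ _ "restrict k Basis"]) auto
  qed
  moreover have "countable (Basis \<rightarrow>\<^sub>E (UNIV :: int set) :: ('e \<Rightarrow> int) set)"
    by (rule countable_PiE) auto
  ultimately show ?thesis using countable_image countable_subset by blast
qed

lemma bilinear_inner_linear:
  fixes E :: "'e::euclidean_space \<Rightarrow> 'f::euclidean_space"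
  assumes "linear E"
  shows "bilinear (\<lambda>v w. E v \<bullet> E w)"
  unfolding bilinear_def using assms
  by (auto intro!: linearI simp: linear_add linear_scale inner_add_left inner_add_right)

lemma positive_form_close:
  fixes D' :: "'e::euclidean_space \<Rightarrow> 'e"
  assumes D': "linear D'" "inj D'" and \<delta>: "\<delta> > 0"
  obtains \<eta> where "\<eta> > 0" "\<And>B v. bilinear B \<Longrightarrow> (\<And>i j. i \<in> Basis \<Longrightarrow> j \<in> Basis \<Longrightarrow> \<bar>B i j - D' i \<bullet> D' j\<bar> \<le> \<eta>) \<Longrightarrow>
     \<bar>B v v - D' v \<bullet> D' v\<bar> \<le> \<delta> * (D' v \<bullet> D' v)"
proof -
  obtain c where c: "c > 0" "\<And>x. c * norm x \<le> norm (D' x)"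
    using linear_inj_bounded_below_pos[OF D'] by (metis mult.commute)
  define n where "n = real (card (Basis :: 'e set))"
  have n: "n > 0" by (simp add: n_def card_gt_0_iff)
  \<comment> \<open>The square of \<open>n\<close> counts the entries of the form, and the square of
    \<open>c\<close> compares the norm of \<open>v\<close> with that of \<open>D' v\<close>, so the
    total error is at most \<open>\<delta>\<close> times the form.\<close>
  define \<eta> where "\<eta> = \<delta> * c\<^sup>2 / n\<^sup>2"
  have \<eta>: "\<eta> > 0" using \<delta> c n by (simp add: \<eta>_def)
  have "\<bar>B v v - D' v \<bullet> D' v\<bar> \<le> \<delta> * (D' v \<bullet> D' v)"
    if B: "bilinear B" and close: "\<And>i j. i \<in> Basis \<Longrightarrow> j \<in> Basis \<Longrightarrow> \<bar>B i j - D' i \<bullet> D' j\<bar> \<le> \<eta>" for B v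
  proof -
    have bD: "bilinear (\<lambda>v w. D' v \<bullet> D' w)" by (rule bilinear_inner_linear[OF D'(1)])
    have "B v v - D' v \<bullet> D' v = (\<Sum>i\<in>Basis. \<Sum>j\<in>Basis. (v \<bullet> i) * (v \<bullet> j) * (B i j - D' i \<bullet> D' j))"
      unfolding bilinear_expand[OF B, of v v] bilinear_expand[OF bD, of v v]
      by (simp add: sum_subtractf right_diff_distrib)
    also have "\<bar>\<dots>\<bar> \<le> (\<Sum>i\<in>Basis. \<Sum>j\<in>Basis. \<bar>(v \<bullet> i) * (v \<bullet> j) * (B i j - D' i \<bullet> D' j)\<bar>)"
      by (rule order_trans[OF sum_abs sum_mono]) (rule sum_abs)
    also have "\<dots> \<le> (\<Sum>i\<in>(Basis :: 'e set). \<Sum>j\<in>(Basis :: 'e set). (norm v)\<^sup>2 * \<eta>)"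
    proof (intro sum_mono)
      fix i j :: 'e assume ij: "i \<in> Basis" "j \<in> Basis"
      show "\<bar>(v \<bullet> i) * (v \<bullet> j) * (B i j - D' i \<bullet> D' j)\<bar> \<le> (norm v)\<^sup>2 * \<eta>"
        unfolding abs_mult power2_eq_square using Basis_le_norm[OF ij(1), of v] Basis_le_norm[OF ij(2), of v] close[OF ij]
        by (intro mult_mono) auto
    qed
    also have "\<dots> = \<delta> * (c * norm v)\<^sup>2" using n by (simp add: \<eta>_def n_def power2_eq_square)
    also have "\<dots> \<le> \<delta> * (D' v \<bullet> D' v)"
      using c \<delta> by (simp add: dot_square_norm mult_left_mono power_mono)
    finally show ?thesis .
  qed
  then show ?thesis using that[OF \<eta>] by blast
qed

context geometrized_block
begin

text \<open>A developing map presents the form at each point as a pulled back scalar product, from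
  which bilinearity and positivity can be read off.\<close>

lemma fiber_metric_bilinear:
  assumes "s \<in> topspace (mtop S)"
  obtains D' :: "real \<times> real \<Rightarrow> real \<times> real" where "linear D'" "inj D'" "\<And>v w. fiber_metric s x v w = D' v \<bullet> D' w"
proof -
  obtain D where "flat_torus (fiber_metric s) D" using flat_torus_fiber[OF assms] .
  then interpret flat_torus "fiber_metric s" D .
  obtain D' where D': "(D has_derivative D') (at x)" "\<And>u v. D' u \<bullet> D' v = fiber_metric s x u v"
    using developing_derivative[OF dev UNIV_I] by metis
  have l: "linear D'" using D'(1) has_derivative_linear by blast
  have "inj D'"
  proof (subst linear_injective_0[OF l], intro allI impI)
    fix v assume "D' v = 0"
    then have "fiber_metric s x v v = 0" using D'(2)[of v v] by simp
    then show "v = 0" using dev unfolding developing_def by (metis UNIV_I less_irrefl)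
  qed
  then show ?thesis using that l D'(2) by metis
qed

text \<open>In a product chart the fiber cover has differential v to (0, v), so the fiber metric is
  a diagonal block of the matrix of \<open>gb\<close> and depends continuously on base point and
  fiber point together.\<close>

lemma fiber_metric_entries_continuous:
  assumes s0: "s0 \<in> topspace (mtop S)" and \<eta>: "\<eta> > 0"
  obtains N B where "openin (mtop S) N" "s0 \<in> N" "open B" "x0 \<in> B"
    "\<And>s x i j. s \<in> N \<Longrightarrow> x \<in> B \<Longrightarrow> i \<in> Basis \<Longrightarrow> j \<in> Basis \<Longrightarrow>
       \<bar>fiber_metric s x i j - fiber_metric s0 x0 i j\<bar> \<le> \<eta>"
proof -
  obtain c1 where c1: "c1 \<in> matlas S" "s0 \<in> cdom c1" using s0 charted_S.dom_cover by blast
  obtain c2 where c2: "c2 \<in> matlas torus2" "x0 \<in> cimg c2" using torus2.chart_at by blast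
  have px0: "param2 x0 \<in> cdom c2" using torus2.chart_dom_eq[OF c2(1)] c2(2) by blast
  obtain l B0 where B0: "open B0" "x0 \<in> B0" "\<And>z. z \<in> B0 \<Longrightarrow> param2 z \<in> cdom c2"
    "\<And>z. z \<in> B0 \<Longrightarrow> cmap c2 (param2 z) = z + l" using torus2.chart_translation[OF c2(1) px0] by metis
  define d where "d = prod_chart c1 c2"
  have d: "d \<in> matlas (block S)" using c1 c2 by (auto simp: d_def block_def prod_mfd_def)
  have val: "fiber_metric s x v w = gb d (cmap c1 s, x + l) (0, v) (0, w)" "(cmap c1 s, x + l) \<in> cimg d"
    if "s \<in> cdom c1" "x \<in> B0" for s x v w
  proof -
    have st: "s \<in> topspace (mtop S)" using that(1) charted_S.dom_open[OF c1(1)] openin_subset by blast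
    have dom: "fiber_cover s x \<in> cdom d" using that B0(3) by (simp add: d_def fiber_cover_apply)
    have cm: "cmap d (fiber_cover s x) = (cmap c1 s, x + l)" using that B0(4) by (simp add: d_def fiber_cover_apply)
    show "fiber_metric s x v w = gb d (cmap c1 s, x + l) (0, v) (0, w)"
      using fiber_metric_chart[OF st d dom] cm by simp
    show "(cmap c1 s, x + l) \<in> cimg d" using charted_block.img_chart[OF dom] cm by simp
  qed
  let ?X0 = "(cmap c1 s0, x0 + l)"
  have "\<exists>\<rho>>(0::real). \<forall>X\<in>cimg d. dist X ?X0 < \<rho> \<longrightarrow> dist (gb d X (0, i) (0, j)) (gb d ?X0 (0, i) (0, j)) < \<eta>" for i j :: "real \<times> real"
  proof -
    have "smooth_on (cimg d) (\<lambda>X. gb d X (0, i) (0, j))" using riemannian d unfolding riemannian_metric_def by blast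
    then have "continuous_on (cimg d) (\<lambda>X. gb d X (0, i) (0, j))" by (rule smooth_on_continuous)
    then show ?thesis using val(2)[OF c1(2) B0(2)] \<eta> unfolding continuous_on_iff by blast
  qed
  then obtain \<rho> :: "real \<times> real \<Rightarrow> real \<times> real \<Rightarrow> real" where \<rho>: "\<And>i j. \<rho> i j > 0"
    "\<And>i j X. X \<in> cimg d \<Longrightarrow> dist X ?X0 < \<rho> i j \<Longrightarrow> dist (gb d X (0, i) (0, j)) (gb d ?X0 (0, i) (0, j)) < \<eta>" by metis
  define r where "r = Min ((\<lambda>(i :: real \<times> real, j :: real \<times> real). \<rho> i j) ` (Basis \<times> Basis))"
  have r: "r > 0" "\<And>i j :: real \<times> real. i \<in> Basis \<Longrightarrow> j \<in> Basis \<Longrightarrow> r \<le> \<rho> i j"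
    unfolding r_def using \<rho>(1) by (auto intro!: Min_le image_eqI[of _ _ "(_, _)"])
  define N where "N = {s \<in> topspace (subtopology (mtop S) (cdom c1)). cmap c1 s \<in> ball (cmap c1 s0) (r / 2)}"
  have "homeomorphic_map (subtopology (mtop S) (cdom c1)) (top_of_set (cimg c1)) (cmap c1)"
    using smooth_S c1(1) by (simp add: smooth_manifold_def is_chart_def)
  then have "continuous_map (subtopology (mtop S) (cdom c1)) euclidean (cmap c1)"
    using homeomorphic_imp_continuous_map continuous_map_into_fulltopology by blast
  then have "openin (subtopology (mtop S) (cdom c1)) N" unfolding N_def
    by (rule openin_continuous_map_preimage) simp
  then have oN: "openin (mtop S) N" using charted_S.dom_open[OF c1(1)] openin_trans_full by blast
  have sN: "s0 \<in> N" using c1(2) s0 r(1) by (simp add: N_def)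
  define B where "B = B0 \<inter> ball x0 (r / 2)"
  have oB: "open B" "x0 \<in> B" using B0 r(1) by (auto simp: B_def)
  show ?thesis
  proof (rule that[OF oN sN oB])
    fix s and x i j :: "real \<times> real" assume sx: "s \<in> N" "x \<in> B" and ij: "i \<in> Basis" "j \<in> Basis"
    have s: "s \<in> cdom c1" "x \<in> B0" using sx by (auto simp: N_def B_def)
    have "dist (cmap c1 s, x + l) ?X0 \<le> dist (cmap c1 s) (cmap c1 s0) + dist (x + l) (x0 + l)"
      unfolding dist_Pair_Pair by (rule sqrt_sum_squares_le_sum) auto
    also have "\<dots> < r" using sx by (simp add: N_def B_def dist_commute)
    also have "r \<le> \<rho> i j" by (rule r(2)[OF ij])
    finally have "dist (gb d (cmap c1 s, x + l) (0, i) (0, j)) (gb d ?X0 (0, i) (0, j)) < \<eta>"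
      by (rule \<rho>(2)[OF val(2)[OF s]])
    then show "\<bar>fiber_metric s x i j - fiber_metric s0 x0 i j\<bar> \<le> \<eta>"
      using val(1)[OF s] val(1)[OF c1(2) B0(2)] by (simp add: dist_real_def)
  qed
qed

text \<open>Continuity alone is local on the fiber; compactness of a fundamental domain and
  periodicity make the comparison uniform over the whole cover.\<close>

lemma fiber_metric_close:
  assumes s0: "s0 \<in> topspace (mtop S)" and \<epsilon>: "\<epsilon> > 0"
  obtains N where "openin (mtop S) N" "s0 \<in> N"
    "\<And>s x v. s \<in> N \<Longrightarrow> fiber_metric s x v v \<le> (1 + \<epsilon>)\<^sup>2 * fiber_metric s0 x v v"
    "\<And>s x v. s \<in> N \<Longrightarrow> fiber_metric s0 x v v \<le> (1 + \<epsilon>)\<^sup>2 * fiber_metric s x v v"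
proof -
  \<comment> \<open>The solution of (1 + \<delta>) / (1 - \<delta>) = 1 + \<epsilon>, because two
    nearby metrics are compared through a third one at a centre of the finite cover.\<close>
  define \<delta> where "\<delta> = \<epsilon> / (2 + \<epsilon>)"
  have \<delta>: "\<delta> > 0" "\<delta> < 1" "1 + \<delta> = (1 + \<epsilon>) * (1 - \<delta>)"
    using \<epsilon> by (auto simp: \<delta>_def field_simps)
  have "\<exists>N B. openin (mtop S) N \<and> s0 \<in> N \<and> open B \<and> x0 \<in> B \<and>
    (\<forall>s\<in>N. \<forall>x\<in>B. \<forall>v. \<bar>fiber_metric s x v v - fiber_metric s0 x0 v v\<bar> \<le> \<delta> * fiber_metric s0 x0 v v)" for x0
  proof -
    obtain D' :: "real \<times> real \<Rightarrow> real \<times> real" where D': "linear D'" "inj D'" "\<And>v w. fiber_metric s0 x0 v w = D' v \<bullet> D' w"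
      using fiber_metric_bilinear[OF s0] by metis
    obtain \<eta> where \<eta>: "\<eta> > 0" "\<And>B v. bilinear B \<Longrightarrow> (\<And>i j. i \<in> Basis \<Longrightarrow> j \<in> Basis \<Longrightarrow> \<bar>B i j - D' i \<bullet> D' j\<bar> \<le> \<eta>) \<Longrightarrow>
       \<bar>B v v - D' v \<bullet> D' v\<bar> \<le> \<delta> * (D' v \<bullet> D' v)"
      using positive_form_close[OF D'(1,2) \<delta>(1)] by metis
    obtain N B where N: "openin (mtop S) N" "s0 \<in> N" "open B" "x0 \<in> B"
      "\<And>s x i j. s \<in> N \<Longrightarrow> x \<in> B \<Longrightarrow> i \<in> Basis \<Longrightarrow> j \<in> Basis \<Longrightarrow>
       \<bar>fiber_metric s x i j - fiber_metric s0 x0 i j\<bar> \<le> \<eta>"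
      using fiber_metric_entries_continuous[OF s0 \<eta>(1), of x0] by metis
    have "\<bar>fiber_metric s x v v - fiber_metric s0 x0 v v\<bar> \<le> \<delta> * fiber_metric s0 x0 v v"
      if s: "s \<in> N" "x \<in> B" for s x v
    proof -
      have st: "s \<in> topspace (mtop S)" using s(1) N(1) openin_subset by blast
      obtain E :: "real \<times> real \<Rightarrow> real \<times> real" where E: "linear E" "\<And>v w. fiber_metric s x v w = E v \<bullet> E w"
        using fiber_metric_bilinear[OF st] by metis
      have "bilinear (fiber_metric s x)"
        unfolding E(2)[abs_def] by (rule bilinear_inner_linear[OF E(1)])
      from \<eta>(2)[OF this, of v] show ?thesis using N(5)[OF s] D'(3) by simp
    qed
    then show ?thesis using N(1-4) by blast
  qed
  then obtain N B where NB: "\<And>x0. openin (mtop S) (N x0)" "\<And>x0. s0 \<in> N x0" "\<And>x0. open (B x0)" "\<And>x0. x0 \<in> B x0"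
    "\<And>x0 s x v. s \<in> N x0 \<Longrightarrow> x \<in> B x0 \<Longrightarrow> \<bar>fiber_metric s x v v - fiber_metric s0 x0 v v\<bar> \<le> \<delta> * fiber_metric s0 x0 v v"
    by metis
  define K :: "(real \<times> real) set" where "K = cbox 0 ((2 * pi) *\<^sub>R One)"
  have "compact K" by (simp add: K_def)
  moreover have "K \<subseteq> \<Union>(B ` K)" using NB(4) by blast
  ultimately obtain F where F: "F \<subseteq> K" "finite F" "K \<subseteq> \<Union>(B ` F)"
    using NB(3) by (metis compactE_image)
  define N0 where "N0 = \<Inter>(insert (topspace (mtop S)) (N ` F))"
  have oN0: "openin (mtop S) N0" unfolding N0_def using F(2) NB(1) by (intro openin_Inter) auto
  have sN0: "s0 \<in> N0" using NB(2) s0 by (simp add: N0_def)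
  have main: "fiber_metric s z v v \<le> (1 + \<epsilon>)\<^sup>2 * fiber_metric s' z v v"
    if s: "s \<in> N0" "s' \<in> N0" and z: "z \<in> K" for s s' z v
  proof -
    obtain x0 where x0: "x0 \<in> F" "z \<in> B x0" using F(3) z by blast
    let ?g = "fiber_metric s0 x0 v v"
    have g: "?g \<ge> 0" using fiber_metric_bilinear[OF s0] by (metis inner_ge_zero)
    have 1: "fiber_metric s z v v \<le> (1 + \<delta>) * ?g" "(1 - \<delta>) * ?g \<le> fiber_metric s' z v v"
      using NB(5)[of s x0 z v] NB(5)[of s' x0 z v] s x0 by (auto simp: N0_def algebra_simps abs_le_iff)
    have "(1 + \<delta>) * ?g = (1 + \<epsilon>) * ((1 - \<delta>) * ?g)" by (simp add: \<delta>(3))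
    also have "\<dots> \<le> (1 + \<epsilon>) * fiber_metric s' z v v" using 1(2) \<epsilon> by (intro mult_left_mono) auto
    \<comment> \<open>The weaker square has the shape in which \<open>period_map_compare\<close>
      takes its constant.\<close>
    also have "\<dots> \<le> (1 + \<epsilon>)\<^sup>2 * fiber_metric s' z v v"
    proof (rule mult_right_mono)
      show "1 + \<epsilon> \<le> (1 + \<epsilon>)\<^sup>2" using \<epsilon> by (simp add: power2_eq_square)
      have "(1 - \<delta>) * ?g \<ge> 0" using g \<delta>(2) by simp
      then show "0 \<le> fiber_metric s' z v v" using 1(2) by linarith
    qed
    finally show ?thesis using 1(1) by linarith
  qed
  have all: "fiber_metric s x v v \<le> (1 + \<epsilon>)\<^sup>2 * fiber_metric s' x v v" if s: "s \<in> N0" "s' \<in> N0" for s s' x v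
  proof -
    obtain z l where zl: "l \<in> period_lattice" "z \<in> K" "x = z + l"
      unfolding K_def by (rule lattice_fundamental)
    have "s \<in> topspace (mtop S)" "s' \<in> topspace (mtop S)" using s by (auto simp: N0_def)
    then show ?thesis using main[OF s zl(2)] fiber_metric_periodic zl(1,3) by metis
  qed
  show ?thesis by (rule that[OF oN0 sN0]) (use all sN0 in blast)+
qed

text \<open>The square root of the length form of the fiber. Two developing maps of one metric
  differ by a rigid motion, so the choice does not affect the norm.\<close>

definition fiber_norm :: "'a \<Rightarrow> real \<times> real \<Rightarrow> real" where
  "fiber_norm s v = norm (period_map (SOME D. flat_torus (fiber_metric s) D) v)"

lemma some_flat_torus:
  assumes "s \<in> topspace (mtop S)" shows "flat_torus (fiber_metric s) (SOME D. flat_torus (fiber_metric s) D)"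
proof -
  obtain D where "flat_torus (fiber_metric s) D" using flat_torus_fiber[OF assms] .
  then have "\<exists>D. flat_torus (fiber_metric s) D" by blast
  then show ?thesis by (rule someI_ex)
qed

text \<open>Fiber metrics comparable up to a factor near 1 have length norms comparable up to the
  same factor.\<close>

lemma fiber_norm_continuous: "continuous_map (mtop S) euclideanreal (\<lambda>s. fiber_norm s v)"
proof -
  have "openin (mtop S) {s \<in> topspace (mtop S). fiber_norm s v \<in> U}" if U: "open U" for U
  proof (subst openin_subopen, intro ballI)
    fix s0 assume "s0 \<in> {s \<in> topspace (mtop S). fiber_norm s v \<in> U}"
    then have s0: "s0 \<in> topspace (mtop S)" "fiber_norm s0 v \<in> U" by auto
    obtain e where e: "e > 0" "ball (fiber_norm s0 v) e \<subseteq> U" using U s0(2) open_contains_ball by blast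
    define f0 where "f0 = fiber_norm s0 v"
    have f0: "f0 \<ge> 0" by (simp add: f0_def fiber_norm_def)
    \<comment> \<open>Small enough to keep the relative error below \<open>e\<close>; adding 1 to
      \<open>f0\<close> covers a vanishing norm.\<close>
    define \<epsilon> where "\<epsilon> = e / (2 * (1 + f0))"
    have \<epsilon>: "\<epsilon> > 0" "\<epsilon> * f0 < e" using e(1) f0 by (auto simp: \<epsilon>_def field_simps add_nonneg_pos)
    obtain N where N: "openin (mtop S) N" "s0 \<in> N"
      "\<And>s x v. s \<in> N \<Longrightarrow> fiber_metric s x v v \<le> (1 + \<epsilon>)\<^sup>2 * fiber_metric s0 x v v"
      "\<And>s x v. s \<in> N \<Longrightarrow> fiber_metric s0 x v v \<le> (1 + \<epsilon>)\<^sup>2 * fiber_metric s x v v"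
      using fiber_metric_close[OF s0(1) \<epsilon>(1)] by metis
    have "N \<subseteq> {s \<in> topspace (mtop S). fiber_norm s v \<in> U}"
    proof
      fix s assume s: "s \<in> N"
      have st: "s \<in> topspace (mtop S)" using s N(1) openin_subset by blast
      note T = some_flat_torus[OF st] and T0 = some_flat_torus[OF s0(1)]
      have e1: "0 \<le> 1 + \<epsilon>" using \<epsilon> by simp
      have 1: "fiber_norm s v \<le> (1 + \<epsilon>) * f0"
        unfolding f0_def fiber_norm_def by (rule period_map_compare[OF T0 T e1 N(3)[OF s]])
      have 2: "f0 \<le> (1 + \<epsilon>) * fiber_norm s v"
        unfolding f0_def fiber_norm_def by (rule period_map_compare[OF T T0 e1 N(4)[OF s]])
      have "f0 - fiber_norm s v < e"
      proof (rule ccontr)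
        assume "\<not> f0 - fiber_norm s v < e"
        then have "fiber_norm s v \<le> f0 - e" by simp
        then have "(1 + \<epsilon>) * fiber_norm s v \<le> (1 + \<epsilon>) * (f0 - e)" using e1 by (rule mult_left_mono)
        also have "\<dots> = f0 + (\<epsilon> * f0 - e) - \<epsilon> * e" by (simp add: algebra_simps)
        also have "\<dots> < f0" using \<epsilon>(2) mult_pos_pos[OF \<epsilon>(1) e(1)] by linarith
        finally show False using 2 by simp
      qed
      moreover have "fiber_norm s v - f0 < e" using 1 \<epsilon>(2) by (simp add: algebra_simps)
      ultimately have "fiber_norm s v \<in> ball f0 e" by (simp add: dist_real_def abs_less_iff)
      then show "s \<in> {s \<in> topspace (mtop S). fiber_norm s v \<in> U}" using st e(2) by (auto simp: f0_def)
    qed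
    then show "\<exists>T. openin (mtop S) T \<and> s0 \<in> T \<and> T \<subseteq> {s \<in> topspace (mtop S). fiber_norm s v \<in> U}"
      using N by blast
  qed
  then show ?thesis by (simp add: continuous_map_def)
qed

text \<open>The isometry between two fibers need not respect homology classes, so only the set of
  lengths is shared. That set is countable, which is all that the continuity argument needs.\<close>

lemma fiber_norm_lattice_values:
  assumes s: "s \<in> topspace (mtop S)" and t: "t \<in> topspace (mtop S)" and l: "l \<in> period_lattice"
  shows "fiber_norm s l \<in> fiber_norm t ` period_lattice"
proof -
  obtain f where f: "isometry_betw
          torus2 (pullback torus2 (block S) (fiber s) gb) (topspace (mtop torus2))
          torus2 (pullback torus2 (block S) (fiber t) gb) (topspace (mtop torus2)) f"
    using geometrization s t unfolding block_geometrization_def by blast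
  obtain m where "m \<in> period_lattice" "norm (period_map (SOME D. flat_torus (fiber_metric t) D) m) =
      norm (period_map (SOME D. flat_torus (fiber_metric s) D) l)"
    using isometry_period[OF torus2.torus_mfd_axioms lattice_cover_torus2 pullback_fiber_metric[OF s] pullback_fiber_metric[OF t]
        fiber_metric_periodic[OF t] some_flat_torus[OF s] some_flat_torus[OF t] f l] by metis
  then show ?thesis unfolding fiber_norm_def by (metis image_eqI)
qed

lemma fiber_norm_constant:
  assumes S: "connected_space (mtop S)" and s: "s \<in> topspace (mtop S)" and t: "t \<in> topspace (mtop S)"
    and l: "l \<in> period_lattice"
  shows "fiber_norm s l = fiber_norm t l"
proof (rule ccontr)
  assume ne: "fiber_norm s l \<noteq> fiber_norm t l"
  let ?R = "(\<lambda>s. fiber_norm s l) ` topspace (mtop S)"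
  have "connectedin euclideanreal ?R"
    using connectedin_continuous_map_image[OF fiber_norm_continuous] S by (simp add: connectedin_topspace)
  then have "connected ?R" by simp
  then have "uncountable ?R" using connected_uncountable ne s t by blast
  moreover have "countable ?R"
  proof (rule countable_subset)
    show "?R \<subseteq> fiber_norm t ` period_lattice" using fiber_norm_lattice_values[OF _ t l] by blast
    show "countable (fiber_norm t ` period_lattice)" by (intro countable_image lattice_countable)
  qed
  ultimately show False by blast
qed

end

section \<open>Gluings and periods\<close>

text \<open>Polarization: lattice generators and their pairwise sums determine all scalar products
  of basis vectors.\<close>

lemma lattice_norm_determines:
  fixes A :: "'e::euclidean_space \<Rightarrow> 'f::euclidean_space" and B :: "'e \<Rightarrow> 'g::euclidean_space"
  assumes A: "linear A" and B: "linear B" and eq: "\<And>l. l \<in> period_lattice \<Longrightarrow> norm (A l) = norm (B l)"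
  shows "norm (A v) = norm (B v)"
proof -
  have sc: "A i \<bullet> A j = B i \<bullet> B j" if ij: "i \<in> Basis" "j \<in> Basis" for i j
  proof -
    let ?i = "(2 * pi) *\<^sub>R i" and ?j = "(2 * pi) *\<^sub>R j"
    have l: "?i \<in> period_lattice" "?j \<in> period_lattice" "?i + ?j \<in> period_lattice"
      using lattice_Basis[OF ij(1)] lattice_Basis[OF ij(2)] lattice_add by auto
    have "A ?i \<bullet> A ?j = B ?i \<bullet> B ?j"
      using eq[OF l(1)] eq[OF l(2)] eq[OF l(3)]
      by (simp add: dot_norm[of "A ?i"] dot_norm[of "B ?i"] flip: linear_add[OF A] linear_add[OF B])
    then show ?thesis by (simp add: linear_scale[OF A] linear_scale[OF B])
  qed
  have "A v \<bullet> A v = B v \<bullet> B v"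
    unfolding bilinear_expand[OF bilinear_inner_linear[OF A], of v v] bilinear_expand[OF bilinear_inner_linear[OF B], of v v]
    by (simp add: sc cong: sum.cong)
  then show ?thesis by (simp add: norm_eq_sqrt_inner)
qed

context geometrized_block
begin

lemma topspace_bd_top: "i \<in> I \<Longrightarrow> topspace (bd_top S \<kappa> i) = bd_torus \<kappa> i"
  using continuous_map_image_subset_topspace[OF continuous_bd_param] by (auto simp: bd_top_def bd_torus_def)

lemma range_bd_cover: "range (bd_cover i) = bd_torus \<kappa> i"
  by (simp add: bd_cover_def bd_torus_def torus3.range_param flip: image_image image_comp)

lemma bd_homeomorphic:
  assumes i: "i \<in> I"
  shows "homeomorphic_map (mtop torus3) (bd_top S \<kappa> i) (bd_param \<kappa> i)"
proof (rule continuous_imp_homeomorphic_map)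
  have c: "compact_space (mtop circle)" by (simp add: circle_def compact_space_subtopology)
  show "compact_space (mtop torus3)"
    using c by (simp add: torus3_def torus2_def prod_mfd_def compact_space_prod_topology)
  have "Hausdorff_space (mtop circle)" by (simp add: circle_def Hausdorff_space_subtopology)
  then have "Hausdorff_space (mtop (block S))"
    using smooth_S by (simp add: block_def torus2_def prod_mfd_def Hausdorff_space_prod_topology smooth_manifold_def)
  then show "Hausdorff_space (bd_top S \<kappa> i)" by (simp add: bd_top_def Hausdorff_space_subtopology)
  show "continuous_map (mtop torus3) (bd_top S \<kappa> i) (bd_param \<kappa> i)"
    using continuous_bd_param[OF i] by (auto simp: bd_top_def bd_torus_def continuous_map_in_subtopology)
  show "bd_param \<kappa> i ` topspace (mtop torus3) = topspace (bd_top S \<kappa> i)"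
    using topspace_bd_top[OF i] by (simp add: bd_torus_def)
  have "inj_on (\<kappa> i) (sphere 0 1)" using circle_diffeo(1)[OF i] by (rule bij_betw_imp_inj_on)
  then show "inj_on (bd_param \<kappa> i) (topspace (mtop torus3))"
    by (auto simp: inj_on_def bd_param_def torus3_def prod_mfd_def circle_def)
qed

lemma lattice_cover_bd: "i \<in> I \<Longrightarrow> lattice_cover (bd_top S \<kappa> i) (bd_cover i)"
  unfolding bd_cover_def by (rule lattice_cover_homeomorphic[OF lattice_cover_torus3 bd_homeomorphic])

text \<open>The circle coordinate is recovered by the inverse of \<open>\<kappa> i\<close>, which is
  smooth on the boundary circle; both components are then lifts through angular parameters.\<close>

lemma bd_lift_differentiable:
  assumes i: "i \<in> I" and \<theta>: "chart_differentiable (block S) (bd_cover i \<circ> F)" and F: "continuous_on UNIV F"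
  shows "F differentiable (at x)"
proof -
  have 1: "chart_differentiable S (fst \<circ> (bd_cover i \<circ> F))"
  proof (rule chart_differentiable_fst)
    show "chart_differentiable (prod_mfd S torus2) (bd_cover i \<circ> F)" using \<theta> by (simp add: block_def)
    fix q assume "q \<in> topspace (mtop torus2)"
    then obtain y where "q = param2 y" using torus2.range_param by (metis rangeE)
    then show "\<exists>c\<in>matlas torus2. q \<in> cdom c" using torus2.chart_at[of y] torus2.chart_dom_eq by blast
  qed
  have "chart_differentiable circle (the_inv_into (sphere 0 1) (\<kappa> i) \<circ> (fst \<circ> (bd_cover i \<circ> F)))"
    by (rule smooth_map_on_chart_differentiable[OF charted_S.charted_axioms circle.chart_dom 1 _ circle_diffeo(3)[OF i]])
      (auto simp: bd_cover_apply)
  also have "the_inv_into (sphere 0 1) (\<kappa> i) \<circ> (fst \<circ> (bd_cover i \<circ> F)) = cis \<circ> (fst \<circ> F)"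
    using the_inv_into_f_f[OF bij_betw_imp_inj_on[OF circle_diffeo(1)[OF i]]] by (auto simp: fun_eq_iff bd_cover_apply)
  finally have f: "(fst \<circ> F) differentiable (at x)"
    by (rule circle.lift_differentiable) (use F in \<open>auto simp: o_def intro!: continuous_intros\<close>)
  have "chart_differentiable torus2 (snd \<circ> (bd_cover i \<circ> F))"
    by (rule chart_differentiable_snd[of S]) (use \<theta> charted_S.dom_cover in \<open>auto simp: block_def\<close>)
  also have "snd \<circ> (bd_cover i \<circ> F) = param2 \<circ> (snd \<circ> F)" by (auto simp: fun_eq_iff bd_cover_apply)
  finally have s: "(snd \<circ> F) differentiable (at x)"
    by (rule torus2.lift_differentiable) (use F in \<open>auto simp: o_def intro!: continuous_intros\<close>)
  have "(\<lambda>z. ((fst \<circ> F) z, (snd \<circ> F) z)) differentiable (at x)"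
    using f s unfolding differentiable_def by (blast intro: has_derivative_Pair)
  then show ?thesis by simp
qed

text \<open>Both boundary metrics are pulled back from one metric on \<open>M\<close>, and the
  projection takes the same value at glued points. A lift of the gluing is therefore an isometry of
  the covers, and its linear part computes the action on periods.\<close>

lemma gluing_period:
  assumes i: "i \<in> I" and j: "j \<in> I"
    and \<psi>: "diffeo_betw (block S) (bd_torus \<kappa> i) (block S) (bd_torus \<kappa> j) \<psi>"
    and gb: "gb = pullback (block S) M \<pi> g" and M: "charted M"
    and \<pi>: "smooth_map_on (block S) (topspace (mtop (block S))) M \<pi>"
    and inv: "\<And>x. x \<in> bd_torus \<kappa> i \<Longrightarrow> \<pi> (\<psi> x) = \<pi> x"
    and D: "flat_torus (bd_metric i) D" and D': "flat_torus (bd_metric j) D'"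
  obtains B where "linear B" "\<And>v. norm (period_map D' (B v)) = norm (period_map D v)"
    "\<And>\<alpha>. \<alpha> \<in> carrier (homology_group 1 (bd_top S \<kappa> i)) \<Longrightarrow>
       lattice_cover.period (bd_cover j) (hom_induced 1 (bd_top S \<kappa> i) {} (bd_top S \<kappa> j) {} \<psi> \<alpha>)
         = B (lattice_cover.period (bd_cover i) \<alpha>)"
proof -
  note Xi = lattice_cover_bd[OF i] and Xj = lattice_cover_bd[OF j]
  have sm: "smooth_map_on (block S) (bd_torus \<kappa> i) (block S) \<psi>"
    and bij: "bij_betw \<psi> (bd_torus \<kappa> i) (bd_torus \<kappa> j)" using \<psi> by (auto simp: diffeo_betw_def)
  have cont: "continuous_map (bd_top S \<kappa> i) (bd_top S \<kappa> j) \<psi>"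
    using sm bij_betw_imp_surj_on[OF bij] topspace_bd_top[OF i]
    by (auto simp: smooth_map_on_def bd_top_def continuous_map_in_subtopology)
  have inj: "inj_on \<psi> (topspace (bd_top S \<kappa> i))"
    using bij_betw_imp_inj_on[OF bij] topspace_bd_top[OF i] by simp
  obtain F where F: "continuous_on UNIV F" "\<And>x. bd_cover j (F x) = \<psi> (bd_cover i x)"
    "\<forall>x. \<forall>l\<in>period_lattice. F (x + l) - F x \<in> period_lattice"
    "\<forall>x y. F x = F y \<longrightarrow> x - y \<in> period_lattice"
    using lattice_cover_lift[OF Xi Xj cont] inj by metis
  have lift: "bd_cover j \<circ> F = \<psi> \<circ> bd_cover i" using F(2) by auto
  have "chart_differentiable (block S) (bd_cover j \<circ> F)" unfolding lift
    by (rule smooth_map_on_chart_differentiable[OF charted_block.charted_axioms charted_block.dom_open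
        bd_cover_differentiable[OF i] _ sm]) (simp_all add: range_bd_cover)
  then have dF: "F differentiable (at x)" for x by (rule bd_lift_differentiable[OF j _ F(1)])
  note push = cover_metric_pullback[OF charted_block.charted_axioms M bd_cover_differentiable \<pi>]
  have \<pi>F: "(\<pi> \<circ> bd_cover j) \<circ> F = \<pi> \<circ> bd_cover i"
  proof
    fix x
    have "bd_cover i x \<in> bd_torus \<kappa> i" using range_bd_cover by blast
    then show "((\<pi> \<circ> bd_cover j) \<circ> F) x = (\<pi> \<circ> bd_cover i) x" using inv F(2) by simp
  qed
  have metric: "bd_metric k = cover_metric M (\<pi> \<circ> bd_cover k) g" if "k \<in> I" for k
    unfolding bd_metric_def using push(1)[OF that] gb by (intro ext) simp
  have "\<exists>F'. (F has_derivative F') (at x) \<and> (\<forall>v w. bd_metric j (F x) (F' v) (F' w) = bd_metric i x v w)" for x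
  proof -
    obtain F' where F': "(F has_derivative F') (at x)" using dF unfolding differentiable_def by blast
    have "bd_metric j (F x) (F' v) (F' w) = bd_metric i x v w" for v w
      using charted.cover_metric_compose[OF M push(2)[OF j] F', of g v w] \<pi>F
      by (simp add: metric i j)
    then show ?thesis using F' by blast
  qed
  note iso = isometric_lift_period[OF D D' F(1,3,4) this]
  show ?thesis
    by (rule that[OF linear_period_map iso(3) period_natural[OF Xi Xj cont F(1,2) linear_period_map iso(1)]])
qed

lemma fiber_hom_period:
  assumes i: "i \<in> I" and \<alpha>: "\<alpha> \<in> carrier (homology_group 1 (mtop torus2))"
  shows "lattice_cover.period (bd_cover i) (fiber_hom S \<kappa> i \<alpha>) = (0, lattice_cover.period param2 \<alpha>)"
  unfolding fiber_hom_def
proof (rule period_natural[OF lattice_cover_torus2 lattice_cover_bd[OF i], where F = "\<lambda>x. (0, x)"])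
  have s: "\<kappa> i 1 \<in> topspace (mtop S)" by (rule circle_point[OF i]) simp
  have "fiber (\<kappa> i 1) ` topspace (mtop torus2) \<subseteq> bd_torus \<kappa> i"
    by (force simp: bd_torus_def bd_param_def fiber_def torus3_def prod_mfd_def circle_def)
  then show "continuous_map (mtop torus2) (bd_top S \<kappa> i) (fiber (\<kappa> i 1))"
    using continuous_fiber[OF s] by (auto simp: bd_top_def continuous_map_in_subtopology)
  show "continuous_on UNIV (\<lambda>x::real \<times> real. (0::real, x))" by (intro continuous_intros)
  show "bd_cover i (0, x) = fiber (\<kappa> i 1) (param2 x)" for x by (simp add: bd_cover_fiber fiber_cover_def)
  show "linear (\<lambda>x::real \<times> real. (0::real, x))" by (auto intro!: linearI)
  show "(0::real, x + l) = (0, x) + (0, l)" for x l :: "real \<times> real" by simp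
qed (rule \<alpha>)

text \<open>Constancy over the fibers is known for lattice vectors only and extends to all vectors
  by polarization; this makes the form independent of the boundary torus.\<close>

lemma bd_period_norm:
  assumes S: "connected_space (mtop S)" and i: "i \<in> I" and t: "t \<in> topspace (mtop S)"
    and D: "flat_torus (bd_metric i) D"
  shows "norm (period_map D (0, v)) = fiber_norm t v"
proof -
  have s: "\<kappa> i 1 \<in> topspace (mtop S)" by (rule circle_point[OF i]) simp
  have "fiber_norm (\<kappa> i 1) v = fiber_norm t v"
    unfolding fiber_norm_def
    by (rule lattice_norm_determines[OF linear_period_map linear_period_map])
      (rule fiber_norm_constant[OF S s t, unfolded fiber_norm_def])
  then show ?thesis using fiber_period[OF i some_flat_torus[OF s] D, of v] by (simp add: fiber_norm_def)
qed

end

section \<open>The contradiction from the gluing matrices\<close>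

theorem theorem6p1:
  fixes S :: "('a, real^2) mfd"
    and M :: "('b, real^4) mfd"
    and \<kappa> :: "int \<Rightarrow> complex \<Rightarrow> 'a"
    and \<psi> :: "int \<Rightarrow> 'a \<times> complex \<times> complex \<Rightarrow> 'a \<times> complex \<times> complex"
    and \<pi> :: "'a \<times> complex \<times> complex \<Rightarrow> 'b"
    and f :: "2 \<Rightarrow> (complex \<times> complex) chain set"
    and z :: "int \<Rightarrow> ('a \<times> complex \<times> complex) chain set"
  assumes "oriented_surface S"
    and "compact_space (mtop S)" and "connected_space (mtop S)"
    and "boundary_circles S {-3..3} \<kappa>"
    and "graph_gluing S \<kappa> {1..3} \<psi>"
    and "glued_manifold S \<kappa> {1..3} \<psi> M \<pi>"
    and "mboundary M = \<pi> ` bd_torus \<kappa> 0"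
    and "waldhausen_basis S {-3..3} \<kappa> f z"
    and "\<And>i. i \<in> {1..3} \<Longrightarrow>
           gluing_matrix S \<kappa> \<psi> f z i
             (vector [vector [1, 1, i - 1],
                      vector [0, 1, 1],
                      vector [0, 3, 2]])"
  shows "\<not> (\<exists>g. geometrization S {-3..3} \<kappa> M \<pi> g)"
proof
  assume "\<exists>g. geometrization S {-3..3} \<kappa> M \<pi> g"
  then obtain g where g: "geometrization S {-3..3} \<kappa> M \<pi> g" ..
  define gb where "gb = pullback (block S) M \<pi> g"
  interpret geometrized_block S "{-3..3}" \<kappa> gb
    using assms(1,4) g by unfold_locales (simp_all add: oriented_surface_def geometrization_def gb_def)
  have M: "charted M" and \<pi>: "smooth_map_on (block S) (topspace (mtop (block S))) M \<pi>"
    using assms(6) smooth_manifold_charted by (auto simp: glued_manifold_def immersion_def)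
  have f: "zbasis (homology_group 1 (mtop torus2)) f"
    and frame: "\<And>i. i \<in> {-3..3} \<Longrightarrow> zbasis (homology_group 1 (bd_top S \<kappa> i)) (bd_frame S \<kappa> f z i)"
    using assms(8) by (auto simp: waldhausen_basis_def)
  have f_carrier: "f k \<in> carrier (homology_group 1 (mtop torus2))" for k
    using f by (auto simp: zbasis_def)
  define t where "t = \<kappa> 0 1"
  have t: "t \<in> topspace (mtop S)" unfolding t_def by (rule circle_point) simp_all
  define T where "T = period_map (SOME D. flat_torus (fiber_metric t) D)"
  interpret T: flat_torus "fiber_metric t" "SOME D. flat_torus (fiber_metric t) D" by (rule some_flat_torus[OF t])
  have T: "linear T" unfolding T_def by (rule linear_period_map)
  define x where "x k = lattice_cover.period param2 (f k)" for k
  \<comment> \<open>\<open>\<zeta>\<close> stands for the period of z on the i-th torus. Lengths are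
    compared only for vectors tangent to the fibers on both sides, because only there are both given
    by the common form.\<close>
  have gluing: "\<exists>(B :: real \<times> real \<times> real \<Rightarrow> real \<times> real \<times> real) \<zeta>. linear B \<and> (\<forall>v w. (0, w) = B (0, v) \<longrightarrow> norm (T w) = norm (T v)) \<and>
      (0, x 1) = B (\<zeta> + (0, x 1) + 3 *\<^sub>R (0, x 2)) \<and> (0, x 2) = B ((i - 1) *\<^sub>R \<zeta> + (0, x 1) + 2 *\<^sub>R (0, x 2))"
    if "i \<in> {1..3}" for i :: int
  proof -
    have i: "i \<in> {-3..3}" "- i \<in> {-3..3}" using that by auto
    interpret Xi: lattice_cover "bd_top S \<kappa> i" "bd_cover i" by (rule lattice_cover_bd[OF i(1)])
    have \<psi>: "diffeo_betw (block S) (bd_torus \<kappa> i) (block S) (bd_torus \<kappa> (- i)) (\<psi> i)"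
      using assms(5) that by (simp add: graph_gluing_def)
    have inv: "\<pi> (\<psi> i x) = \<pi> x" if "x \<in> bd_torus \<kappa> i" for x
    proof -
      have "\<psi> i x \<in> bd_torus \<kappa> (- i)" using \<psi> that by (auto simp: diffeo_betw_def bij_betw_def)
      then have "x \<in> topspace (mtop (block S))" "\<psi> i x \<in> topspace (mtop (block S))"
        using that topspace_bd_top[OF i(1)] topspace_bd_top[OF i(2)] by (auto simp: bd_top_def)
      then show ?thesis using assms(6) \<open>i \<in> {1..3}\<close> that unfolding glued_manifold_def by metis
    qed
    obtain D where D: "flat_torus (bd_metric i) D" using flat_torus_bd[OF i(1)] .
    obtain D' where D': "flat_torus (bd_metric (- i)) D'" using flat_torus_bd[OF i(2)] .
    obtain B where B: "linear B" "\<And>v. norm (period_map D' (B v)) = norm (period_map D v)"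
      "\<And>\<alpha>. \<alpha> \<in> carrier (homology_group 1 (bd_top S \<kappa> i)) \<Longrightarrow>
         lattice_cover.period (bd_cover (- i)) (hom_induced 1 (bd_top S \<kappa> i) {} (bd_top S \<kappa> (- i)) {} (\<psi> i) \<alpha>)
           = B (Xi.period \<alpha>)"
      using gluing_period[OF i \<psi> gb_def M \<pi> inv D D'] by metis
    let ?b = "bd_frame S \<kappa> f z i" and ?G = "homology_group 1 (bd_top S \<kappa> i)"
    let ?A = "vector [vector [1, 1, i - 1], vector [0, 1, 1], vector [0, 3, 2]] :: int^3^3"
    have b: "range ?b \<subseteq> carrier ?G" "zcomb ?G ?b n \<in> carrier ?G" for n
      using frame[OF i(1)] by (auto simp: zbasis_def bij_betw_def)
    have per: "lattice_cover.period (bd_cover (- i)) (bd_frame S \<kappa> f z (- i) k)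
        = B (\<Sum>l\<in>UNIV. of_int (?A $ l $ k) *\<^sub>R Xi.period (?b l))" for k
    proof -
      have "bd_frame S \<kappa> f z (- i) k =
          hom_induced 1 (bd_top S \<kappa> i) {} (bd_top S \<kappa> (- i)) {} (\<psi> i) (zcomb ?G ?b (\<lambda>l. ?A $ l $ k))"
        using assms(9)[OF that] unfolding gluing_matrix_def by (rule spec)
      then show ?thesis by (simp only: B(3)[OF b(2)] Xi.period_zcomb[OF b(1)])
    qed
    note fp = fiber_hom_period[OF _ f_carrier, folded x_def]
    have norm: "norm (T w) = norm (T v)" if "(0, w) = B (0, v)" for v w
      using B(2)[of "(0, v)"] bd_period_norm[OF assms(3) i(1) t D, of v] bd_period_norm[OF assms(3) i(2) t D', of w] that
      by (simp add: T_def fiber_norm_def)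
    have sum: "(\<Sum>l\<in>UNIV. of_int (?A $ l $ 2) *\<^sub>R Xi.period (?b l)) = Xi.period (z i) + (0, x 1) + 3 *\<^sub>R (0, x 2)"
      "(\<Sum>l\<in>UNIV. of_int (?A $ l $ 3) *\<^sub>R Xi.period (?b l)) = (i - 1) *\<^sub>R Xi.period (z i) + (0, x 1) + 2 *\<^sub>R (0, x 2)"
      by (simp_all add: sum_3 vector_3 bd_frame_def fp[OF i(1)])
    have "lattice_cover.period (bd_cover (- i)) (bd_frame S \<kappa> f z (- i) 2) = (0, x 1)"
      "lattice_cover.period (bd_cover (- i)) (bd_frame S \<kappa> f z (- i) 3) = (0, x 2)"
      by (simp_all add: bd_frame_def fp[OF i(2)])
    then have p: "(0, x 1) = B (Xi.period (z i) + (0, x 1) + 3 *\<^sub>R (0, x 2))"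
      "(0, x 2) = B ((i - 1) *\<^sub>R Xi.period (z i) + (0, x 1) + 2 *\<^sub>R (0, x 2))"
      using per[of 2] per[of 3] unfolding sum by (simp_all only:)
    show ?thesis
      by (intro exI[of _ B] exI[of _ "Xi.period (z i)"] conjI allI impI B(1) p) (rule norm)
  qed
  have i12: "1 \<in> {1..3::int}" "2 \<in> {1..3::int}" by auto
  obtain B :: "real \<times> real \<times> real \<Rightarrow> real \<times> real \<times> real" and \<zeta> where B: "\<And>v w. (0, w) = B (0, v) \<Longrightarrow> norm (T w) = norm (T v)"
    "(0, x 2) = B (of_int (1 - 1) *\<^sub>R \<zeta> + (0, x 1) + 2 *\<^sub>R (0, x 2))"
    using gluing[OF i12(1)] by blast
  \<comment> \<open>For i = 1 the coefficient of \<open>\<zeta>\<close> in the third column is 0, so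
    the argument is tangent to the fiber.\<close>
  have e: "of_int (1 - 1) *\<^sub>R \<zeta> + (0, x 1) + 2 *\<^sub>R (0, x 2) = (0, x 1 + 2 *\<^sub>R x 2)" by simp
  have "norm (T (x 2)) = norm (T (x 1 + 2 *\<^sub>R x 2))" by (rule B(1)[OF B(2)[unfolded e]])
  then have 1: "T (x 2) \<bullet> T (x 2) = (T (x 1) + 2 *\<^sub>R T (x 2)) \<bullet> (T (x 1) + 2 *\<^sub>R T (x 2))"
    by (simp add: norm_eq linear_add[OF T] linear_scale[OF T])
  obtain B :: "real \<times> real \<times> real \<Rightarrow> real \<times> real \<times> real" and \<zeta> where B: "linear B" "\<And>v w. (0, w) = B (0, v) \<Longrightarrow> norm (T w) = norm (T v)"
    "(0, x 1) = B (\<zeta> + (0, x 1) + 3 *\<^sub>R (0, x 2))" "(0, x 2) = B (of_int (2 - 1) *\<^sub>R \<zeta> + (0, x 1) + 2 *\<^sub>R (0, x 2))"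
    using gluing[OF i12(2)] by blast
  \<comment> \<open>For i = 2 both columns contain \<open>\<zeta>\<close> with coefficient 1, and
    the difference is tangent to the fiber.\<close>
  have "(0::real, x 1 - x 2) = (0, x 1) - (0, x 2)" by simp
  also have "\<dots> = B ((\<zeta> + (0, x 1) + 3 *\<^sub>R (0, x 2)) - (of_int (2 - 1) *\<^sub>R \<zeta> + (0, x 1) + 2 *\<^sub>R (0, x 2)))"
    by (simp only: B(3,4)[symmetric] linear_diff[OF B(1)])
  also have "(\<zeta> + (0, x 1) + 3 *\<^sub>R (0, x 2)) - (of_int (2 - 1) *\<^sub>R \<zeta> + (0, x 1) + 2 *\<^sub>R (0, x 2)) = (0, x 2)"
    using scaleR_add_left[of 2 1 "x 2"] by (simp add: algebra_simps)
  finally have "norm (T (x 1 - x 2)) = norm (T (x 2))" by (rule B(2))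
  then have 2: "(T (x 1) - T (x 2)) \<bullet> (T (x 1) - T (x 2)) = T (x 2) \<bullet> T (x 2)"
    by (simp add: norm_eq linear_diff[OF T])
  \<comment> \<open>Twice the second relation added to the first eliminates the mixed
    product.\<close>
  have "3 * (T (x 1) \<bullet> T (x 1)) + 3 * (T (x 2) \<bullet> T (x 2)) = 0"
    using 1 2 inner_commute[of "T (x 2)" "T (x 1)"]
    by (simp add: inner_add_left inner_add_right inner_diff_left inner_diff_right)
  then have "T (x 1) \<bullet> T (x 1) = 0" "T (x 2) \<bullet> T (x 2) = 0"
    using inner_ge_zero[of "T (x 1)"] inner_ge_zero[of "T (x 2)"] by linarith+
  then have x0: "x 1 = 0" "x 2 = 0" using T.period_map_eq_0 by (auto simp: T_def)
  interpret F: lattice_cover "mtop torus2" param2 by (rule lattice_cover_torus2)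
  \<comment> \<open>A class with nonzero period is an integer combination of the basis
    \<open>f\<close>, whose periods have just been shown to vanish.\<close>
  obtain \<alpha> where \<alpha>: "\<alpha> \<in> carrier (homology_group 1 (mtop torus2))" "F.period \<alpha> = (2 * pi) *\<^sub>R (1, 0)"
    by (rule F.exists_period[of "(1, 0)"]) (auto simp: Basis_prod_def)
  obtain n where n: "\<alpha> = zcomb (homology_group 1 (mtop torus2)) f n"
    using f \<alpha>(1) unfolding zbasis_def bij_betw_def by blast
  have "F.period \<alpha> = 0"
    unfolding n using F.period_zcomb[of f n] f_carrier x0 by (simp add: sum_2 x_def image_subset_iff)
  then show False using \<alpha>(2) by (simp add: prod_eq_iff)
qed

end
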